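(* The monoid $\mathcal{BR}(\mathcal{B}r_n)$ is presented by generators $e_1,\ldots,e_{n-1}$, $z_1,\ldots,z_{n-1}$, $d_1,\ldots,d_{n-1}$ subject to the relations: $e_i^2=e_i$, $e_ie_j=e_je_i$; $z_iz_jz_i=z_jz_iz_j$ ($|i-j|=1$), $z_iz_j=z_jz_i$ ($|i-j|>1$), $e_iz_j=z_je_i$, $z_i^2=e_i$, $e_iz_i=z_i$; $d_i^2=d_i$, $d_id_j=d_jd_i$ ($|i-j|>1$); $d_ie_j=e_jd_i$, $d_ie_i=d_i$, $d_id_jd_i=e_jd_ie_j$ ($|i-j|=1$); $z_id_jd_i=z_jd_i$ and $d_id_jz_i=d_iz_j$ ($|i-j|=1$), $z_id_i=d_i=d_iz_i$, $z_id_j=d_jz_i$ ($|i-j|>1$).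
   Context: $\mathfrak{C}_n$ is the partition monoid: set partitions of $[2n]$ (top points $1..n$, bottom $n+1..2n$) with concatenation product $*$ (identify bottom point $n+i$ of the first with top point $i$ of the second, join blocks transitively, delete middle points). $I\preceq J$ means each block of $J$ is a union of blocks of $I$. The Brauer monoid $\mathcal{B}r_n$ is the submonoid of set partitions all of whose blocks have exactly two elements; it contains $\mathfrak{S}_n$ (blocks $\{i,n+j\}$), with simple transpositions $s_i$, identity $1=\{\{i,n+i\}\}$, and $t_i$ = the partition with blocks $\{i,i+1\}$, $\{n+i,n+i+1\}$ and $\{j,n+j\}$ for $j\ne i,i+1$. A set partition $J$ of $[2n]$ is boxed if $1\preceq J$ and $J$ restricted to $[n]$ has interval blocks. $\mathcal{BR}(\mathcal{B}r_n)$ is the monoid of pairs $(I,J)$ with $I\in\mathcal{B}r_n$, $J$ boxed, $I\preceq J$, with product $(I,J)(H,K)=(I*H,J*K)$. $b_i$ merges the blocks $\{i,n+i\}$ and $\{i+1,n+i+1\}$ of $1$; $e_i=(1,b_i)$, $z_i=(s_i,b_i)$, $d_i=(t_i,b_i)$. Relations quantified without a condition on $i,j$ hold for all $i,j\in[n-1]$. *)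

theory Defs
  imports Main "HOL-Library.Disjoint_Sets"
begin

text \<open>A set partition of [2n] is a set of blocks (sets of naturals) partitioning {1..2n};
  top points 1..n, bottom points n+1..2n.\<close>

definition is_setpart :: "nat \<Rightarrow> nat set set \<Rightarrow> bool" where
  "is_setpart n P \<longleftrightarrow> partition_on {1..2*n} P"

definition blockrel :: "nat set set \<Rightarrow> (nat \<times> nat) set" where
  "blockrel P = {(x,y). \<exists>B\<in>P. x \<in> B \<and> y \<in> B}"

definition shiftp :: "nat \<Rightarrow> nat set set \<Rightarrow> nat set set" where
  "shiftp k P = (\<lambda>B. (\<lambda>x. x + k) ` B) ` P"

text \<open>Concatenation I * H: points of I keep their labels (its bottom points n+1..2n become the
  middle row), points of H are shifted by n (its top points become the middle row n+1..2n,
  its bottom points become 2n+1..3n). Blocks are joined transitively, middle points are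
  deleted, and the bottom row 2n+1..3n is relabelled to n+1..2n.\<close>

definition concat :: "nat \<Rightarrow> nat set set \<Rightarrow> nat set set \<Rightarrow> nat set set" where
  "concat n I H =
     (let R = (blockrel I \<union> blockrel (shiftp n H))\<^sup>*;
          outer = {1..n} \<union> {2*n+1..3*n};
          f = (\<lambda>x::nat. if x \<le> n then x else x - n)
      in {f ` (R `` {x} \<inter> outer) | x. x \<in> outer})"

definition refines :: "nat set set \<Rightarrow> nat set set \<Rightarrow> bool" where
  "refines I J \<longleftrightarrow> (\<forall>B\<in>J. \<exists>S\<subseteq>I. B = \<Union>S)"

definition id_part :: "nat \<Rightarrow> nat set set" where
  "id_part n = {{i, n+i} | i. i \<in> {1..n}}"

definition brauer :: "nat \<Rightarrow> nat set set \<Rightarrow> bool" where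
  "brauer n I \<longleftrightarrow> is_setpart n I \<and> (\<forall>B\<in>I. card B = 2)"

definition interval_set :: "nat set \<Rightarrow> bool" where
  "interval_set A \<longleftrightarrow> (\<forall>x y z. x \<in> A \<and> z \<in> A \<and> x \<le> y \<and> y \<le> z \<longrightarrow> y \<in> A)"

definition restrict_top :: "nat \<Rightarrow> nat set set \<Rightarrow> nat set set" where
  "restrict_top n J = (\<lambda>B. B \<inter> {1..n}) ` J - {{}}"

definition boxed :: "nat \<Rightarrow> nat set set \<Rightarrow> bool" where
  "boxed n J \<longleftrightarrow> is_setpart n J \<and> refines (id_part n) J
      \<and> (\<forall>B\<in>restrict_top n J. interval_set B)"

definition BR :: "nat \<Rightarrow> (nat set set \<times> nat set set) set" where
  "BR n = {(I,J). brauer n I \<and> boxed n J \<and> refines I J}"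

definition brmult :: "nat \<Rightarrow> (nat set set \<times> nat set set) \<Rightarrow> (nat set set \<times> nat set set)
    \<Rightarrow> (nat set set \<times> nat set set)" where
  "brmult n x y = (concat n (fst x) (fst y), concat n (snd x) (snd y))"

definition brone :: "nat \<Rightarrow> nat set set \<times> nat set set" where
  "brone n = (id_part n, id_part n)"

definition s_part :: "nat \<Rightarrow> nat \<Rightarrow> nat set set" where
  "s_part n i = {{i, n+i+1}, {i+1, n+i}} \<union> {{j, n+j} | j. j \<in> {1..n} \<and> j \<noteq> i \<and> j \<noteq> i+1}"

definition t_part :: "nat \<Rightarrow> nat \<Rightarrow> nat set set" where
  "t_part n i = {{i, i+1}, {n+i, n+i+1}} \<union> {{j, n+j} | j. j \<in> {1..n} \<and> j \<noteq> i \<and> j \<noteq> i+1}"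

definition b_part :: "nat \<Rightarrow> nat \<Rightarrow> nat set set" where
  "b_part n i = {{i, i+1, n+i, n+i+1}} \<union> {{j, n+j} | j. j \<in> {1..n} \<and> j \<noteq> i \<and> j \<noteq> i+1}"

datatype gen = E nat | Z nat | D nat

fun gidx :: "gen \<Rightarrow> nat" where
  "gidx (E i) = i" | "gidx (Z i) = i" | "gidx (D i) = i"

fun gen_el :: "nat \<Rightarrow> gen \<Rightarrow> nat set set \<times> nat set set" where
  "gen_el n (E i) = (id_part n, b_part n i)"
| "gen_el n (Z i) = (s_part n i, b_part n i)"
| "gen_el n (D i) = (t_part n i, b_part n i)"

definition words :: "nat \<Rightarrow> gen list set" where
  "words n = {w. \<forall>g\<in>set w. 1 \<le> gidx g \<and> gidx g < n}"

fun eval :: "nat \<Rightarrow> gen list \<Rightarrow> nat set set \<times> nat set set" where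
  "eval n [] = brone n"
| "eval n (g # w) = brmult n (gen_el n g) (eval n w)"

definition adj :: "nat \<Rightarrow> nat \<Rightarrow> bool" where
  "adj i j \<longleftrightarrow> i = j + 1 \<or> j = i + 1"

definition far :: "nat \<Rightarrow> nat \<Rightarrow> bool" where
  "far i j \<longleftrightarrow> i + 1 < j \<or> j + 1 < i"

inductive_set rels :: "nat \<Rightarrow> (gen list \<times> gen list) set" for n where
  ee:   "\<lbrakk>1 \<le> i; i < n\<rbrakk> \<Longrightarrow> ([E i, E i], [E i]) \<in> rels n"
| ecomm: "\<lbrakk>1 \<le> i; i < n; 1 \<le> j; j < n\<rbrakk> \<Longrightarrow> ([E i, E j], [E j, E i]) \<in> rels n"
| zbraid: "\<lbrakk>1 \<le> i; i < n; 1 \<le> j; j < n; adj i j\<rbrakk> \<Longrightarrow> ([Z i, Z j, Z i], [Z j, Z i, Z j]) \<in> rels n"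
| zcomm: "\<lbrakk>1 \<le> i; i < n; 1 \<le> j; j < n; far i j\<rbrakk> \<Longrightarrow> ([Z i, Z j], [Z j, Z i]) \<in> rels n"
| ez:   "\<lbrakk>1 \<le> i; i < n; 1 \<le> j; j < n\<rbrakk> \<Longrightarrow> ([E i, Z j], [Z j, E i]) \<in> rels n"
| zz:   "\<lbrakk>1 \<le> i; i < n\<rbrakk> \<Longrightarrow> ([Z i, Z i], [E i]) \<in> rels n"
| ezi:  "\<lbrakk>1 \<le> i; i < n\<rbrakk> \<Longrightarrow> ([E i, Z i], [Z i]) \<in> rels n"
| dd:   "\<lbrakk>1 \<le> i; i < n\<rbrakk> \<Longrightarrow> ([D i, D i], [D i]) \<in> rels n"
| dcomm: "\<lbrakk>1 \<le> i; i < n; 1 \<le> j; j < n; far i j\<rbrakk> \<Longrightarrow> ([D i, D j], [D j, D i]) \<in> rels n"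
| de:   "\<lbrakk>1 \<le> i; i < n; 1 \<le> j; j < n\<rbrakk> \<Longrightarrow> ([D i, E j], [E j, D i]) \<in> rels n"
| dei:  "\<lbrakk>1 \<le> i; i < n\<rbrakk> \<Longrightarrow> ([D i, E i], [D i]) \<in> rels n"
| ddd:  "\<lbrakk>1 \<le> i; i < n; 1 \<le> j; j < n; adj i j\<rbrakk> \<Longrightarrow> ([D i, D j, D i], [E j, D i, E j]) \<in> rels n"
| zdd:  "\<lbrakk>1 \<le> i; i < n; 1 \<le> j; j < n; adj i j\<rbrakk> \<Longrightarrow> ([Z i, D j, D i], [Z j, D i]) \<in> rels n"
| ddz:  "\<lbrakk>1 \<le> i; i < n; 1 \<le> j; j < n; adj i j\<rbrakk> \<Longrightarrow> ([D i, D j, Z i], [D i, Z j]) \<in> rels n"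
| zd:   "\<lbrakk>1 \<le> i; i < n\<rbrakk> \<Longrightarrow> ([Z i, D i], [D i]) \<in> rels n"
| dz:   "\<lbrakk>1 \<le> i; i < n\<rbrakk> \<Longrightarrow> ([D i, Z i], [D i]) \<in> rels n"
| zdfar: "\<lbrakk>1 \<le> i; i < n; 1 \<le> j; j < n; far i j\<rbrakk> \<Longrightarrow> ([Z i, D j], [D j, Z i]) \<in> rels n"

inductive_set congr :: "nat \<Rightarrow> (gen list \<times> gen list) set" for n where
  base: "(u, v) \<in> rels n \<Longrightarrow> (u, v) \<in> congr n"
| refl: "(u, u) \<in> congr n"
| sym: "(u, v) \<in> congr n \<Longrightarrow> (v, u) \<in> congr n"
| trans: "(u, v) \<in> congr n \<Longrightarrow> (v, w) \<in> congr n \<Longrightarrow> (u, w) \<in> congr n"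
| ctx: "(u, v) \<in> congr n \<Longrightarrow> (a @ u @ b, a @ v @ b) \<in> congr n"

end

(*
  Write e_T for the product of the central idempotents e_i with i in T. The second component of the
  value of a word only records the set T of indices occurring in it, and modulo e_T the letters e_i
  become trivial, so everything reduces to the parabolic Brauer monoid with generators z_i, d_i (i in T).
  There, transpositions (a b) and projections t_ab for arbitrary a, b in one block of T are defined as
  conjugates of the generators. Every word equals p * t_{a1 b1} ... t_{ak bk} with disjoint pairs
  and p a permutation: multiplying by t_ab on the left extends the list, is absorbed, or, by
  t_ab t_bc = (a c) t_bc, only changes p. The diagram determines the pairs and determines p up to
  permutations that preserve the set of pairs and fix all other points, and these are absorbed by
  the product of projections.
*)

theory Submission
  imports Defs "HOL-Combinatorics.Transposition"
begin

subsection \<open>Parabolic Brauer monoids acting on a set\<close>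

text \<open>An index \<open>i\<close> is the edge between the points \<open>i\<close> and
  \<open>i + 1\<close>; \<open>linked S\<close> is connectedness along the edges in
  \<open>S\<close>, so its classes are the blocks mentioned above. Two obstacles shape the proof. In
  the presented monoid \<open>Z i\<close> need not be invertible, as its square is
  \<open>E i\<close>; only modulo \<open>e_T\<close> does it become an involution, and the
  conjugations and cancellations below rest on this. That quotient depends on \<open>n\<close> and
  \<open>T\<close>, so the algebra is done for functions on an arbitrary set
  (\<open>brauer_action\<close>), and the model supplied at the end is left multiplication on chosen
  representatives. Second, a diagram only shows a permutation, whereas the normal form contains a
  word for it. That two words for one permutation act alike is the completeness of the Coxeter
  relations. It is proved by passing to all linked transpositions, where points can be eliminated
  one at a time. On the other side, a Brauer diagram is an involution of the naturals, on which left
  multiplication by a generator is an explicit operation.\<close>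

definition linked :: "nat set \<Rightarrow> nat \<Rightarrow> nat \<Rightarrow> bool" where
  "linked S a b \<longleftrightarrow> {min a b..<max a b} \<subseteq> S"

lemma linked_refl [simp]: "linked S a a"
  by (simp add: linked_def)

lemma linked_sym: "linked S a b \<Longrightarrow> linked S b a"
  by (simp add: linked_def min.commute max.commute)

lemma linked_trans:
  assumes "linked S a b" "linked S b c" shows "linked S a c"
proof -
  have "{min a c..<max a c} \<subseteq> {min a b..<max a b} \<union> {min b c..<max b c}" by auto
  then show ?thesis using assms unfolding linked_def by blast
qed

lemma linked_Suc: "i \<in> S \<Longrightarrow> linked S i (Suc i)"
  by (auto simp: linked_def min_def max_def)

lemma linked_between:
  "linked S a b \<Longrightarrow> a \<le> c \<Longrightarrow> c \<le> b \<Longrightarrow> linked S a c"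
  by (auto simp: linked_def min_def max_def)

lemma linked_transpose_left:
  assumes "linked S c d" shows "linked S a (transpose c d a)"
  using assms linked_sym[OF assms] by (auto simp: transpose_def)

lemma linked_transpose:
  assumes "linked S c d" "linked S a b" shows "linked S (transpose c d a) (transpose c d b)"
  using linked_trans linked_sym linked_transpose_left[OF assms(1)] assms(2) by meson

lemma linked_in_points: "linked S a b \<Longrightarrow> a \<noteq> b \<Longrightarrow> a \<in> S \<union> Suc ` S"
proof -
  assume l: "linked S a b" and ne: "a \<noteq> b"
  show ?thesis
  proof (cases "a < b")
    case True then show ?thesis using l by (auto simp: linked_def)
  next
    case False
    then have "b < a" using ne by simp
    then have "a - 1 \<in> S" using l by (auto simp: linked_def subset_iff)
    then show ?thesis using \<open>b < a\<close> by (metis Suc_pred' UnI2 gr0I image_eqI not_less_zero)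
  qed
qed

primrec points :: "(nat \<times> nat) list \<Rightarrow> nat set" where
  "points [] = {}"
| "points (ab # ps) = insert (fst ab) (insert (snd ab) (points ps))"

primrec pairing :: "nat set \<Rightarrow> (nat \<times> nat) list \<Rightarrow> bool" where
  "pairing S [] \<longleftrightarrow> True"
| "pairing S (ab # ps) \<longleftrightarrow> fst ab \<noteq> snd ab \<and> linked S (fst ab) (snd ab) \<and>
     fst ab \<notin> points ps \<and> snd ab \<notin> points ps \<and> pairing S ps"

text \<open>The involution that swaps each pair. It forgets the order and the orientation of the
  list, which the product of the projections does not see either (\<open>tws_cong\<close>).\<close>

primrec partner :: "(nat \<times> nat) list \<Rightarrow> nat \<Rightarrow> nat" where
  "partner [] x = x"
| "partner (ab # ps) x = (if x = fst ab then snd ab else if x = snd ab then fst ab else partner ps x)"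

lemma partner_outside: "x \<notin> points ps \<Longrightarrow> partner ps x = x"
  by (induction ps) auto

lemma partner_in_points: "x \<in> points ps \<Longrightarrow> partner ps x \<in> points ps"
  by (induction ps) auto

lemma partner_neq_iff: "pairing S ps \<Longrightarrow> partner ps x \<noteq> x \<longleftrightarrow> x \<in> points ps"
  by (induction ps) auto

lemma points_partner: "pairing S ps \<Longrightarrow> points ps = {x. partner ps x \<noteq> x}"
  using partner_neq_iff by blast

lemma partner_partner: "pairing S ps \<Longrightarrow> partner ps (partner ps x) = x"
proof (induction ps)
  case (Cons ab ps)
  then show ?case using partner_in_points[of x ps] partner_outside[of x ps]
    by (cases "x \<in> points ps") (auto split: if_splits)
qed simp

lemma linked_partner: "pairing S ps \<Longrightarrow> linked S x (partner ps x)"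
  by (induction ps) (auto simp: linked_sym)

text \<open>Relations that hold between the letters \<open>Z i\<close> and \<open>D i\<close> once
  all \<open>E i\<close> with \<open>i \<in> S\<close> act trivially. Stating them pointwise for
  functions on a set avoids a quotient monoid; the model is
  \<open>brauer_action_corner\<close>.\<close>

locale brauer_action =
  fixes S :: "nat set" and s t :: "nat \<Rightarrow> 'x \<Rightarrow> 'x"
  assumes finS: "finite S"
    and ss: "i \<in> S \<Longrightarrow> s i (s i x) = x"
    and sfar: "i \<in> S \<Longrightarrow> j \<in> S \<Longrightarrow> far i j \<Longrightarrow> s i (s j x) = s j (s i x)"
    and braid: "i \<in> S \<Longrightarrow> j \<in> S \<Longrightarrow> adj i j \<Longrightarrow> s i (s j (s i x)) = s j (s i (s j x))"
    and tt: "i \<in> S \<Longrightarrow> t i (t i x) = t i x"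
    and tfar: "i \<in> S \<Longrightarrow> j \<in> S \<Longrightarrow> far i j \<Longrightarrow> t i (t j x) = t j (t i x)"
    and stfar: "i \<in> S \<Longrightarrow> j \<in> S \<Longrightarrow> far i j \<Longrightarrow> s i (t j x) = t j (s i x)"
    and st: "i \<in> S \<Longrightarrow> s i (t i x) = t i x"
    and ts: "i \<in> S \<Longrightarrow> t i (s i x) = t i x"
    and stt: "i \<in> S \<Longrightarrow> j \<in> S \<Longrightarrow> adj i j \<Longrightarrow> s i (t j (t i x)) = s j (t i x)"
    and tts: "i \<in> S \<Longrightarrow> j \<in> S \<Longrightarrow> adj i j \<Longrightarrow> t i (t j (s i x)) = t i (s j x)"
begin

text \<open>The relations with the \<open>s i\<close> under which conjugation by \<open>s i\<close> permutes the elements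
  \<open>cs x a b\<close> defined below like the pairs \<open>{a, b}\<close>; both \<open>s\<close> and \<open>t\<close> satisfy them.\<close>

definition conj_family :: "(nat \<Rightarrow> 'x \<Rightarrow> 'x) \<Rightarrow> bool" where
  "conj_family x \<longleftrightarrow>
     (\<forall>i\<in>S. \<forall>j\<in>S. far i j \<longrightarrow> (\<forall>y. s i (x j y) = x j (s i y))) \<and>
     (\<forall>i\<in>S. \<forall>y. s i (x i y) = x i (s i y)) \<and>
     (\<forall>i\<in>S. \<forall>j\<in>S. adj i j \<longrightarrow> (\<forall>y. s j (s i (x j y)) = x i (s j (s i y))))"

text \<open>\<open>stt\<close> multiplied by the involution \<open>s j\<close>: in front of a
  projection, an adjacent projection can be traded for two transpositions.\<close>

lemma adj_tt: "i \<in> S \<Longrightarrow> j \<in> S \<Longrightarrow> adj i j \<Longrightarrow> t i (t j y) = s j (s i (t j y))"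
  using stt[of j i y] ss[of j] by (metis adj_def)

lemma conj_family_s: "conj_family s"
  unfolding conj_family_def using sfar braid by (metis adj_def)

lemma conj_family_t: "conj_family t"
  unfolding conj_family_def
proof (intro conjI ballI impI allI)
  fix i j y assume ij: "i \<in> S" "j \<in> S" "adj i j"
  \<comment> \<open>Both sides equal \<open>t i (t j y)\<close>: the left one by
    \<open>adj_tt\<close>, the right one by \<open>tts\<close> after inserting \<open>s i\<close>
    twice.\<close>
  have "s j (s i (t j y)) = t i (t j y)" using adj_tt ij by simp
  also have "\<dots> = t i (t j (s i (s i y)))" using ss ij by simp
  also have "\<dots> = t i (s j (s i y))" using tts ij by simp
  finally show "s j (s i (t j y)) = t i (s j (s i y))" .
qed (use stfar st ts in auto)


section \<open>Conjugates of the generators for arbitrary linked pairs\<close>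

text \<open>\<open>cj x a k\<close> belongs to the pair of \<open>a\<close> and
  \<open>a + k + 1\<close>: it is \<open>x (a + k)\<close> conjugated by
  \<open>s (a + k - 1)\<close>, ..., \<open>s a\<close>, and thus uses exactly the indices from
  \<open>a\<close> to \<open>a + k\<close>.\<close>

primrec cj :: "(nat \<Rightarrow> 'x \<Rightarrow> 'x) \<Rightarrow> nat \<Rightarrow> nat \<Rightarrow> 'x \<Rightarrow> 'x" where
  "cj x a 0 = x a"
| "cj x a (Suc k) = (\<lambda>y. s a (cj x (Suc a) k (s a y)))"

lemma cj_outside:
  assumes "conj_family x" "{a..a+k} \<subseteq> S" "i \<in> S" "Suc i < a \<or> a + k + 1 < i"
  shows "s i (cj x a k y) = cj x a k (s i y)"
  using assms(2,4)
proof (induction k arbitrary: a y)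
  case 0
  then show ?case using assms(1,3) by (auto simp: conj_family_def far_def)
next
  case (Suc k)
  have "{Suc a..Suc a + k} \<subseteq> S" using Suc.prems(1) by auto
  moreover have "Suc i < Suc a \<or> Suc a + k + 1 < i" using Suc.prems by auto
  moreover have "far i a" "a \<in> S" using Suc.prems by (auto simp: far_def)
  ultimately show ?case using Suc.IH sfar assms(3) by auto
qed

lemma cj_inside:
  assumes "conj_family x" "{a..a+k} \<subseteq> S" "a < i" "i < a + k"
  shows "s i (cj x a k y) = cj x a k (s i y)"
  using assms(2-4)
proof (induction k arbitrary: a y)
  case (Suc k)
  have sub: "{Suc a..Suc a + k} \<subseteq> S" using Suc.prems(1) by auto
  have aS: "a \<in> S" and iS: "i \<in> S" using Suc.prems by auto
  show ?case
  proof (cases "i = Suc a")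
    case True
    \<comment> \<open>Two layers of the conjugate are unfolded: the braid relation moves
      \<open>s a\<close> inward, where it commutes with the remaining conjugate, and a second use of
      the braid relation restores the layers.\<close>
    then obtain l where l: "k = Suc l" using Suc.prems by (cases k) auto
    have far: "s a (cj x (Suc (Suc a)) l z) = cj x (Suc (Suc a)) l (s a z)" for z
      by (rule cj_outside[OF assms(1) _ aS]) (use Suc.prems l in auto)
    have br: "s i (s a (s i z)) = s a (s i (s a z))" for z
      using braid[of i a z] iS aS True by (auto simp: adj_def)
    show ?thesis using l br far True by simp
  next
    case False
    then have "s i (s a z) = s a (s i z)" for z
      using sfar iS aS Suc.prems by (auto simp: far_def)
    moreover have "s i (cj x (Suc a) k z) = cj x (Suc a) k (s i z)" for z
      using Suc.IH[OF sub] False Suc.prems by auto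
    ultimately show ?thesis by simp
  qed
qed simp

text \<open>The definition moves the lower end of a pair; this moves its upper end. For
  \<open>k = 0\<close> it is the third clause of \<open>conj_family\<close>, rearranged with
  \<open>ss\<close>; in the induction step the letter at the upper end is far from the outer letter
  \<open>s a\<close>.\<close>

lemma cj_extend:
  assumes "conj_family x" "{a..a+k+1} \<subseteq> S"
  shows "s (a+k+1) (cj x a k y) = cj x a (Suc k) (s (a+k+1) y)"
  using assms(2)
proof (induction k arbitrary: a y)
  case 0
  then have aS: "a \<in> S" "Suc a \<in> S" by auto
  have "s a (s (Suc a) (x a y)) = x (Suc a) (s a (s (Suc a) y))"
    using assms(1) aS by (auto simp: conj_family_def adj_def)
  then show ?case using ss aS by (metis add.commute add.right_neutral cj.simps plus_1_eq_Suc)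
next
  case (Suc k)
  have "{Suc a..Suc a + k + 1} \<subseteq> S" using Suc.prems by auto
  note IH = Suc.IH[OF this]
  have "a \<in> S" "Suc a + k + 1 \<in> S" using Suc.prems by auto
  then have "s (Suc a + k + 1) (s a z) = s a (s (Suc a + k + 1) z)" for z
    using sfar[of "Suc a + k + 1" a z] by (auto simp: far_def)
  then show ?case using IH by simp
qed

lemma cj_shrink:
  assumes "conj_family x" "{a..a+Suc k} \<subseteq> S"
  shows "s (a+k+1) (cj x a (Suc k) y) = cj x a k (s (a+k+1) y)"
proof -
  have m: "a+k+1 \<in> S" using assms(2) by auto
  have "s (a+k+1) (cj x a k (s (a+k+1) y)) = cj x a (Suc k) (s (a+k+1) (s (a+k+1) y))"
    by (rule cj_extend) (use assms in auto)
  then have "cj x a (Suc k) y = s (a+k+1) (cj x a k (s (a+k+1) y))" by (simp only: ss[OF m])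
  then show ?thesis by (simp only: ss[OF m])
qed

text \<open>Unordered version of \<open>cj\<close>. For \<open>a = b\<close> truncated subtraction
  makes it \<open>x a\<close>, which has no meaning; the lemmas on conjugation are about distinct
  points.\<close>

definition cs :: "(nat \<Rightarrow> 'x \<Rightarrow> 'x) \<Rightarrow> nat \<Rightarrow> nat \<Rightarrow> 'x \<Rightarrow> 'x" where
  "cs x a b = cj x (min a b) (max a b - min a b - 1)"

lemma cs_commute: "cs x a b = cs x b a"
  by (simp add: cs_def min.commute max.commute)

lemma cs_Suc [simp]: "cs x a (Suc a) = x a"
  by (simp add: cs_def min_def max_def)

lemma cs_less: "cs x a (a + k + 1) = cj x a k"
  by (simp add: cs_def min_def max_def)

lemma cs_conj_simple_less:
  assumes x: "conj_family x" and i: "i \<in> S" and ab: "linked S a (a+k+1)"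
  shows "s i (cs x a (a+k+1) y)
       = cs x (transpose i (Suc i) a) (transpose i (Suc i) (a+k+1)) (s i y)"
proof -
  have sub: "{a..a+k} \<subseteq> S" using ab by (auto simp: linked_def min_def max_def)
  have aS: "a \<in> S" using sub by auto
  \<comment> \<open>Position of the edge \<open>i\<close> relative to the pair: it moves one end in
    cases 2, 4, 6 and 7, exchanges the two ends in case 3, and otherwise touches neither end and
    commutes.\<close>
  consider "Suc i < a" | "Suc i = a" | "i = a" "k = 0" | l where "i = a" "k = Suc l"
    | "a < i" "i < a + k" | l where "i = a + k" "k = Suc l" | "i = a + k + 1" | "a + k + 1 < i"
    by (metis Suc_eq_plus1 add.right_neutral linorder_neqE_nat not_less_eq old.nat.exhaust)
  then show ?thesis
  proof cases
    case 1
    then show ?thesis using cj_outside[OF x sub i] cs_less by (auto simp: transpose_def)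
  next
    case 2
    then have a: "a = Suc i" by simp
    have "cs x i (Suc (Suc (i + k))) = cj x i (Suc k)" using cs_less[of x i "Suc k"] by simp
    then show ?thesis using ss i cs_less[of x a k] unfolding a by (auto simp: transpose_def)
  next
    case 3
    then show ?thesis using x i by (auto simp: transpose_def conj_family_def cs_commute)
  next
    case 4
    have "cs x (Suc a) (Suc a + l + 1) = cj x (Suc a) l" by (rule cs_less)
    then show ?thesis using 4 ss i cs_less[of x a k] by (auto simp: transpose_def)
  next
    case 5
    then show ?thesis using cj_inside[OF x sub] cs_less[of x a k] by (auto simp: transpose_def)
  next
    case 6
    then show ?thesis using cj_shrink[OF x, of a l y] sub cs_less[of x a k] cs_less[of x a l]
      by (auto simp: transpose_def)
  next
    case 7
    then have "{a..a+k+1} \<subseteq> S" using i sub by (auto simp: le_Suc_eq)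
    then show ?thesis using cj_extend[OF x, of a k y] 7 cs_less[of x a k] cs_less[of x a "Suc k"]
      by (auto simp: transpose_def)
  next
    case 8
    then show ?thesis using cj_outside[OF x sub i] cs_less[of x a k] by (auto simp: transpose_def)
  qed
qed

lemma cs_conj_simple:
  assumes x: "conj_family x" and i: "i \<in> S" and ab: "linked S a b" "a \<noteq> b"
  shows "s i (cs x a b y) = cs x (transpose i (Suc i) a) (transpose i (Suc i) b) (s i y)"
proof -
  consider "a < b" | "b < a" using ab by linarith
  then show ?thesis
  proof cases
    case 1
    then obtain k where "b = a + k + 1" using less_imp_Suc_add by fastforce
    then show ?thesis using cs_conj_simple_less[OF x i] ab by simp
  next
    case 2
    then obtain k where "a = b + k + 1" using less_imp_Suc_add by fastforce
    then show ?thesis using cs_conj_simple_less[OF x i, of b k] linked_sym[OF ab(1)]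
      by (simp add: cs_commute)
  qed
qed

abbreviation sw :: "nat \<Rightarrow> nat \<Rightarrow> 'x \<Rightarrow> 'x" where "sw \<equiv> cs s"
abbreviation tw :: "nat \<Rightarrow> nat \<Rightarrow> 'x \<Rightarrow> 'x" where "tw \<equiv> cs t"

section \<open>The action of the parabolic symmetric group\<close>

text \<open>A permutation and an operator given by the same word in the simple transpositions. This
  is a relation because it is not yet known that the permutation determines the operator, which will
  follow from \<open>simp_group_id\<close>.\<close>

inductive simp_group :: "(nat \<Rightarrow> nat) \<Rightarrow> ('x \<Rightarrow> 'x) \<Rightarrow> bool" where
  one: "simp_group id id"
| step: "simp_group p f \<Longrightarrow> i \<in> S \<Longrightarrow> simp_group (transpose i (Suc i) \<circ> p) (s i \<circ> f)"

lemma simp_group_comp: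
  assumes "simp_group p f" "simp_group q g" shows "simp_group (p \<circ> q) (f \<circ> g)"
  using assms by (induction rule: simp_group.induct) (auto simp: comp_assoc simp_group.step)

lemma simp_group_gen: "i \<in> S \<Longrightarrow> simp_group (transpose i (Suc i)) (s i)"
  using simp_group.step[OF simp_group.one] by fastforce

lemma simp_group_bij: "simp_group p f \<Longrightarrow> bij p"
  by (induction rule: simp_group.induct) (simp_all only: bij_comp bij_id bij_transpose)

lemma simp_group_linked: "simp_group p f \<Longrightarrow> linked S a b \<Longrightarrow> linked S (p a) (p b)"
  by (induction rule: simp_group.induct) (auto simp: linked_transpose linked_Suc)

lemma simp_group_linked_self: "simp_group p f \<Longrightarrow> linked S a (p a)"
proof (induction rule: simp_group.induct)
  case (step p f i)
  then show ?case using linked_trans linked_transpose_left[OF linked_Suc] by fastforce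
qed simp

lemma simp_group_conj:
  assumes "simp_group p f" "conj_family x" "linked S a b" "a \<noteq> b"
  shows "f (cs x a b y) = cs x (p a) (p b) (f y)"
  using assms
proof (induction arbitrary: y rule: simp_group.induct)
  case (step p f i)
  have "p a \<noteq> p b" using simp_group_bij[OF step.hyps(1)] step.prems(3) by (metis bij_pointE)
  then show ?case
    using step cs_conj_simple[OF step.prems(1) step.hyps(2), of "p a" "p b"]
      simp_group_linked[OF step.hyps(1)] by simp
qed simp

lemma simp_group_swap_less: "{a..a+k} \<subseteq> S \<Longrightarrow> simp_group (transpose a (a+k+1)) (cj s a k)"
proof (induction k arbitrary: a)
  case 0
  then show ?case using simp_group_gen by auto
next
  case (Suc k)
  have "simp_group (transpose (Suc a) (Suc a+k+1)) (cj s (Suc a) k)" 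
    by (rule Suc.IH) (use Suc.prems in auto)
  moreover have "simp_group (transpose a (Suc a)) (s a)"
    by (rule simp_group_gen) (use Suc.prems in auto)
  ultimately have *: "simp_group (transpose a (Suc a) \<circ> (transpose (Suc a) (Suc a+k+1) \<circ> transpose a (Suc a))) (s a \<circ> (cj s (Suc a) k \<circ> s a))"
    by (intro simp_group_comp)
  have "transpose a (Suc a) \<circ> (transpose (Suc a) (Suc a+k+1) \<circ> transpose a (Suc a))
     = transpose a (a + Suc k + 1)"
    by (auto simp: transpose_def fun_eq_iff)
  moreover have "s a \<circ> (cj s (Suc a) k \<circ> s a) = cj s a (Suc k)" by (simp add: fun_eq_iff)
  ultimately show ?case using * by (simp only:)
qed

lemma simp_group_swap:
  assumes "linked S a b" "a \<noteq> b" shows "simp_group (transpose a b) (sw a b)"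
proof -
  have *: "simp_group (transpose a b) (sw a b)" if lab: "linked S a b" "a < b" for a b
  proof -
    obtain k where k: "b = a + k + 1" using less_imp_Suc_add[OF lab(2)] by auto
    have "{a..a+k} \<subseteq> S" using lab k by (auto simp: linked_def min_def max_def)
    then show ?thesis unfolding k cs_less by (rule simp_group_swap_less)
  qed
  show ?thesis
  proof (cases "a < b")
    case False
    then have "b < a" using assms by simp
    then show ?thesis using *[of b a] assms linked_sym by (simp add: cs_commute transpose_commute)
  qed (use * assms in auto)
qed

lemmas sw_conj = simp_group_conj[OF simp_group_swap]

lemma sw_sw:
  assumes "linked S a b" "a \<noteq> b" shows "sw a b (sw a b y) = y"
proof -
  have *: "{a..a+k} \<subseteq> S \<Longrightarrow> cj s a k (cj s a k y) = y" for a k y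
    by (induction k arbitrary: a y) (auto simp: ss subset_iff)
  have **: "cs s a b (cs s a b y) = y" if lab: "linked S a b" "a < b" for a b
  proof -
    obtain k where k: "b = a + k + 1" using less_imp_Suc_add[OF lab(2)] by auto
    have "{a..a+k} \<subseteq> S" using lab k by (auto simp: linked_def min_def max_def)
    then show ?thesis unfolding k cs_less by (rule *)
  qed
  show ?thesis
    using ** assms linked_sym by (metis cs_commute linorder_neqE_nat)
qed

text \<open>With simple transpositions alone, a point in the middle of a block could not be
  eliminated; the larger alphabet of all linked transpositions allows an induction on the point set
  \<open>A\<close>.\<close>

inductive swap_group :: "nat set \<Rightarrow> (nat \<Rightarrow> nat) \<Rightarrow> ('x \<Rightarrow> 'x) \<Rightarrow> bool" for A where
  one: "swap_group A id id"
| step: "swap_group A p f \<Longrightarrow> c \<in> A \<Longrightarrow> d \<in> A \<Longrightarrow> c \<noteq> d \<Longrightarrow> linked S c d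
    \<Longrightarrow> swap_group A (transpose c d \<circ> p) (sw c d \<circ> f)"

lemma swap_group_fixes: "swap_group A p f \<Longrightarrow> x \<notin> A \<Longrightarrow> p x = x"
  by (induction rule: swap_group.induct) (auto simp: transpose_def)

text \<open>Collects the transpositions moving \<open>v\<close> into a single leading one. This is the induction step
  of the proof that a product of transpositions representing the identity acts as the identity.\<close>

lemma swap_group_insert:
  assumes "swap_group (insert v A) p f" "v \<notin> A"
  shows "swap_group A p f \<or>
     (\<exists>a\<in>A. linked S v a \<and> (\<exists>q g. swap_group A q g \<and> p = transpose v a \<circ> q \<and> f = sw v a \<circ> g))"
  using assms(1)
proof (induction rule: swap_group.induct)
  case one
  show ?case by (rule disjI1) (rule swap_group.one)
next
  case (step p f c d)
  have main: ?case if "c \<in> A" "d \<in> A"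
    using step.IH
  proof (elim disjE bexE exE conjE)
    assume "swap_group A p f"
    then show ?thesis using swap_group.step that step.hyps by blast
  next
    fix a q g assume a: "a \<in> A" "linked S v a" and q: "swap_group A q g"
      and p: "p = transpose v a \<circ> q" and f: "f = sw v a \<circ> g"
    let ?a = "transpose c d a"
    have va: "v \<noteq> a" "v \<noteq> c" "v \<noteq> d" using assms(2) a that by auto
    \<comment> \<open>The new letter does not move \<open>v\<close>, so it passes the leading
      transposition and only renames \<open>a\<close>.\<close>
    have "sw c d (sw v a y) = sw v ?a (sw c d y)" for y
      using sw_conj[OF _ _ conj_family_s, of c d v a] step.hyps a va by simp
    then have "sw c d \<circ> f = sw v ?a \<circ> (sw c d \<circ> g)" using f by (simp add: fun_eq_iff)
    moreover have "transpose c d \<circ> p = transpose v ?a \<circ> (transpose c d \<circ> q)"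
      using p va by (auto simp: fun_eq_iff transpose_def)
    moreover have "?a \<in> A" using a that by (auto simp: transpose_def)
    moreover have "linked S v ?a" using linked_transpose[of S c d v a] va step.hyps a by simp
    moreover have "swap_group A (transpose c d \<circ> q) (sw c d \<circ> g)"
      using swap_group.step q that step.hyps by blast
    ultimately show ?thesis by blast
  qed
  have one: "swap_group A (transpose v e \<circ> p) (sw v e \<circ> f) \<or>
     (\<exists>a\<in>A. linked S v a \<and> (\<exists>q g. swap_group A q g \<and> transpose v e \<circ> p = transpose v a \<circ> q
       \<and> sw v e \<circ> f = sw v a \<circ> g))" if e: "e \<in> A" "linked S v e" for e
    using step.IH
  proof (elim disjE bexE exE conjE)
    assume "swap_group A p f"
    then show ?thesis using e by blast
  next
    fix a q g assume a: "a \<in> A" "linked S v a" and q: "swap_group A q g"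
      and p: "p = transpose v a \<circ> q" and f: "f = sw v a \<circ> g"
    have ve: "v \<noteq> e" "v \<noteq> a" using assms(2) e a by auto
    show ?thesis
    proof (cases "e = a")
      case True
      then have "transpose v e \<circ> p = q" "sw v e \<circ> f = g"
        using p f sw_sw e ve by (auto simp: fun_eq_iff)
      then show ?thesis using q by simp
    next
      case False
      \<comment> \<open>Two letters moving \<open>v\<close> become one:
        \<open>(v e)(v a) = (v a)(e a)\<close>.\<close>
      have ea: "linked S e a" using e a linked_trans linked_sym by blast
      have "sw v a (sw e a y) = sw e v (sw v a y)" for y
        using sw_conj[OF a(2) ve(2) conj_family_s ea False] ve False by simp
      then have "sw v e (sw v a y) = sw v a (sw e a y)" for y by (simp add: cs_commute)
      then have "sw v e \<circ> f = sw v a \<circ> (sw e a \<circ> g)" using f by (simp add: fun_eq_iff)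
      moreover have "transpose v e \<circ> p = transpose v a \<circ> (transpose e a \<circ> q)"
        using p ve False by (auto simp: fun_eq_iff transpose_def)
      moreover have "swap_group A (transpose e a \<circ> q) (sw e a \<circ> g)"
        using swap_group.step q e a False ea by blast
      ultimately show ?thesis using a by blast
    qed
  qed
  consider "c \<in> A" "d \<in> A" | "c = v" "d \<in> A" | "d = v" "c \<in> A" using step.hyps by auto
  then show ?case
  proof cases
    case 1
    then show ?thesis by (rule main)
  next
    case 2
    show ?thesis unfolding 2(1) by (rule one) (use 2 step.hyps in auto)
  next
    case 3
    then have *: "transpose c d = transpose v c" "sw c d = sw v c"
      by (simp_all only: transpose_commute cs_commute)
    show ?thesis unfolding * by (rule one) (use 3 step.hyps linked_sym in auto)
  qed
qed

text \<open>A leading letter \<open>(v a)\<close> in front of a product that fixes \<open>v\<close>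
  would send \<open>v\<close> to \<open>a\<close>. Over the identity it cannot occur, so
  \<open>v\<close> disappears from the word.\<close>

lemma swap_group_id:
  assumes "finite A" "swap_group A id f" shows "f = id"
  using assms
proof (induction A arbitrary: f)
  case empty
  from empty.prems show ?case by (cases rule: swap_group.cases) auto
next
  case (insert v A)
  from swap_group_insert[OF insert.prems insert.hyps(2)] show ?case
  proof (elim disjE bexE exE conjE)
    fix a q g assume a: "a \<in> A" "swap_group A q g" "id = transpose v a \<circ> q"
    have "q v = v" using swap_group_fixes a insert.hyps by blast
    then have "v = a" using a(3) by (metis comp_apply id_apply transpose_apply_first)
    then show ?thesis using a insert.hyps by simp
  qed (use insert.IH in blast)
qed

lemma simp_group_swap_group: "simp_group p f \<Longrightarrow> swap_group (S \<union> Suc ` S) p f"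
proof (induction rule: simp_group.induct)
  case (step p f i)
  have "swap_group (S \<union> Suc ` S) (transpose i (Suc i) \<circ> p) (sw i (Suc i) \<circ> f)"
    by (rule swap_group.step[OF step.IH]) (use step.hyps linked_Suc in auto)
  then show ?case by (simp only: cs_Suc)
qed (rule swap_group.one)

text \<open>Completeness of the Coxeter relations for the parabolic subgroup: a word in the simple
  transpositions is a word in the swaps of finitely many points.\<close>

lemma simp_group_id: "simp_group id f \<Longrightarrow> f = id"
  using swap_group_id simp_group_swap_group finS by (metis finite_UnI finite_imageI)

lemma simp_group_inv:
  "simp_group p f \<Longrightarrow> \<exists>g. simp_group (inv p) g \<and> f \<circ> g = id \<and> g \<circ> f = id"
proof (induction rule: simp_group.induct)
  case one
  then show ?case using simp_group.one inv_id comp_id by metis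
next
  case (step p f i)
  then obtain g where g: "simp_group (inv p) g" "f \<circ> g = id" "g \<circ> f = id" by blast
  have "inv (transpose i (Suc i) \<circ> p) = inv p \<circ> transpose i (Suc i)"
    using simp_group_bij[OF step.hyps(1)] by (simp add: o_inv_distrib)
  then have "simp_group (inv (transpose i (Suc i) \<circ> p)) (g \<circ> s i)"
    using simp_group_comp[OF g(1) simp_group_gen[OF step.hyps(2)]] by simp
  moreover have "s i \<circ> f \<circ> (g \<circ> s i) = id" "g \<circ> s i \<circ> (s i \<circ> f) = id"
    using g ss step.hyps(2) by (auto simp: fun_eq_iff)
  ultimately show ?case by blast
qed

section \<open>Projections on arbitrary linked pairs\<close>

text \<open>Swapping \<open>Suc a\<close> with \<open>b\<close> is an injective operator that turns
  the pair of \<open>a\<close> and \<open>b\<close> into the edge \<open>a\<close>, so claims about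
  one projection reduce to claims about \<open>t a\<close>.\<close>

lemma tw_consecutive:
  assumes "linked S a b" "a < b"
  obtains p f g where "simp_group p f" "g \<circ> f = id" "p a = a" "p b = Suc a" "a \<in> S"
proof -
  have aS: "a \<in> S" using assms by (auto simp: linked_def)
  show ?thesis
  proof (cases "b = Suc a")
    case True
    then show ?thesis using that[OF simp_group.one] aS by auto
  next
    case False
    have "linked S (Suc a) b" using assms by (auto simp: linked_def min_def max_def)
    then show ?thesis using that[OF simp_group_swap, of "Suc a" b "sw (Suc a) b"] False assms aS
      by (auto simp: fun_eq_iff sw_sw)
  qed
qed

lemma tw_idem_sw:
  assumes "linked S a b" "a \<noteq> b"
  shows "tw a b (tw a b y) = tw a b y" "sw a b (tw a b y) = tw a b y"
proof -
  have *: "tw a b (tw a b y) = tw a b y \<and> sw a b (tw a b y) = tw a b y"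
    if ab: "linked S a b" "a < b" for a b
  proof -
    obtain p f g where p: "simp_group p f" "g \<circ> f = id" "p a = a" "p b = Suc a" "a \<in> S"
      using tw_consecutive ab by metis
    note c = simp_group_conj[OF p(1) _ ab(1)]
    have inj: "f u = f v \<Longrightarrow> u = v" for u v using p(2) by (metis comp_apply id_apply)
    have "f (tw a b (tw a b y)) = f (tw a b y)" "f (sw a b (tw a b y)) = f (tw a b y)"
      using c conj_family_s conj_family_t ab p tt st by simp_all
    then show ?thesis using inj by blast
  qed
  show "tw a b (tw a b y) = tw a b y" "sw a b (tw a b y) = tw a b y"
    using * assms linked_sym by (metis cs_commute linorder_neqE_nat)+
qed

text \<open>An operator of the symmetric group moves \<open>a\<close>, \<open>b\<close>,
  \<open>c\<close> to three consecutive points. There \<open>adj_tt\<close> gives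
  \<open>t i t j = s j s i t j = s j s i s j t j\<close>, and \<open>s j s i s j\<close> is the swap
  of the two outer points.\<close>

lemma tw_tw_adjacent:
  assumes "linked S a b" "linked S b c" "a \<noteq> b" "b \<noteq> c" "a \<noteq> c"
  shows "tw a b (tw b c y) = sw a c (tw b c y)"
proof -
  let ?i = "min a (min b c)"
  have li: "linked S x y" if "x \<in> {a,b,c}" "y \<in> {a,b,c}" for x y
    using that assms linked_sym linked_trans by (smt (verit) empty_iff insert_iff linked_refl)
  define j k where "j = Suc ?i" and "k = Suc (Suc ?i)"
  let ?m = "max a (max b c)"
  \<comment> \<open>Three distinct points: the largest is at least \<open>?i + 2\<close>, so the
    edges \<open>?i\<close> and \<open>j\<close> lie in \<open>S\<close>.\<close>
  have m: "k \<le> ?m" using assms(3-5) unfolding k_def by linarith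
  have lm: "linked S ?i ?m" by (rule li) (auto simp: min_def max_def)
  have lj: "linked S ?i j" "linked S ?i k"
    using linked_between[OF lm] m unfolding j_def k_def by auto
  have iS: "?i \<in> S" "j \<in> S" using lm m unfolding linked_def j_def k_def by (auto simp: subset_iff)
  \<comment> \<open>The identity serves for \<open>u = v\<close>, where \<open>sw u v\<close> is no
    swap. Points other than \<open>u\<close> and \<open>v\<close> stay put, so each of the three
    moves keeps the points already placed.\<close>
  have ex: "\<exists>q h. simp_group q h \<and> (\<forall>u v. h u = h v \<longrightarrow> u = v) \<and> q u = v \<and> 
      (\<forall>w. w \<noteq> u \<longrightarrow> w \<noteq> v \<longrightarrow> q w = w)" if "linked S u v" for u v
  proof (cases "u = v")
    case True
    then show ?thesis using simp_group.one by (intro exI[of _ id]) auto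
  next
    case False
    then show ?thesis using simp_group_swap[OF that] sw_sw[OF that]
      by (intro exI[of _ "transpose u v"] exI[of _ "sw u v"]) (auto, metis)
  qed
  obtain q1 h1 where 1: "simp_group q1 h1" "\<And>u v. h1 u = h1 v \<Longrightarrow> u = v" "q1 a = ?i"
    using ex[of a ?i] li by (smt (verit) insertCI min_def)
  have l1: "linked S ?i (q1 b)" "linked S ?i (q1 c)" "q1 b \<noteq> ?i" "q1 c \<noteq> ?i" "q1 b \<noteq> q1 c"
    using simp_group_linked[OF 1(1), of a] li 1(3) simp_group_bij[OF 1(1)] assms
    by (auto, (metis bij_pointE)+)
  obtain q2 h2 where 2: "simp_group q2 h2" "\<And>u v. h2 u = h2 v \<Longrightarrow> u = v" "q2 (q1 b) = j" 
     "\<And>w. w \<noteq> q1 b \<Longrightarrow> w \<noteq> j \<Longrightarrow> q2 w = w"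
    using ex[of "q1 b" j] linked_trans[OF linked_sym[OF l1(1)] lj(1)] by metis
  have i2: "q2 ?i = ?i" using 2(4)[of ?i] l1 unfolding j_def by auto
  let ?c = "q2 (q1 c)"
  have l2: "linked S ?i ?c" "?c \<noteq> ?i" "?c \<noteq> j"
    using simp_group_linked[OF 2(1) l1(2)] i2 simp_group_bij[OF 2(1)] 2(3) l1
    by (auto, (metis bij_pointE)+)
  obtain q3 h3 where 3: "simp_group q3 h3" "\<And>u v. h3 u = h3 v \<Longrightarrow> u = v" "q3 ?c = k" 
     "\<And>w. w \<noteq> ?c \<Longrightarrow> w \<noteq> k \<Longrightarrow> q3 w = w"
    using ex[of ?c k] linked_trans[OF linked_sym[OF l2(1)] lj(2)] by metis
  have i3: "q3 ?i = ?i" "q3 j = j" using 3(4) l2 unfolding j_def k_def by auto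
  define q h where "q = q3 \<circ> (q2 \<circ> q1)" and "h = h3 \<circ> (h2 \<circ> h1)"
  have qh: "simp_group q h" unfolding q_def h_def by (intro simp_group_comp 1 2 3)
  have q: "q a = ?i" "q b = j" "q c = k" unfolding q_def by (simp_all only: comp_apply 1(3) 2(3) 3(3) i2 i3)
  have hinj: "u = v" if "h u = h v" for u v
  proof (rule 1(2), rule 2(2), rule 3(2))
    show "h3 (h2 (h1 u)) = h3 (h2 (h1 v))" using that by (simp add: h_def)
  qed
  have swik: "sw ?i k z = s j (s ?i (s j z))" for z
    using cs_conj_simple[OF conj_family_s iS(2), of ?i j "s j z"] lj(1) iS ss
    by (simp add: j_def k_def)
  have twij: "tw ?i j = t ?i" "tw j k = t j" unfolding k_def j_def by simp_all
  have "t ?i (t j z) = s j (s ?i (s j (t j z)))" for z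
    using adj_tt[of ?i j z] st iS by (simp add: adj_def j_def)
  moreover have "h (tw a b (tw b c y)) = tw ?i j (tw j k (h y))"
    "h (sw a c (tw b c y)) = sw ?i k (tw j k (h y))"
    using simp_group_conj[OF qh] conj_family_s conj_family_t li assms q by simp_all
  ultimately have "h (tw a b (tw b c y)) = h (sw a c (tw b c y))" by (simp only: swik twij)
  then show ?thesis by (rule hinj)
qed

lemma sw_inj: "linked S a b \<Longrightarrow> a \<noteq> b \<Longrightarrow> sw a b x = sw a b y \<Longrightarrow> x = y"
  using sw_sw by metis

text \<open>The swap of \<open>Suc c\<close> and \<open>d\<close> leaves \<open>a\<close> and
  \<open>Suc a\<close> alone and makes the second pair an edge, which is far from
  \<open>a\<close>.\<close>

lemma tw_commute_consecutive:
  assumes "linked S c d" "c < d" "Suc a < c" "a \<in> S"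
  shows "tw a (Suc a) (tw c d y) = tw c d (tw a (Suc a) y)"
proof (cases "d = Suc c")
  case True
  then have "c \<in> S" using assms by (auto simp: linked_def)
  then show ?thesis using True tfar[of a c y] assms by (simp add: far_def)
next
  case False
  let ?e = "Suc c"
  have l: "linked S ?e d" "?e \<noteq> d" using assms False by (auto simp: linked_def min_def max_def)
  have "c \<in> S" using assms by (auto simp: linked_def)
  note far = tfar[OF assms(4) this]
  have ca: "sw ?e d (tw a (Suc a) z) = tw a (Suc a) (sw ?e d z)" for z
    using sw_conj[OF l conj_family_t linked_Suc[OF assms(4)]] assms by simp
  have cc: "sw ?e d (tw c d z) = tw c ?e (sw ?e d z)" for z
    using sw_conj[OF l conj_family_t assms(1)] assms l by simp
  have "sw ?e d (tw a (Suc a) (tw c d y)) = sw ?e d (tw c d (tw a (Suc a) y))"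
    using far assms unfolding ca cc by (simp add: far_def)
  then show ?thesis by (rule sw_inj[OF l])
qed

text \<open>\<open>a\<close> is the smallest of the four points, so the swap of \<open>Suc a\<close>
  and \<open>b\<close> turns the first pair into an edge and keeps the second pair above it.\<close>

lemma tw_commute_less:
  assumes "linked S a b" "linked S c d" "a < b" "a < c" "a < d" "b \<noteq> c" "b \<noteq> d" "c \<noteq> d"
  shows "tw a b (tw c d y) = tw c d (tw a b y)"
proof -
  have aS: "a \<in> S" using assms by (auto simp: linked_def)
  have far: "tw a (Suc a) (tw c d z) = tw c d (tw a (Suc a) z)"
    if "linked S c d" "c \<noteq> d" "Suc a < c" "Suc a < d" for c d z
    using tw_commute_consecutive[of c d a z] tw_commute_consecutive[of d c a z] that aS linked_sym[OF that(1)]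
    by (cases "c < d") (auto simp: cs_commute[of _ d c])
  show ?thesis
  proof (cases "b = Suc a")
    case True
    then show ?thesis using far[OF assms(2)] assms by simp
  next
    case False
    let ?e = "Suc a"
    have l: "linked S ?e b" "?e \<noteq> b" using assms False by (auto simp: linked_def min_def max_def)
    let ?c = "transpose ?e b c" and ?d = "transpose ?e b d"
    have ab: "sw ?e b (tw a b z) = tw a ?e (sw ?e b z)" for z
      using sw_conj[OF l conj_family_t assms(1)] assms l by simp
    have cd: "sw ?e b (tw c d z) = tw ?c ?d (sw ?e b z)" for z
      using sw_conj[OF l conj_family_t assms(2)] assms by simp
    have "linked S ?c ?d" by (rule linked_transpose[OF l(1) assms(2)])
    moreover have "?c \<noteq> ?d" using assms(8) by (metis transpose_involutory)
    moreover have "Suc a < ?c" "Suc a < ?d" using assms False by (auto simp: transpose_def)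
    ultimately have "sw ?e b (tw a b (tw c d y)) = sw ?e b (tw c d (tw a b y))"
      unfolding ab cd by (rule far)
    then show ?thesis by (rule sw_inj[OF l])
  qed
qed

lemma tw_commute:
  assumes "linked S a b" "linked S c d" "a \<noteq> b" "c \<noteq> d" "a \<noteq> c" "a \<noteq> d" "b \<noteq> c" "b \<noteq> d"
  shows "tw a b (tw c d y) = tw c d (tw a b y)"
proof -
  have "tw a b (tw c d y) = tw c d (tw a b y)"
    if ab: "linked S a b" and cd: "linked S c d" and lt: "a < b" "c < d"
      and ne: "a \<noteq> c" "a \<noteq> d" "b \<noteq> c" "b \<noteq> d" for a b c d
  proof (cases "a < c")
    case True
    show ?thesis by (rule tw_commute_less[OF ab cd]) (use True lt ne in auto)
  next
    case False
    show ?thesis by (rule tw_commute_less[OF cd ab, symmetric]) (use False lt ne in auto)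
  qed
  from this[of "min a b" "max a b" "min c d" "max c d"]
  have "tw (min a b) (max a b) (tw (min c d) (max c d) y)
      = tw (min c d) (max c d) (tw (min a b) (max a b) y)"
    using assms linked_sym by (auto simp: min_def max_def)
  moreover have "tw (min a b) (max a b) = tw a b" for a b
    by (simp add: cs_def)
  ultimately show ?thesis by (simp only:)
qed

text \<open>Two arcs may be exchanged as a whole. If \<open>X\<close> is the product of both
  projections, then \<open>tw b c X\<close> equals \<open>sw c a X\<close> when
  \<open>tw a b\<close> is written in front, and \<open>sw d b X\<close> when \<open>tw c d\<close>
  is; cancelling the swap of \<open>c\<close> and \<open>a\<close> gives the claim.\<close>

lemma sw_sw_tw_tw:
  assumes "linked S a b" "linked S c d" "linked S a c"
    and "a \<noteq> b" "c \<noteq> d" "a \<noteq> c" "a \<noteq> d" "b \<noteq> c" "b \<noteq> d"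
  shows "sw c a (sw d b (tw a b (tw c d y))) = tw a b (tw c d y)"
proof -
  have l: "linked S b c" "linked S b d" using assms linked_sym linked_trans by metis+
  have "tw c b (tw b a z) = sw c a (tw b a z)" for z
    by (rule tw_tw_adjacent) (use l assms linked_sym in auto)
  then have 1: "tw b c (tw a b (tw c d y)) = sw c a (tw a b (tw c d y))"
    by (simp only: cs_commute)
  have "tw b c (tw c d z) = sw b d (tw c d z)" for z
    by (rule tw_tw_adjacent) (use l assms linked_sym in auto)
  then have "tw b c (tw c d (tw a b y)) = sw b d (tw c d (tw a b y))" .
  moreover have "tw a b (tw c d y) = tw c d (tw a b y)" using tw_commute assms by simp
  ultimately have 2: "tw b c (tw a b (tw c d y)) = sw d b (tw a b (tw c d y))"
    by (simp only: cs_commute[of _ d b])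
  show ?thesis using 1 2 sw_sw[of c a] assms linked_sym by metis
qed

section \<open>Products of disjoint projections\<close>

primrec tws :: "(nat \<times> nat) list \<Rightarrow> 'x \<Rightarrow> 'x" where
  "tws [] y = y"
| "tws (ab # ps) y = tw (fst ab) (snd ab) (tws ps y)"

text \<open>The arc at \<open>a\<close> commutes with the arcs before it; its stored orientation may
  be the opposite one, which \<open>tw\<close> does not see.\<close>

lemma tws_pull:
  assumes "pairing S ps" "partner ps a = b" "a \<noteq> b"
  obtains qs where "pairing S ((a,b) # qs)" "\<And>y. tws ps y = tw a b (tws qs y)"
    "partner ((a,b) # qs) = partner ps"
  using assms(1,2)
proof (induction ps arbitrary: thesis)
  case Nil
  then show ?case using assms(3) by simp
next
  case (Cons cd ps)
  obtain c d where cd: "cd = (c,d)" by force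
  have c: "c \<noteq> d" "linked S c d" "c \<notin> points ps" "d \<notin> points ps" "pairing S ps"
    using Cons.prems(2) cd by auto
  show ?case
  proof (cases "a = c \<or> a = d")
    case True
    then consider "a = c" "b = d" | "a = d" "b = c" using Cons.prems(3) cd c by auto
    then show ?thesis
    proof cases
      case 1
      then show ?thesis using Cons.prems(1)[of ps] Cons.prems(2) cd by simp
    next
      case 2
      show ?thesis
        by (rule Cons.prems(1)[of ps]) (use 2 c cd linked_sym in \<open>auto simp: cs_commute\<close>)
    qed
  next
    case False
    then have pa: "partner ps a = b" using Cons.prems(3) cd by simp
    obtain qs where q: "pairing S ((a,b) # qs)" "\<And>y. tws ps y = tw a b (tws qs y)"
      "partner ((a,b) # qs) = partner ps" using Cons.IH[OF _ c(5) pa] by blast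
    \<comment> \<open>The points of a pairing are read off from \<open>partner\<close>, which the
      rearrangement preserves; hence \<open>c\<close> and \<open>d\<close> do not occur in
      \<open>qs\<close>.\<close>
    have "points ps = {x. partner ps x \<noteq> x}" "points qs \<subseteq> {x. partner ((a,b)#qs) x \<noteq> x}" "b \<in> {x. partner ((a,b)#qs) x \<noteq> x}"
      using points_partner c(5) points_partner[OF q(1)] assms(3) by auto
    then have pq: "points qs \<subseteq> points ps" "b \<in> points ps" using q(3) by auto
    then have ne: "b \<noteq> c" "b \<noteq> d" "c \<notin> points qs" "d \<notin> points qs" using c by auto
    show ?thesis
    proof (rule Cons.prems(1)[of "(c,d) # qs"])
      show "pairing S ((a, b) # (c, d) # qs)" using q(1) c ne False by auto
      show "tws (cd # ps) y = tw a b (tws ((c, d) # qs) y)" for y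
        using q(1,2) cd tw_commute[OF c(2), of a b] c False ne by simp
      show "partner ((a, b) # (c, d) # qs) = partner (cd # ps)"
        using q(3)[symmetric] False ne by (auto simp: cd fun_eq_iff)
    qed
  qed
qed

lemma tws_cong:
  assumes "pairing S ps" "pairing S qs" "partner ps = partner qs"
  shows "tws ps y = tws qs y"
  using assms
proof (induction ps arbitrary: qs)
  case Nil
  then have "points qs = {}" using points_partner[of S qs] by (auto simp: fun_eq_iff)
  then show ?case by (cases qs) auto
next
  case (Cons ab ps)
  obtain a b where ab: "ab = (a,b)" by force
  have "partner qs a = b" "a \<noteq> b" using fun_cong[OF Cons.prems(3), of a] Cons.prems(1) ab by auto
  then obtain rs where rs: "pairing S ((a,b) # rs)" "\<And>y. tws qs y = tw a b (tws rs y)"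
    "partner ((a,b) # rs) = partner qs" using tws_pull Cons.prems(2) by blast
  have ps: "pairing S ps" "a \<notin> points ps" "b \<notin> points ps" using Cons.prems(1) ab by auto
  have "partner ps x = partner rs x" for x
  proof (cases "x = a \<or> x = b")
    case True
    then have "x \<notin> points ps" "x \<notin> points rs" using ps rs(1) by auto
    then show ?thesis by (simp add: partner_outside)
  next
    case False
    have "partner (ab # ps) x = partner ((a,b) # rs) x" 
      by (simp only: rs(3) Cons.prems(3))
    then show ?thesis using False ab by simp
  qed
  then have "tws ps y = tws rs y" using Cons.IH[of rs] ps(1) rs(1) by auto
  then show ?case using rs(2) ab by simp
qed

text \<open>\<open>p\<close> permutes the arcs, and the induction first makes it fix the leading
  one. If \<open>p\<close> reverses this arc, it is corrected by \<open>sw a b\<close>, which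
  \<open>tw a b\<close> absorbs; if \<open>p\<close> carries it to another arc, it is corrected by
  the exchange of the two arcs, which \<open>sw_sw_tw_tw\<close> absorbs. Without arcs
  \<open>p\<close> is the identity, and \<open>simp_group_id\<close> applies.\<close>

lemma tws_absorb:
  assumes "simp_group p f" "pairing S ps"
    and "\<And>x. p (partner ps x) = partner ps (p x)" "\<And>x. x \<notin> points ps \<Longrightarrow> p x = x"
  shows "f (tws ps y) = tws ps y"
  using assms
proof (induction ps arbitrary: p f y)
  case Nil
  then have "p = id" by auto
  then have "f = id" using simp_group_id Nil.prems(1) by blast
  then show ?case by simp
next
  case (Cons ab ps)
  obtain a b where ab: "ab = (a,b)" by force
  let ?P = "partner (ab # ps)"
  have a: "a \<noteq> b" "linked S a b" "a \<notin> points ps" "b \<notin> points ps" "pairing S ps"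
    using Cons.prems(2) ab by auto
  have P: "?P a = b" "?P b = a" using ab a by auto
  have P': "partner ps x = (if x = a \<or> x = b then x else ?P x)" for x
    using a partner_outside ab by auto
  have inv: "?P (?P x) = x" for x using partner_partner[OF Cons.prems(2)] .
  have inj: "p x = p y \<longleftrightarrow> x = y" for x y
    using simp_group_bij[OF Cons.prems(1)] by (auto dest: bij_is_inj injD)
  have pab: "?P (p a) = p b" "?P (p b) = p a" using Cons.prems(3) P by metis+
  \<comment> \<open>A permutation fixing both ends commutes with \<open>tw a b\<close> and falls
    under the induction hypothesis for the remaining arcs.\<close>
  have fixing: "g (tws (ab # ps) y) = tws (ab # ps) y"
    if q: "simp_group q g" "q a = a" "q b = b" "\<And>x. q (?P x) = ?P (q x)" "\<And>x. x \<notin> points ps \<Longrightarrow> q x = x"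
    for q g y
  proof -
    have qinj: "q x = q y \<longleftrightarrow> x = y" for x y
      using simp_group_bij[OF q(1)] by (auto dest: bij_is_inj injD)
    have "q (partner ps x) = partner ps (q x)" for x
      using q(2-4) qinj[of x a] qinj[of x b] unfolding P' by auto
    then have "g (tws ps y) = tws ps y" using Cons.IH[OF q(1) a(5)] q(5) by blast
    moreover have "g (tw a b z) = tw a b (g z)" for z
      using simp_group_conj[OF q(1) conj_family_t a(2,1)] q by simp
    ultimately show ?thesis using ab by simp
  qed
  have off: "x \<noteq> a \<Longrightarrow> x \<noteq> b \<Longrightarrow> x \<notin> points ps \<Longrightarrow> p x = x" for x
    using Cons.prems(4)[of x] ab by simp
  consider "p a = a" "p b = b" | "p a = b" "p b = a" | "p a \<noteq> a" "p a \<noteq> b"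
    using pab P by metis
  then show ?case
  proof cases
    case 1
    show ?thesis
      by (rule fixing[OF Cons.prems(1) 1 Cons.prems(3)]) (use off 1 in metis)
  next
    case 2
    let ?q = "transpose a b \<circ> p" and ?g = "sw a b \<circ> f"
    have "?g (tws (ab # ps) y) = tws (ab # ps) y"
    proof (rule fixing)
      show "simp_group ?q ?g" by (intro simp_group_comp simp_group_swap a Cons.prems(1))
      show "?q a = a" "?q b = b" using 2 by simp_all
      show "?q (?P x) = ?P (?q x)" for x
      proof -
        have *: "p (?P x) = ?P (p x)" by (rule Cons.prems(3))
        consider "p x = a" | "p x = b" | "p x \<noteq> a" "p x \<noteq> b" by blast
        then show ?thesis
        proof cases
          case 3
          then have "?P (p x) \<noteq> a" "?P (p x) \<noteq> b" using P inv[of "p x"] by metis+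
          then show ?thesis using 3 by (simp add: * transpose_def del: partner.simps)
        qed (simp_all only: comp_apply * P transpose_apply_first transpose_apply_second)
      qed
      show "?q x = x" if "x \<notin> points ps" for x
        using off[of x] that 2 by (cases "x = a \<or> x = b") auto
    qed
    moreover have "sw a b (tws (ab # ps) y) = tws (ab # ps) y" using tw_idem_sw a ab by simp
    ultimately have "sw a b (f (tws (ab # ps) y)) = sw a b (tws (ab # ps) y)" by simp
    then show ?thesis by (rule sw_inj[OF a(2,1)])
  next
    case 3
    let ?c = "p a" and ?d = "p b"
    have d: "?d \<noteq> a" "?d \<noteq> b" "?c \<noteq> ?d" using 3 pab P inj a by metis+
    have "partner ps ?c = ?d" using pab 3 by (simp add: P')
    then obtain qs where qs: "pairing S ((?c,?d) # qs)" "\<And>y. tws ps y = tw ?c ?d (tws qs y)"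
      using tws_pull[OF a(5)] d by metis
    have l: "linked S ?c ?d" "linked S a ?c" "linked S b ?d"
      using simp_group_linked[OF Cons.prems(1) a(2)] simp_group_linked_self[OF Cons.prems(1)] by auto
    \<comment> \<open>The two swaps bring the image arc back onto \<open>a\<close> and
      \<open>b\<close> end by end, so that the corrected permutation fixes both.\<close>
    let ?q = "transpose ?c a \<circ> (transpose ?d b \<circ> p)" and ?g = "sw ?c a \<circ> (sw ?d b \<circ> f)"
    have "?g (tws (ab # ps) y) = tws (ab # ps) y"
    proof (rule fixing)
      show "simp_group ?q ?g" 
        by (intro simp_group_comp simp_group_swap a Cons.prems(1)) (use l 3 d linked_sym in auto)
      show qa: "?q a = a" "?q b = b" using 3 d a by (auto simp: transpose_def)
      show "?q (?P x) = ?P (?q x)" for x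
      proof (cases "x = a \<or> x = b")
        case True
        then show ?thesis using qa P by auto
      next
        case False
        then have y: "p x \<noteq> ?c" "p x \<noteq> ?d" using inj by auto
        let ?y = "p x" and ?T = "\<lambda>x. transpose ?c a (transpose ?d b x)"
        have "?T (?P ?y) = ?P (?T ?y)"
        proof -
          consider "?y = a" | "?y = b" | "?y \<noteq> a" "?y \<noteq> b" by blast
          then show ?thesis
          proof cases
            case 1 then show ?thesis using P pab 3 d a by (simp add: transpose_def)
          next
            case 2 then show ?thesis using P pab 3 d a by (simp add: transpose_def)
          next
            case c3: 3
            have "?P ?y \<noteq> a" "?P ?y \<noteq> b" "?P ?y \<noteq> ?c" "?P ?y \<noteq> ?d"
              using c3 y inv P pab by metis+
            then show ?thesis using c3 y by (simp add: transpose_def)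
          qed
        qed
        then show ?thesis using Cons.prems(3) by simp
      qed
      show "?q x = x" if x: "x \<notin> points ps" for x
      proof (cases "x = a \<or> x = b")
        case True
        then show ?thesis using qa by auto
      next
        case False
        then have px: "p x = x" using off x by auto
        then have "x \<noteq> ?c" "x \<noteq> ?d" using inj False by metis+
        then show ?thesis using px False by simp
      qed
    qed
    moreover have "sw ?c a (sw ?d b (tws (ab # ps) y)) = tws (ab # ps) y"
      using sw_sw_tw_tw[OF a(2) l(1,2) a(1) d(3)] qs(2) 3 d ab by simp
    ultimately have "sw ?c a (sw ?d b (f (tws (ab # ps) y))) = sw ?c a (sw ?d b (tws (ab # ps) y))"
      by simp
    then have "sw ?d b (f (tws (ab # ps) y)) = sw ?d b (tws (ab # ps) y)"
      by (rule sw_inj[OF linked_sym[OF l(2)] 3(1)])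
    then show ?thesis by (rule sw_inj[OF linked_sym[OF l(3)] d(2)])
  qed
qed

end

subsection \<open>Diagrams as fixed-point-free involutions\<close>

text \<open>If \<open>p\<close> moves top points only, this is left multiplication by the
  permutation diagram of \<open>p\<close>.\<close>

definition relabel :: "(nat \<Rightarrow> nat) \<Rightarrow> (nat \<Rightarrow> nat) \<Rightarrow> nat \<Rightarrow> nat" where
  "relabel p m = p \<circ> m \<circ> inv p"

text \<open>Left multiplication by the projection on \<open>a\<close> and \<open>b\<close>: they
  form an arc, and their former partners are joined through the middle row. If they were joined
  before, only a closed loop is lost and \<open>m\<close> stays the same
  (\<open>cap_absorb\<close>).\<close>

definition cap :: "nat \<Rightarrow> nat \<Rightarrow> (nat \<Rightarrow> nat) \<Rightarrow> nat \<Rightarrow> nat" where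
  "cap a b m x = (if x = a then b else if x = b then a
     else if m x = a then m b else if m x = b then m a else m x)"

text \<open>Diagram of the product of the projections on \<open>ps\<close>: the same arcs in both
  rows, vertical lines elsewhere, and the identity off the diagram. The empty list gives the
  unit.\<close>

definition pair_diag :: "nat \<Rightarrow> (nat \<times> nat) list \<Rightarrow> nat \<Rightarrow> nat" where
  "pair_diag n ps x =
     (if 1 \<le> x \<and> x \<le> n then (if partner ps x = x then n + x else partner ps x)
      else if n < x \<and> x \<le> 2 * n
        then (if partner ps (x - n) = x - n then x - n else n + partner ps (x - n))
      else x)"

primrec gen_op :: "gen \<Rightarrow> (nat \<Rightarrow> nat) \<Rightarrow> nat \<Rightarrow> nat" where
  "gen_op (E i) m = m"
| "gen_op (Z i) m = relabel (transpose i (Suc i)) m"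
| "gen_op (D i) m = cap i (Suc i) m"

primrec diag :: "nat \<Rightarrow> gen list \<Rightarrow> nat \<Rightarrow> nat" where
  "diag n [] = pair_diag n []"
| "diag n (g # w) = gen_op g (diag n w)"

lemma relabel_apply: "bij p \<Longrightarrow> relabel p m (p x) = p (m x)"
  by (simp add: relabel_def bij_is_inj)

lemma relabel_transpose: "relabel (transpose a b) m x = transpose a b (m (transpose a b x))"
  by (simp add: relabel_def)

lemma relabel_id [simp]: "relabel id m = m"
  by (simp add: relabel_def)

lemma relabel_relabel:
  assumes "bij p" "bij q" shows "relabel p (relabel q m) = relabel (p \<circ> q) m"
  using assms by (simp add: relabel_def o_inv_distrib comp_assoc)

lemma relabel_eqI:
  assumes "bij p" "\<And>x. m' (p x) = p (m x)" shows "m' = relabel p m"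
proof
  fix x
  obtain y where "x = p y" using assms(1) by (metis bij_pointE)
  then show "m' x = relabel p m x" using assms relabel_apply by simp
qed

lemma relabel_inj:
  assumes "bij p" "relabel p m = relabel p m'" shows "m = m'"
proof
  fix x
  have "p (m x) = p (m' x)" using assms relabel_apply by metis
  then show "m x = m' x" using assms(1) by (metis bij_pointE)
qed

lemma cap_relabel:
  assumes "bij p" shows "cap (p a) (p b) (relabel p m) = relabel p (cap a b m)"
proof (rule relabel_eqI[OF assms])
  fix x
  have inj: "p u = p v \<longleftrightarrow> u = v" for u v using assms by (metis bij_pointE)
  show "cap (p a) (p b) (relabel p m) (p x) = p (cap a b m x)"
    unfolding cap_def relabel_apply[OF assms] inj by simp
qed

lemma cap_commute: "a \<noteq> b \<Longrightarrow> cap a b m = cap b a m"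
  by (auto simp: cap_def fun_eq_iff)

lemma cap_absorb:
  assumes "\<And>x. m (m x) = x" "m a = b"
  shows "cap a b m = m"
proof
  fix x
  have "m b = a" using assms by metis
  then show "cap a b m x = m x" using assms unfolding cap_def by metis
qed

text \<open>With \<open>a\<close> joined to \<open>c\<close>, the point \<open>b\<close> takes the
  place of \<open>c\<close> at \<open>a\<close>, and \<open>c\<close> takes that of \<open>b\<close>
  at its old partner. Diagram counterpart of \<open>tw_tw_adjacent\<close>.\<close>

lemma cap_adjacent:
  assumes m: "\<And>x. m (m x) = x" and c: "m a = c" and ne: "c \<noteq> b" "a \<noteq> b" "a \<noteq> c" "m b \<noteq> b"
  shows "cap a b m = relabel (transpose b c) m"
proof
  fix x
  have mc: "m c = a" using m c by metis
  have inj: "m u = m v \<longleftrightarrow> u = v" for u v using m by metis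
  consider "x = a" | "x = b" | "x = c" | "x \<noteq> a" "x \<noteq> b" "x \<noteq> c" "m x = b" 
    | "x \<noteq> a" "x \<noteq> b" "x \<noteq> c" "m x \<noteq> b" by blast
  then show "cap a b m x = relabel (transpose b c) m x"
  proof cases
    case 1
    then show ?thesis by (simp add: cap_def relabel_transpose transpose_def c ne)
  next
    case 2
    then show ?thesis using ne by (simp add: cap_def relabel_transpose transpose_def mc)
  next
    case 3
    have "m b \<noteq> c" using m[of b] mc ne(2) by auto
    then show ?thesis using 3 ne by (simp add: cap_def relabel_transpose transpose_def mc c)
  next
    case 4
    then show ?thesis using ne c mc inj by (simp add: cap_def relabel_transpose transpose_def)
  next
    case 5
    then have "m x \<noteq> a" "m x \<noteq> c" using m mc c by metis+
    then show ?thesis using 5 by (simp add: cap_def relabel_transpose transpose_def)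
  qed
qed

lemma points_bounded:
  assumes "pairing S ps" "S \<subseteq> {1..<n}" shows "points ps \<subseteq> {1..n}"
proof
  fix x assume "x \<in> points ps"
  then have "partner ps x \<noteq> x" "linked S x (partner ps x)"
    using partner_neq_iff[OF assms(1)] linked_partner[OF assms(1)] by auto
  then have "x \<in> S \<union> Suc ` S" using linked_in_points by metis
  then show "x \<in> {1..n}" using assms(2) by auto
qed

lemma partner_bounded:
  assumes "pairing S ps" "S \<subseteq> {1..<n}"
  shows "1 \<le> partner ps x \<and> partner ps x \<le> n \<longleftrightarrow> 1 \<le> x \<and> x \<le> n"
  using points_bounded[OF assms] partner_in_points[of x ps] partner_outside[of x ps]
  by (cases "x \<in> points ps") auto

lemma pair_diag_involution:
  assumes "pairing S ps" "S \<subseteq> {1..<n}"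
  shows "pair_diag n ps (pair_diag n ps x) = x"
proof -
  note pp = partner_partner[OF assms(1)]
  note pb = partner_bounded[OF assms]
  consider "1 \<le> x" "x \<le> n" "partner ps x = x" | "1 \<le> x" "x \<le> n" "partner ps x \<noteq> x"
    | y where "x = n + y" "1 \<le> y" "y \<le> n" "partner ps y = y"
    | y where "x = n + y" "1 \<le> y" "y \<le> n" "partner ps y \<noteq> y"
    | "x = 0 \<or> 2 * n < x"
  proof (cases "n < x \<and> x \<le> 2 * n")
    case True
    then have "x = n + (x - n)" "1 \<le> x - n" "x - n \<le> n" by auto
    then show ?thesis using that by blast
  qed (use that in auto, linarith)
  then show ?thesis
  proof cases
    case 1
    then show ?thesis by (simp add: pair_diag_def)
  next
    case 2
    then show ?thesis using pb[of x] pp[of x] by (auto simp: pair_diag_def)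
  next
    case 3
    then show ?thesis by (simp add: pair_diag_def)
  next
    case 4
    then show ?thesis using pb[of y] pp[of y] by (auto simp: pair_diag_def)
  next
    case 5
    then have "\<not> (1 \<le> x \<and> x \<le> n)" "\<not> (n < x \<and> x \<le> 2 * n)" by auto
    then have "pair_diag n ps x = x" unfolding pair_diag_def by (simp only: if_False)
    then show ?thesis by simp
  qed
qed

lemma pair_diag_fixpoint_free: "1 \<le> x \<Longrightarrow> x \<le> n \<Longrightarrow> pair_diag n ps x \<noteq> x"
  by (auto simp: pair_diag_def)

text \<open>\<open>a\<close> and \<open>b\<close> are the tops of vertical lines, so their former
  partners are \<open>n + a\<close> and \<open>n + b\<close>; joining these produces the mirror arc
  below.\<close>

lemma cap_pair_diag:
  assumes "pairing S ((a, b) # ps)" "S \<subseteq> {1..<n}"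
  shows "cap a b (pair_diag n ps) = pair_diag n ((a, b) # ps)"
proof
  fix x
  have ps: "pairing S ps" "a \<noteq> b" "a \<notin> points ps" "b \<notin> points ps" using assms(1) by auto
  have ab: "1 \<le> a" "a \<le> n" "1 \<le> b" "b \<le> n" using points_bounded[OF assms] by auto
  note part = partner_outside[OF ps(3)] partner_outside[OF ps(4)]
  have m: "pair_diag n ps a = n + a" "pair_diag n ps b = n + b"
    using ab part by (auto simp: pair_diag_def)
  have m': "pair_diag n ps (n + a) = a" "pair_diag n ps (n + b) = b"
    using ab part by (auto simp: pair_diag_def)
  have "pair_diag n ps x = a \<longleftrightarrow> x = n + a" "pair_diag n ps x = b \<longleftrightarrow> x = n + b"
    using m m' pair_diag_involution[OF ps(1) assms(2)] by metis+
  then have cap: "cap a b (pair_diag n ps) x = (if x = a then b else if x = b then a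
      else if x = n + a then n + b else if x = n + b then n + a else pair_diag n ps x)"
    unfolding cap_def m by simp
  consider "x = a" | "x = b" | "x = n + a" | "x = n + b"
    | "x \<noteq> a" "x \<noteq> b" "x \<noteq> n + a" "x \<noteq> n + b" by blast
  then show "cap a b (pair_diag n ps) x = pair_diag n ((a, b) # ps) x"
  proof cases
    case 5
    then have "cap a b (pair_diag n ps) x = pair_diag n ps x" using cap by simp
    also have "\<dots> = pair_diag n ((a, b) # ps) x"
      using 5 unfolding pair_diag_def by (auto simp: le_eq_less_or_eq)
    finally show ?thesis .
  qed (use cap ab ps(2) in \<open>auto simp: pair_diag_def\<close>)
qed

section \<open>Normal form and faithfulness of the diagram\<close>

context brauer_action
begin

primrec act_gen :: "gen \<Rightarrow> 'x \<Rightarrow> 'x" where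
  "act_gen (E i) x = x"
| "act_gen (Z i) x = s i x"
| "act_gen (D i) x = t i x"

primrec act :: "gen list \<Rightarrow> 'x \<Rightarrow> 'x" where
  "act [] x = x"
| "act (g # w) x = act_gen g (act w x)"

text \<open>Action and diagram are rewritten in parallel: each rule used for the projections has a
  counterpart for \<open>cap\<close>, hence the same \<open>p\<close> and \<open>ps\<close> serve
  both.\<close>

lemma normal_form:
  assumes "S \<subseteq> {1..<n}" "gidx ` set w \<subseteq> S"
  shows "\<exists>p f ps. simp_group p f \<and> pairing S ps \<and> (\<forall>x. act w x = f (tws ps x))
    \<and> diag n w = relabel p (pair_diag n ps)"
  using assms(2)
proof (induction w)
  case Nil
  have "act [] x = id (tws [] x)" for x by simp
  moreover have "diag n [] = relabel id (pair_diag n [])" by simp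
  ultimately show ?case using simp_group.one pairing.simps(1) by blast
next
  case (Cons g w)
  then obtain p f ps where p: "simp_group p f" and ps: "pairing S ps"
    and w: "\<And>x. act w x = f (tws ps x)" "diag n w = relabel p (pair_diag n ps)" by auto
  have bij: "bij p" using simp_group_bij[OF p] .
  show ?case
  proof (cases g)
    case (E i)
    then show ?thesis using p ps w by auto
  next
    case (Z i)
    then have i: "i \<in> S" using Cons.prems by auto
    have "act (g # w) x = (s i \<circ> f) (tws ps x)" for x using Z w by simp
    moreover have "diag n (g # w) = relabel (transpose i (Suc i) \<circ> p) (pair_diag n ps)"
      using Z w(2) relabel_relabel bij bij_transpose by simp
    ultimately show ?thesis using simp_group.step[OF p i] ps by blast
  next
    case (D i)
    then have i: "i \<in> S" using Cons.prems by auto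
    \<comment> \<open>\<open>t i\<close> is pulled to the right through \<open>p\<close>, where it
      becomes the projection on the preimages of \<open>i\<close> and \<open>Suc i\<close>, next to
      the disjoint projections.\<close>
    define a b where "a = inv p i" and "b = inv p (Suc i)"
    let ?m = "pair_diag n ps"
    have pab: "p a = i" "p b = Suc i"
      using bij unfolding a_def b_def by (simp_all add: bij_is_surj surj_f_inv_f)
    have ne: "a \<noteq> b" using pab by auto
    have l: "linked S a b"
      using simp_group_inv[OF p] simp_group_linked[OF _ linked_Suc[OF i]] a_def b_def by blast
    have abn: "1 \<le> a" "a \<le> n" "1 \<le> b" "b \<le> n"
      using linked_in_points[OF l ne] linked_in_points[OF linked_sym[OF l]] ne assms(1) by auto
    have inv: "?m (?m x) = x" for x using pair_diag_involution[OF ps assms(1)] .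
    have "f (tw a b y) = t i (f y)" for y
      using simp_group_conj[OF p conj_family_t l ne] pab by simp
    then have act: "act (g # w) x = f (tw a b (tws ps x))" for x using D w by simp
    have dia: "diag n (g # w) = relabel p (cap a b ?m)"
      using D w(2) cap_relabel[OF bij, of a b ?m] pab by simp
    \<comment> \<open>The end \<open>c\<close> already lies on an arc that does not lead to
      \<open>d\<close>; stated for \<open>c\<close> and \<open>d\<close> so that either of
      \<open>a\<close> and \<open>b\<close> can play the part of \<open>c\<close>.\<close>
    have adjacent: ?thesis
      if cd: "linked S c d" "c \<noteq> d" and c: "c \<in> points ps" and nd: "partner ps c \<noteq> d"
        and eqs: "tw a b = tw c d" "cap a b ?m = cap c d ?m" and n: "1 \<le> d" "d \<le> n" for c d
    proof -
      let ?c = "partner ps c"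
      have cn: "1 \<le> c" "c \<le> n" using points_bounded[OF ps assms(1)] c by auto
      have cc: "?c \<noteq> c" using partner_neq_iff[OF ps] c by simp
      have lc: "linked S c ?c" by (rule linked_partner[OF ps])
      have ldc: "linked S d ?c" using linked_trans[OF linked_sym[OF cd(1)] lc] .
      obtain qs where qs: "\<And>y. tws ps y = tw c ?c (tws qs y)"
        using tws_pull[OF ps, of c ?c] cc by metis
      have "tw d c (tw c ?c y) = sw d ?c (tw c ?c y)" for y
        by (rule tw_tw_adjacent) (use cd lc cc nd linked_sym in auto)
      then have "act (g # w) x = (f \<circ> sw d ?c) (tws ps x)" for x
        unfolding act qs eqs by (simp add: cs_commute[of _ c d])
      moreover have "simp_group (p \<circ> transpose d ?c) (f \<circ> sw d ?c)"
        by (intro simp_group_comp p simp_group_swap ldc) (use nd in auto)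
      moreover have "cap c d ?m = relabel (transpose d ?c) ?m"
        by (rule cap_adjacent[OF inv]) 
          (use cc cn nd cd pair_diag_fixpoint_free[OF n] in \<open>auto simp: pair_diag_def\<close>)
      then have "diag n (g # w) = relabel (p \<circ> transpose d ?c) ?m"
        unfolding dia eqs using relabel_relabel bij bij_transpose by simp
      ultimately show ?thesis using ps by blast
    qed
    consider "partner ps a = b" | "a \<in> points ps" "partner ps a \<noteq> b"
      | "b \<in> points ps" "partner ps b \<noteq> a" | "a \<notin> points ps" "b \<notin> points ps"
      using partner_partner[OF ps] by metis
    then show ?thesis
    proof cases
      case 1
      obtain qs where "\<And>y. tws ps y = tw a b (tws qs y)" using tws_pull[OF ps 1 ne] by metis
      then have "act (g # w) x = f (tws ps x)" for x using act tw_idem_sw(1)[OF l ne] by simp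
      moreover have "cap a b ?m = ?m"
        by (rule cap_absorb[OF inv]) (use 1 ne abn in \<open>simp add: pair_diag_def\<close>)
      ultimately show ?thesis using dia p ps by auto
    next
      case 2
      show ?thesis by (rule adjacent[of a b]) (use 2 l ne abn in auto)
    next
      case 3
      show ?thesis
        by (rule adjacent[of b a]) (use 3 linked_sym[OF l] ne abn cap_commute in \<open>auto simp: cs_commute\<close>)
    next
      case 4
      then have ps': "pairing S ((a, b) # ps)" using ps l ne by simp
      have "act (g # w) x = f (tws ((a, b) # ps) x)" for x using act by simp
      moreover have "diag n (g # w) = relabel p (pair_diag n ((a, b) # ps))"
        using dia cap_pair_diag[OF ps' assms(1)] by simp
      ultimately show ?thesis using p ps' by blast
    qed
  qed
qed

lemma simp_group_fixes: "S \<subseteq> {1..<n} \<Longrightarrow> simp_group p f \<Longrightarrow> x \<notin> {1..n} \<Longrightarrow> p x = x"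
  by (rule swap_group_fixes[OF simp_group_swap_group]) auto

lemma simp_group_bounded:
  assumes "S \<subseteq> {1..<n}" "simp_group p f" shows "1 \<le> p x \<and> p x \<le> n \<longleftrightarrow> 1 \<le> x \<and> x \<le> n"
  using simp_group_fixes[OF assms] simp_group_bij[OF assms(2)]
  by (metis atLeastAtMost_iff bij_pointE)

text \<open>The two left permutations differ by \<open>r\<close>, which fixes every bottom point. So
  the bottom row shows that both pairings agree and that \<open>r\<close> fixes the unpaired points,
  and the top row shows that \<open>r\<close> preserves the pairs. Then \<open>tws_absorb\<close>
  removes \<open>r\<close>.\<close>

theorem act_eq_if_diag_eq:
  assumes S: "S \<subseteq> {1..<n}" and uv: "gidx ` set u \<subseteq> S" "gidx ` set v \<subseteq> S"
    and eq: "diag n u = diag n v"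
  shows "act u x = act v x"
proof -
  obtain p f ps where p: "simp_group p f" and ps: "pairing S ps"
    and u: "\<And>x. act u x = f (tws ps x)" "diag n u = relabel p (pair_diag n ps)"
    using normal_form[OF S uv(1)] by auto
  obtain q g qs where q: "simp_group q g" and qs: "pairing S qs"
    and v: "\<And>x. act v x = g (tws qs x)" "diag n v = relabel q (pair_diag n qs)"
    using normal_form[OF S uv(2)] by auto
  obtain h where h: "simp_group (inv q) h" "g \<circ> h = id" using simp_group_inv[OF q] by blast
  define r where "r = inv q \<circ> p"
  have r: "simp_group r (h \<circ> f)" unfolding r_def by (intro simp_group_comp h p)
  have bij: "bij p" "bij q" "bij r" using simp_group_bij p q r by auto
  have "relabel q (relabel r (pair_diag n ps)) = relabel p (pair_diag n ps)"
    using bij by (simp add: relabel_relabel r_def comp_assoc[symmetric] bij_is_surj surj_iff[THEN iffD1])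
  then have "relabel r (pair_diag n ps) = pair_diag n qs"
    using relabel_inj[OF bij(2)] eq u(2) v(2) by metis
  then have rel: "pair_diag n qs (r x) = r (pair_diag n ps x)" for x
    using relabel_apply[OF bij(3)] by metis
  have rn: "1 \<le> r x \<and> r x \<le> n \<longleftrightarrow> 1 \<le> x \<and> x \<le> n" for x by (rule simp_group_bounded[OF S r])
  have rfix: "r x = x" if "\<not> (1 \<le> x \<and> x \<le> n)" for x
    by (rule simp_group_fixes[OF S r]) (use that in auto)
  have bottom: "partner ps y = partner qs y \<and> (partner ps y = y \<longrightarrow> r y = y)" if y: "1 \<le> y" "y \<le> n" for y
  proof -
    have ry: "r (n + y) = n + y" using y by (intro rfix) auto
    then have e: "pair_diag n qs (n + y) = r (pair_diag n ps (n + y))" using rel[of "n + y"] by simp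
    have d: "pair_diag n xs (n + y) = (if partner xs y = y then y else n + partner xs y)" for xs
      using y by (simp add: pair_diag_def)
    have b: "1 \<le> partner ps y" "1 \<le> partner qs y"
      using partner_bounded[OF ps S, of y] partner_bounded[OF qs S, of y] y by auto
    show ?thesis
    proof (cases "partner ps y = y")
      case True
      then have e: "pair_diag n qs (n + y) = r y" using e d by simp
      \<comment> \<open>\<open>r y\<close> is a top point, so \<open>n + y\<close> ends a vertical
        line in the second diagram too.\<close>
      then have "partner qs y = y" using d[of qs] rn[of y] y b by (auto split: if_splits)
      then show ?thesis using e d True by simp
    next
      case False
      have "r (n + partner ps y) = n + partner ps y" using b by (intro rfix) auto
      then have "pair_diag n qs (n + y) = n + partner ps y" using e d False by simp
      then show ?thesis using d[of qs] False b y by (auto split: if_splits)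
    qed
  qed
  have part: "partner ps = partner qs"
  proof
    fix y
    show "partner ps y = partner qs y"
    proof (cases "1 \<le> y \<and> y \<le> n")
      case False
      then have "y \<notin> points ps" "y \<notin> points qs"
        using points_bounded[OF ps S] points_bounded[OF qs S] by auto
      then show ?thesis by (simp add: partner_outside)
    qed (use bottom in blast)
  qed
  have rfix': "r x = x" if "partner ps x = x" for x
    using that bottom[of x] rfix[of x] by blast
  have "r (partner ps x) = partner ps (r x)" for x
  proof (cases "partner ps x = x")
    case True
    then show ?thesis using rfix' by simp
  next
    case False
    then have x: "1 \<le> x" "x \<le> n"
      using points_bounded[OF ps S] partner_neq_iff[OF ps] by auto
    then have "pair_diag n qs (r x) = r (partner ps x)"
      using rel[of x] False by (simp add: pair_diag_def)
    moreover have "r (partner ps x) \<le> n" "1 \<le> r x" "r x \<le> n"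
      using partner_bounded[OF ps S, of x] rn x by blast+
    ultimately show ?thesis unfolding part by (auto simp: pair_diag_def split: if_splits)
  qed
  then have "(h \<circ> f) (tws ps x) = tws ps x"
    using tws_absorb[OF r ps] rfix' partner_outside by blast
  then have "g (h (f (tws ps x))) = g (tws qs x)"
    using tws_cong[OF ps qs part] by simp
  moreover have "g (h z) = z" for z using h(2) by (metis comp_apply id_apply)
  ultimately have "f (tws ps x) = g (tws qs x)" by (simp only:)
  then show ?thesis by (simp only: u(1) v(1))
qed

end

subsection \<open>Concatenation with generators\<close>

text \<open>Partitions are compared through labellings of the points: their equality and refinement
  become statements about equal labels.\<close>

definition kernel_part :: "nat \<Rightarrow> (nat \<Rightarrow> 'l) \<Rightarrow> nat set set" where
  "kernel_part n l = (\<lambda>x. {y \<in> {1..2*n}. l y = l x}) ` {1..2*n}"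

lemma kernel_part_cong:
  assumes "\<And>x y. x \<in> {1..2*n} \<Longrightarrow> y \<in> {1..2*n} \<Longrightarrow> l x = l y \<longleftrightarrow> l' x = l' y"
  shows "kernel_part n l = kernel_part n l'"
  unfolding kernel_part_def by (intro image_cong) (use assms in auto)

lemma kernel_part_block: "B \<in> kernel_part n l \<Longrightarrow> x \<in> B \<Longrightarrow> y \<in> B \<Longrightarrow> l x = l y"
  by (auto simp: kernel_part_def)

lemma kernel_part_blockI:
  assumes "x \<in> {1..2*n}" "y \<in> {1..2*n}" "l x = l y"
  shows "\<exists>B\<in>kernel_part n l. x \<in> B \<and> y \<in> B"
  using assms by (auto simp: kernel_part_def intro!: bexI[of _ x])

lemma kernel_part_eqD:
  assumes "kernel_part n l = kernel_part n l'" "x \<in> {1..2*n}" "y \<in> {1..2*n}"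
  shows "l x = l y \<longleftrightarrow> l' x = l' y"
proof
  show "l' x = l' y" if "l x = l y"
    using kernel_part_blockI[OF assms(2,3) that] unfolding assms(1) by (blast dest: kernel_part_block)
  show "l x = l y" if "l' x = l' y"
    using kernel_part_blockI[OF assms(2,3) that] unfolding assms(1)[symmetric]
    by (blast dest: kernel_part_block)
qed

lemma partition_on_kernel_part: "partition_on {1..2*n} (kernel_part n l)"
  by (rule partition_onI) (auto simp: kernel_part_def disjnt_def)

definition glue :: "nat \<Rightarrow> nat set set \<Rightarrow> nat set set \<Rightarrow> (nat \<times> nat) set" where
  "glue n I H = (blockrel I \<union> blockrel (shiftp n H))\<^sup>*"

lemma glue_left: "B \<in> I \<Longrightarrow> x \<in> B \<Longrightarrow> y \<in> B \<Longrightarrow> (x, y) \<in> glue n I H"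
  by (auto simp: glue_def blockrel_def)

lemma glue_right:
  assumes "B \<in> H" "x \<in> B" "y \<in> B" shows "(n + x, n + y) \<in> glue n I H"
proof -
  have "(\<lambda>x. x + n) ` B \<in> shiftp n H" using assms by (auto simp: shiftp_def)
  moreover have "n + x \<in> (\<lambda>x. x + n) ` B" "n + y \<in> (\<lambda>x. x + n) ` B"
    using imageI[OF assms(2), of "\<lambda>x. x + n"] imageI[OF assms(3), of "\<lambda>x. x + n"]
    by (simp_all only: add.commute)
  ultimately have "(n + x, n + y) \<in> blockrel (shiftp n H)"
    unfolding blockrel_def by (intro CollectI case_prodI bexI conjI)
  then show ?thesis unfolding glue_def by (intro r_into_rtrancl UnI2)
qed

lemma glue_refl: "(x, x) \<in> glue n I H"
  by (simp add: glue_def)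

lemma glue_trans: "(x, y) \<in> glue n I H \<Longrightarrow> (y, z) \<in> glue n I H \<Longrightarrow> (x, z) \<in> glue n I H"
  unfolding glue_def using rtrancl_trans .

lemma glue_sym: "(x, y) \<in> glue n I H \<Longrightarrow> (y, x) \<in> glue n I H"
proof -
  have "sym (blockrel I \<union> blockrel (shiftp n H))" by (auto simp: sym_def blockrel_def)
  then show "(x, y) \<in> glue n I H \<Longrightarrow> (y, x) \<in> glue n I H"
    unfolding glue_def using sym_rtrancl symD by metis
qed

text \<open>Embeds the \<open>2n\<close> points of a product into the \<open>3n\<close> points of the two stacked diagrams.\<close>

definition lift :: "nat \<Rightarrow> nat \<Rightarrow> nat" where
  "lift n y = (if y \<le> n then y else n + y)"

text \<open>A product is computed by labelling the stacked diagrams. Labels that are constant on the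
  blocks of both factors are constant on components; conversely \<open>conn\<close> makes equal
  labels of outer points imply connection.\<close>

lemma concat_kernel_part:
  fixes l :: "nat \<Rightarrow> 'l"
  assumes left: "\<And>B x y. B \<in> I \<Longrightarrow> x \<in> B \<Longrightarrow> y \<in> B \<Longrightarrow> l x = l y"
    and right: "\<And>B x y. B \<in> H \<Longrightarrow> x \<in> B \<Longrightarrow> y \<in> B \<Longrightarrow> l (n + x) = l (n + y)"
    and conn: "\<And>x y. x \<in> {1..2*n} \<Longrightarrow> y \<in> {1..2*n} \<Longrightarrow> l (lift n x) = l (lift n y)
        \<Longrightarrow> (lift n x, lift n y) \<in> glue n I H"
  shows "concat n I H = kernel_part n (\<lambda>y. l (lift n y))"
proof -
  let ?outer = "{1..n} \<union> {2*n+1..3*n}" and ?f = "\<lambda>x::nat. if x \<le> n then x else x - n"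
  have edge: "l x = l y" if "(x, y) \<in> blockrel I \<union> blockrel (shiftp n H)" for x y
  proof -
    consider B where "B \<in> I" "x \<in> B" "y \<in> B"
      | B x' y' where "B \<in> H" "x' \<in> B" "y' \<in> B" "x = x' + n" "y = y' + n"
      using \<open>(x, y) \<in> _\<close> by (auto simp: blockrel_def shiftp_def)
    then show ?thesis
    proof cases
      case 1
      then show ?thesis by (rule left)
    next
      case 2
      show ?thesis using right[OF 2(1-3)] by (simp only: 2(4,5) add.commute)
    qed
  qed
  have glue: "l x = l y" if "(x, y) \<in> glue n I H" for x y
    using that unfolding glue_def by (induction rule: rtrancl_induct) (auto simp: edge)
  have outer: "?outer = lift n ` {1..2*n}"
  proof (intro equalityI subsetI)
    fix x assume "x \<in> ?outer"
    then have "x = lift n (?f x)" "?f x \<in> {1..2*n}" by (auto simp: lift_def)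
    then show "x \<in> lift n ` {1..2*n}" by blast
  qed (auto simp: lift_def)
  have fl: "?f (lift n x) = x" for x by (auto simp: lift_def)
  have "?f ` (glue n I H `` {lift n x} \<inter> lift n ` {1..2*n}) = {y \<in> {1..2*n}. l (lift n y) = l (lift n x)}"
    if x: "x \<in> {1..2*n}" for x
  proof (intro equalityI subsetI)
    fix y assume "y \<in> {y \<in> {1..2*n}. l (lift n y) = l (lift n x)}"
    then have y: "y \<in> {1..2*n}" "l (lift n x) = l (lift n y)" by auto
    then have "lift n y \<in> glue n I H `` {lift n x} \<inter> lift n ` {1..2*n}" using conn[OF x] by blast
    then have "?f (lift n y) \<in> ?f ` (glue n I H `` {lift n x} \<inter> lift n ` {1..2*n})"
      by (rule imageI)
    then show "y \<in> ?f ` (glue n I H `` {lift n x} \<inter> lift n ` {1..2*n})" by (simp only: fl)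
  next
    fix y assume "y \<in> ?f ` (glue n I H `` {lift n x} \<inter> lift n ` {1..2*n})"
    then obtain z where z: "y = ?f (lift n z)" "z \<in> {1..2*n}" "(lift n x, lift n z) \<in> glue n I H" by blast
    then have "y = z" using fl by (simp only:)
    then show "y \<in> {y \<in> {1..2*n}. l (lift n y) = l (lift n x)}" using glue[OF z(3)] z(2) by simp
  qed
  then have "(\<lambda>x. ?f ` (glue n I H `` {x} \<inter> ?outer)) ` ?outer = kernel_part n (\<lambda>y. l (lift n y))"
    unfolding outer kernel_part_def image_image by (intro image_cong) auto
  then show ?thesis unfolding concat_def Let_def glue_def[symmetric] by (simp only: Setcompr_eq_image)
qed

text \<open>Fixing the outside points makes equality of functions the same as equality of diagrams
  (\<open>blocks_inj\<close>).\<close>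

definition matching :: "nat \<Rightarrow> (nat \<Rightarrow> nat) \<Rightarrow> bool" where
  "matching n m \<longleftrightarrow> (\<forall>x. m (m x) = x) \<and> (\<forall>x\<in>{1..2*n}. m x \<in> {1..2*n} \<and> m x \<noteq> x)
     \<and> (\<forall>x. x \<notin> {1..2*n} \<longrightarrow> m x = x)"

lemma matchingD:
  assumes "matching n m"
  shows "m (m x) = x" "x \<in> {1..2*n} \<Longrightarrow> m x \<in> {1..2*n}" "x \<in> {1..2*n} \<Longrightarrow> m x \<noteq> x"
    "x \<notin> {1..2*n} \<Longrightarrow> m x = x"
  using assms unfolding matching_def by blast+

lemma matching_eq_iff: "matching n m \<Longrightarrow> m x = m y \<longleftrightarrow> x = y"
  by (metis matchingD(1))

definition blocks :: "nat \<Rightarrow> (nat \<Rightarrow> nat) \<Rightarrow> nat set set" where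
  "blocks n m = kernel_part n (\<lambda>x. {x, m x})"

lemma blocks_inj:
  assumes "matching n m" "matching n m'" "blocks n m = blocks n m'" shows "m = m'"
proof
  fix x
  show "m x = m' x"
  proof (cases "x \<in> {1..2*n}")
    case True
    have mm: "m (m x) = x" and mx: "m x \<in> {1..2*n}" using matchingD(1,2)[OF assms(1)] True by auto
    have "{x, m x} = {m x, m (m x)}" unfolding mm by (rule insert_commute)
    then have "{x, m' x} = {m x, m' (m x)}"
      using kernel_part_eqD[OF assms(3)[unfolded blocks_def] True mx] by (rule iffD1[rotated])
    then show ?thesis using matchingD(3)[OF assms(1) True] by auto
  next
    case False
    then show ?thesis using matchingD(4) assms by metis
  qed
qed

lemma concat_s_part:
  assumes "matching n m" "1 \<le> i" "i < n"
  shows "concat n (s_part n i) (blocks n m) = blocks n (relabel (transpose i (Suc i)) m)"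
proof -
  let ?\<tau> = "transpose i (Suc i)"
  \<comment> \<open>Middle and bottom points carry their arc in \<open>m\<close>; a top point
    carries the arc of the middle point it is joined to, which lies in column
    \<open>?\<tau> z\<close>.\<close>
  define l where "l z = (if z \<le> n then {?\<tau> z, m (?\<tau> z)} else {z - n, m (z - n)})" for z
  let ?G = "glue n (s_part n i) (blocks n m)"
  have \<tau>: "?\<tau> y \<in> {1..2*n} \<longleftrightarrow> y \<in> {1..2*n}" "?\<tau> y \<le> n \<longleftrightarrow> y \<le> n" for y
    using assms by (auto simp: transpose_def)
  have l: "l (lift n y) = {?\<tau> y, m (?\<tau> y)}" if "y \<in> {1..2*n}" for y
    using that assms by (auto simp: l_def lift_def transpose_def)
  have mid: "(lift n y, n + ?\<tau> y) \<in> ?G" if y: "y \<in> {1..2*n}" for y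
  proof (cases "y \<le> n")
    case True
    have "{y, n + ?\<tau> y} \<in> s_part n i" using True y assms by (auto simp: s_part_def transpose_def)
    then show ?thesis using True by (intro glue_left) (auto simp: lift_def)
  next
    case False
    then show ?thesis using assms glue_refl by (simp add: lift_def)
  qed
  have "concat n (s_part n i) (blocks n m) = kernel_part n (\<lambda>y. l (lift n y))"
  proof (rule concat_kernel_part)
    show "l x = l y" if "B \<in> s_part n i" "x \<in> B" "y \<in> B" for B x y
      using that assms unfolding s_part_def by (auto simp: l_def)
    show "l (n + x) = l (n + y)" if "B \<in> blocks n m" "x \<in> B" "y \<in> B" for B x y
      using kernel_part_block[OF that[unfolded blocks_def]] that
      by (auto simp: l_def blocks_def kernel_part_def)
    show "(lift n x, lift n y) \<in> ?G"
      if xy: "x \<in> {1..2*n}" "y \<in> {1..2*n}" and e: "l (lift n x) = l (lift n y)" for x y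
    proof -
      have "{?\<tau> x, m (?\<tau> x)} = {?\<tau> y, m (?\<tau> y)}" using e l xy by simp
      then obtain B where "B \<in> blocks n m" "?\<tau> x \<in> B" "?\<tau> y \<in> B"
        using kernel_part_blockI[of "?\<tau> x" n "?\<tau> y" "\<lambda>x. {x, m x}"] \<tau>(1) xy
        unfolding blocks_def by auto
      then have "(n + ?\<tau> x, n + ?\<tau> y) \<in> ?G" by (rule glue_right)
      then show ?thesis using mid xy glue_sym glue_trans by metis
    qed
  qed
  also have "\<dots> = blocks n (relabel ?\<tau> m)"
    unfolding blocks_def
  proof (rule kernel_part_cong)
    fix x y assume xy: "x \<in> {1..2*n}" "y \<in> {1..2*n}"
    have "{?\<tau> x, m (?\<tau> x)} = ?\<tau> ` {x, ?\<tau> (m (?\<tau> x))}" "{?\<tau> y, m (?\<tau> y)} = ?\<tau> ` {y, ?\<tau> (m (?\<tau> y))}"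
      by auto
    then show "l (lift n x) = l (lift n y) \<longleftrightarrow> {x, relabel ?\<tau> m x} = {y, relabel ?\<tau> m y}"
      unfolding l[OF xy(1)] l[OF xy(2)] relabel_transpose
      by (simp only: inj_image_eq_iff[OF inj_transpose])
  qed
  finally show ?thesis .
qed

lemma eq_kernel_partI:
  assumes part: "partition_on {1..2*n} P"
    and eq: "\<And>x y. x \<in> {1..2*n} \<Longrightarrow> y \<in> {1..2*n} \<Longrightarrow> (\<exists>B\<in>P. x \<in> B \<and> y \<in> B) \<longleftrightarrow> l x = l y"
  shows "P = kernel_part n l"
proof -
  have block: "B = {y \<in> {1..2*n}. l y = l x}" if B: "B \<in> P" "x \<in> B" for B x
  proof (intro equalityI subsetI)
    have sub: "z \<in> {1..2*n}" if "z \<in> B" for z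
      using partition_onD1[OF part] B(1) that by blast
    {
      fix y assume y: "y \<in> B"
      then show "y \<in> {y \<in> {1..2*n}. l y = l x}" using eq[OF sub sub, of y x] sub B by blast
    next
      fix y assume "y \<in> {y \<in> {1..2*n}. l y = l x}"
      then have "y \<in> {1..2*n}" "l x = l y" by simp_all
      then obtain C where C: "C \<in> P" "x \<in> C" "y \<in> C" using eq[OF sub[OF B(2)]] by blast
      then have "C = B" using partition_onD2[OF part] B unfolding disjoint_def by blast
      then show "y \<in> B" using C by simp
    }
  qed
  show ?thesis
  proof (intro equalityI subsetI)
    fix B assume B: "B \<in> P"
    then obtain x where x: "x \<in> B" using partition_onD3[OF part] by fastforce
    then have "x \<in> {1..2*n}" using partition_onD1[OF part] B by blast
    then show "B \<in> kernel_part n l" unfolding kernel_part_def block[OF B x] by (rule imageI)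
  next
    fix B assume "B \<in> kernel_part n l"
    then obtain x where x: "x \<in> {1..2*n}" "B = {y \<in> {1..2*n}. l y = l x}"
      unfolding kernel_part_def by (rule imageE)
    then obtain C where "C \<in> P" "x \<in> C" using partition_onD1[OF part] by blast
    then show "B \<in> P" using block x(2) by simp
  qed
qed

lemma refines_kernel_part:
  "refines (kernel_part n l) (kernel_part n l') \<longleftrightarrow>
     (\<forall>x\<in>{1..2*n}. \<forall>y\<in>{1..2*n}. l x = l y \<longrightarrow> l' x = l' y)"
proof
  assume r: "refines (kernel_part n l) (kernel_part n l')"
  show "\<forall>x\<in>{1..2*n}. \<forall>y\<in>{1..2*n}. l x = l y \<longrightarrow> l' x = l' y"
  proof (intro ballI impI)
    fix x y assume x: "x \<in> {1..2*n}" and y: "y \<in> {1..2*n}" and e: "l x = l y"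
    obtain B where B: "B \<in> kernel_part n l'" "x \<in> B" using kernel_part_blockI[OF x x HOL.refl] by blast
    then obtain C where C: "C \<subseteq> kernel_part n l" "B = \<Union>C" using r unfolding refines_def by blast
    then obtain A where A: "A \<in> C" "x \<in> A" using B(2) by blast
    then obtain z where z: "A = {y \<in> {1..2*n}. l y = l z}"
      using C(1) unfolding kernel_part_def by blast
    then have "y \<in> A" using A(2) y e by simp
    then have "y \<in> B" using A C by blast
    then show "l' x = l' y" using kernel_part_block[OF B(1,2)] by blast
  qed
next
  assume r: "\<forall>x\<in>{1..2*n}. \<forall>y\<in>{1..2*n}. l x = l y \<longrightarrow> l' x = l' y"
  show "refines (kernel_part n l) (kernel_part n l')"
    unfolding refines_def
  proof
    fix B assume "B \<in> kernel_part n l'"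
    then obtain x where x: "x \<in> {1..2*n}" "B = {y \<in> {1..2*n}. l' y = l' x}"
      unfolding kernel_part_def by (rule imageE)
    have *: "B = \<Union>((\<lambda>x. {y \<in> {1..2*n}. l y = l x}) ` B)"
    proof (intro equalityI subsetI)
      fix y assume "y \<in> B"
      then show "y \<in> \<Union>((\<lambda>x. {y \<in> {1..2*n}. l y = l x}) ` B)" using x(2) by blast
    next
      fix y assume "y \<in> \<Union>((\<lambda>x. {y \<in> {1..2*n}. l y = l x}) ` B)"
      then obtain z where z: "z \<in> B" "y \<in> {1..2*n}" "l y = l z" by blast
      have zx: "z \<in> {1..2*n}" "l' z = l' x" using z(1) x(2) by simp_all
      then have "l' y = l' z" using r z(2,3) by blast
      then have "l' y = l' x" using zx(2) by (rule HOL.trans)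
      then show "y \<in> B" using x(2) z(2) by simp
    qed
    have "(\<lambda>x. {y \<in> {1..2*n}. l y = l x}) ` B \<subseteq> kernel_part n l"
      unfolding kernel_part_def by (rule image_mono) (auto simp: x(2))
    then show "\<exists>S\<subseteq>kernel_part n l. B = \<Union>S" using * by (intro exI conjI)
  qed
qed

text \<open>The column of a point; the blocks of the unit are the columns.\<close>

definition pos :: "nat \<Rightarrow> nat \<Rightarrow> nat" where
  "pos n y = (if y \<le> n then y else y - n)"

lemma pos_bounds: "x \<in> {1..2*n} \<Longrightarrow> 1 \<le> pos n x \<and> pos n x \<le> n"
  by (auto simp: pos_def)

lemma id_part_kernel: "id_part n = kernel_part n (pos n)"
proof (rule eq_kernel_partI)
  have mem: "B \<in> id_part n \<longleftrightarrow> (\<exists>i. 1 \<le> i \<and> i \<le> n \<and> B = {i, n + i})" for B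
    by (auto simp: id_part_def)
  show "partition_on {1..2*n} (id_part n)"
  proof (rule partition_onI)
    show "\<Union>(id_part n) = {1..2*n}"
    proof (intro equalityI subsetI)
      fix x assume "x \<in> {1..2*n}"
      then have "{pos n x, n + pos n x} \<in> id_part n" "x \<in> {pos n x, n + pos n x}"
        using pos_bounds[of x n] mem by (auto simp: pos_def)
      then show "x \<in> \<Union>(id_part n)" by blast
    qed (auto simp: mem)
    show "{} \<notin> id_part n" by (auto simp: mem)
    show "disjnt A B" if "A \<in> id_part n" "B \<in> id_part n" "A \<noteq> B" for A B
      using that by (auto simp: mem disjnt_def)
  qed
  fix x y assume xy: "x \<in> {1..2*n}" "y \<in> {1..2*n}"
  show "(\<exists>B\<in>id_part n. x \<in> B \<and> y \<in> B) \<longleftrightarrow> pos n x = pos n y"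
  proof
    assume "pos n x = pos n y"
    then have "x \<in> {pos n x, n + pos n x}" "y \<in> {pos n x, n + pos n x}" by (auto simp: pos_def split: if_splits)
    moreover have "{pos n x, n + pos n x} \<in> id_part n" 
      unfolding mem using pos_bounds[OF xy(1)] by (intro exI[of _ "pos n x"]) simp
    ultimately show "\<exists>B\<in>id_part n. x \<in> B \<and> y \<in> B" by (intro bexI conjI)
  qed (auto simp: mem pos_def)
qed

lemma matching_vertical: "matching n (pair_diag n [])"
  by (auto simp: matching_def pair_diag_def)

lemma id_part_blocks: "id_part n = blocks n (pair_diag n [])"
  unfolding id_part_kernel blocks_def
  by (rule kernel_part_cong) (auto simp: pair_diag_def pos_def doubleton_eq_iff)

lemma concat_id_part:
  assumes "matching n m" shows "concat n (id_part n) (blocks n m) = blocks n m"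
proof -
  let ?l = "\<lambda>z. if z \<le> n then {z, m z} else {z - n, m (z - n)}"
  let ?G = "glue n (id_part n) (blocks n m)"
  have l: "?l (lift n y) = {y, m y}" for y by (simp add: lift_def)
  have mid: "(lift n y, n + y) \<in> ?G" if "y \<in> {1..2*n}" for y
  proof (cases "y \<le> n")
    case True
    have "{y, n + y} \<in> id_part n" using True that by (auto simp: id_part_def)
    then show ?thesis using True by (intro glue_left) (auto simp: lift_def)
  qed (simp add: lift_def glue_refl)
  have "concat n (id_part n) (blocks n m) = kernel_part n (\<lambda>y. ?l (lift n y))"
  proof (rule concat_kernel_part)
    show "?l x = ?l y" if "B \<in> id_part n" "x \<in> B" "y \<in> B" for B x y
      using that by (auto simp: id_part_def)
    show "?l (n + x) = ?l (n + y)" if "B \<in> blocks n m" "x \<in> B" "y \<in> B" for B x y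
      using kernel_part_block[OF that[unfolded blocks_def]] that
      by (auto simp: blocks_def kernel_part_def)
    show "(lift n x, lift n y) \<in> ?G"
      if xy: "x \<in> {1..2*n}" "y \<in> {1..2*n}" and e: "?l (lift n x) = ?l (lift n y)" for x y
    proof -
      have "{x, m x} = {y, m y}" using e unfolding l .
      then obtain B where "B \<in> blocks n m" "x \<in> B" "y \<in> B"
        using kernel_part_blockI[of x n y "\<lambda>x. {x, m x}"] xy unfolding blocks_def by auto
      then have "(n + x, n + y) \<in> ?G" by (rule glue_right)
      then show ?thesis using mid xy glue_sym glue_trans by metis
    qed
  qed
  then show ?thesis unfolding l blocks_def .
qed

lemma cap_involution:
  assumes m: "\<And>x. m (m x) = x" and ne: "a \<noteq> b" "m a \<noteq> a" "m b \<noteq> b"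
  shows "cap a b m (cap a b m x) = x"
proof -
  have ab: "m x = a \<longleftrightarrow> x = m a" "m x = b \<longleftrightarrow> x = m b" for x using m by metis+
  consider "x = a" | "x = b" | "x \<noteq> a" "x \<noteq> b" "m x = a" | "x \<noteq> a" "x \<noteq> b" "m x = b"
    | "x \<noteq> a" "x \<noteq> b" "m x \<noteq> a" "m x \<noteq> b" by blast
  then show ?thesis
  proof cases
    case 3
    then have x: "x = m a" "m b \<noteq> a" using ab by metis+
    then show ?thesis using 3 ne m by (simp add: cap_def)
  next
    case 4
    then have x: "x = m b" "m a \<noteq> b" using ab by metis+
    moreover have "m b \<noteq> m a" using ne(1) m by metis
    ultimately show ?thesis using 4 ne m by (simp add: cap_def)
  next
    case 5
    then show ?thesis using m by (simp add: cap_def)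
  qed (use ne in \<open>simp_all add: cap_def\<close>)
qed

lemma concat_t_part:
  assumes m: "matching n m" and i: "1 \<le> i" "i < n"
  shows "concat n (t_part n i) (blocks n m) = blocks n (cap i (Suc i) m)"
proof -
  \<comment> \<open>The lower arc of \<open>t_part\<close> joins the middle points of columns
    \<open>i\<close> and \<open>Suc i\<close>, so the arcs of \<open>m\<close> at these two points
    merge into one component.\<close>
  let ?sp = "{i, Suc i, m i, m (Suc i)}"
  define L where "L a = (if a \<in> ?sp then ?sp else {a, m a})" for a
  \<comment> \<open>The top arc is a component of its own: its label \<open>{}\<close> differs from
    every \<open>L a\<close>, which contains \<open>a\<close>.\<close>
  define l where "l z = (if z \<le> n then if z = i \<or> z = Suc i then {} else L z else L (z - n))" for z
  let ?G = "glue n (t_part n i) (blocks n m)"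
  note mm = matchingD(1)[OF m]
  have sp: "m a \<in> ?sp \<longleftrightarrow> a \<in> ?sp" for a using mm by (metis insertCI insertE singletonD)
  have Lm: "L (m a) = L a" for a unfolding L_def sp mm by (simp add: insert_commute)
  have aL: "a \<in> L a" for a by (simp add: L_def)
  have Leq: "L x = L y \<longleftrightarrow> (if x \<in> ?sp then y \<in> ?sp else y = x \<or> y = m x)" for x y
  proof (cases "x \<in> ?sp")
    case True
    then have "L x = ?sp" by (simp add: L_def)
    then show ?thesis using True aL[of y] by (auto simp: L_def)
  next
    case False
    then have Lx: "L x = {x, m x}" by (simp add: L_def)
    show ?thesis
    proof
      assume Lxy: "L x = L y"
      then show "if x \<in> ?sp then y \<in> ?sp else y = x \<or> y = m x" 
        using aL[of y] False unfolding Lxy[symmetric] Lx by simp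
    next
      assume "if x \<in> ?sp then y \<in> ?sp else y = x \<or> y = m x"
      then have "y = x \<or> y = m x" using False by (simp only: if_False)
      then show "L x = L y" using Lm[of x] by (elim disjE) (simp_all only:)
    qed
  qed
  have l: "l (lift n y) = (if y = i \<or> y = Suc i then {} else L y)" for y
    using i by (simp add: l_def lift_def)
  have mid: "(lift n y, n + y) \<in> ?G" if y: "y \<in> {1..2*n}" "y \<noteq> i" "y \<noteq> Suc i" for y
  proof (cases "y \<le> n")
    case True
    have "{y, n + y} \<in> t_part n i" using True y by (auto simp: t_part_def)
    then show ?thesis using True by (intro glue_left) (auto simp: lift_def)
  qed (simp add: lift_def glue_refl)
  have arc: "(n + x, n + m x) \<in> ?G" if x: "x \<in> {1..2*n}" for x
  proof -
    have "{x, m x} = {m x, m (m x)}" unfolding mm by (rule insert_commute)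
    then obtain B where "B \<in> blocks n m" "x \<in> B" "m x \<in> B"
      using kernel_part_blockI[OF x matchingD(2)[OF m x], of "\<lambda>x. {x, m x}"] unfolding blocks_def by blast
    then show ?thesis by (rule glue_right)
  qed
  have in2: "i \<in> {1..2*n}" "Suc i \<in> {1..2*n}" using i by auto
  have "{n+i, n+i+1} \<in> t_part n i" by (simp add: t_part_def)
  then have bend: "(n + i, n + Suc i) \<in> ?G" by (rule glue_left) auto
  have star: "(n + i, n + x) \<in> ?G" if "x \<in> ?sp" for x
    using that bend arc[OF in2(1)] arc[OF in2(2)] glue_trans glue_refl by blast
  have "concat n (t_part n i) (blocks n m) = kernel_part n (\<lambda>y. l (lift n y))"
  proof (rule concat_kernel_part)
    show "l x = l y" if B: "B \<in> t_part n i" "x \<in> B" "y \<in> B" for B x y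
    proof -
      have s: "L i = L (Suc i)" by (simp add: L_def)
      consider "B = {i, Suc i}" | "B = {n + i, n + Suc i}"
        | j where "B = {j, n + j}" "1 \<le> j" "j \<le> n" "j \<noteq> i" "j \<noteq> Suc i"
        using B(1) unfolding t_part_def by auto
      then show ?thesis
      proof cases
        case 1
        then show ?thesis using B i by (auto simp: l_def)
      next
        case 2
        have "l (n + i) = L i" "l (n + Suc i) = L i" using i s by (simp_all add: l_def)
        moreover have "x = n + i \<or> x = n + Suc i" "y = n + i \<or> y = n + Suc i"
          using B(2,3) 2 by simp_all
        ultimately show ?thesis by (elim disjE) (simp_all only:)
      next
        case 3
        then have "l j = L j" "l (n + j) = L j" by (simp_all add: l_def)
        moreover have "x = j \<or> x = n + j" "y = j \<or> y = n + j" using B(2,3) 3(1) by simp_all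
        ultimately show ?thesis by (elim disjE) (simp_all only:)
      qed
    qed
    show "l (n + x) = l (n + y)" if B: "B \<in> blocks n m" "x \<in> B" "y \<in> B" for B x y
    proof -
      have "{x, m x} = {y, m y}" using kernel_part_block[OF B[unfolded blocks_def]] .
      then have "y = x \<or> y = m x" by blast
      then have "L x = L y" using Lm[of x] by (elim disjE) (simp_all only:)
      moreover have "x \<in> {1..2*n}" "y \<in> {1..2*n}" using B by (auto simp: blocks_def kernel_part_def)
      ultimately show ?thesis by (simp add: l_def)
    qed
    show "(lift n x, lift n y) \<in> ?G"
      if xy: "x \<in> {1..2*n}" "y \<in> {1..2*n}" and e: "l (lift n x) = l (lift n y)" for x y
    proof (cases "x = i \<or> x = Suc i")
      case True
      then have "l (lift n y) = {}" using e unfolding l by simp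
      then have "y = i \<or> y = Suc i" using aL[of y] unfolding l by (metis empty_iff)
      moreover have "{i, i+1} \<in> t_part n i" by (simp add: t_part_def)
      ultimately show ?thesis using True i by (intro glue_left) (auto simp: lift_def)
    next
      case False
      then have "l (lift n y) = L x" using e unfolding l by simp
      then have y: "y \<noteq> i" "y \<noteq> Suc i" and Lxy: "L x = L y"
        using aL[of x] unfolding l by (metis empty_iff)+
      have "(n + x, n + y) \<in> ?G"
      proof (cases "x \<in> ?sp")
        case True
        then have "y \<in> ?sp" using Lxy Leq by simp
        then show ?thesis using glue_trans[OF glue_sym[OF star[OF True]] star] by blast
      next
        case False
        then have "y = x \<or> y = m x" using Lxy Leq by simp
        then show ?thesis using arc[OF xy(1)] glue_refl[of "n + x"] by (elim disjE) (simp_all only:)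
      qed
      moreover have "(lift n x, n + x) \<in> ?G" "(lift n y, n + y) \<in> ?G"
        using mid xy y False by blast+
      ultimately show ?thesis using glue_sym glue_trans by metis
    qed
  qed
  also have "\<dots> = blocks n (cap i (Suc i) m)"
    unfolding blocks_def
  proof (rule kernel_part_cong)
    fix x y
    let ?c = "cap i (Suc i) m"
    have fpf: "m i \<noteq> i" "m (Suc i) \<noteq> Suc i" using matchingD(3)[OF m] in2 by blast+
    have cc: "?c (?c z) = z" for z by (rule cap_involution[OF mm _ fpf]) simp
    have "{x, ?c x} = {y, ?c y} \<longleftrightarrow> y = x \<or> y = ?c x" using cc by (metis doubleton_eq_iff)
    moreover have "l (lift n x) = l (lift n y) \<longleftrightarrow> y = x \<or> y = ?c x"
    proof (cases "x = i \<or> x = Suc i")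
      case True
      then show ?thesis unfolding l using aL[of y] by (auto simp: cap_def)
    next
      case False
      then have "l (lift n x) = l (lift n y) \<longleftrightarrow> y \<noteq> i \<and> y \<noteq> Suc i \<and> L x = L y"
        unfolding l using aL[of x] by auto
      also have "\<dots> \<longleftrightarrow> y = x \<or> y = ?c x"
      proof -
        \<comment> \<open>Apart from \<open>i\<close> and \<open>Suc i\<close>, the merged component
          can only contain \<open>m i\<close> and \<open>m (Suc i)\<close>, the points that
          \<open>cap\<close> joins.\<close>
        have ab: "m x = i \<longleftrightarrow> x = m i" "m x = Suc i \<longleftrightarrow> x = m (Suc i)" for x using mm by metis+
        have "m i \<noteq> m (Suc i)" using mm by (metis n_not_Suc_n)
        then consider "x = m i" "x \<noteq> m (Suc i)" | "x = m (Suc i)" "x \<noteq> m i" | "x \<noteq> m i" "x \<noteq> m (Suc i)"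
          by metis
        then show ?thesis
        proof cases
          case 1
          then have mi: "m (Suc i) \<noteq> i" "m x = i" using False mm by metis+
          then have "?c x = m (Suc i)" using False by (simp add: cap_def)
          then show ?thesis using 1 mi False fpf unfolding Leq by auto
        next
          case 2
          then have mi: "m i \<noteq> Suc i" "m x = Suc i" using False mm by metis+
          then have "?c x = m i" using False by (simp add: cap_def)
          then show ?thesis using 2 mi False fpf unfolding Leq by auto
        next
          case 3
          then have mi: "m x \<noteq> i" "m x \<noteq> Suc i" using ab by blast+
          then have "?c x = m x" using False by (simp add: cap_def)
          then show ?thesis using 3 mi False unfolding Leq by auto
        qed
      qed
      finally show ?thesis .
    qed
    ultimately show "l (lift n x) = l (lift n y) \<longleftrightarrow> {x, ?c x} = {y, ?c y}" by blast
  qed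
  finally show ?thesis .
qed

section \<open>Boxed partitions as sets of indices\<close>

text \<open>\<open>linked T\<close> is the least equivalence relation containing the steps from
  \<open>k\<close> to \<open>Suc k\<close> for \<open>k \<in> T\<close>; this is its induction
  rule.\<close>

lemma linked_chain:
  assumes ab: "linked T a b" and step: "\<And>k. k \<in> T \<Longrightarrow> P k (Suc k)"
    and refl: "\<And>x. P x x" and sym: "\<And>x y. P x y \<Longrightarrow> P y x"
    and trans: "\<And>x y z. P x y \<Longrightarrow> P y z \<Longrightarrow> P x z"
  shows "P a b"
proof -
  have up: "P a (a + d)" if "{a..<a + d} \<subseteq> T" for a d
    using that
  proof (induction d)
    case (Suc d)
    have "{a..<a + d} \<subseteq> T" "a + d \<in> T" using Suc.prems by (auto simp: subset_iff)
    then have "P a (Suc (a + d))" using trans[OF Suc.IH step] by blast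
    then show ?case by simp
  qed (simp add: refl)
  show ?thesis
  proof (cases "a \<le> b")
    case True
    then have "b = a + (b - a)" by simp
    moreover have "P a (a + (b - a))"
      by (rule up) (use ab True in \<open>simp add: linked_def min_def max_def\<close>)
    ultimately show ?thesis by (simp only:)
  next
    case False
    then have "a = b + (a - b)" by simp
    moreover have "P b (b + (a - b))"
      by (rule up) (use ab False in \<open>simp add: linked_def min_def max_def\<close>)
    ultimately have "P b a" by (simp only:)
    then show ?thesis by (rule sym)
  qed
qed

lemma linked_Suc_iff: "linked T k (Suc k) \<longleftrightarrow> k \<in> T"
  by (auto simp: linked_def min_def max_def)

lemma linked_empty: "linked {} a b \<longleftrightarrow> a = b"
  by (auto simp: linked_def min_def max_def)

lemma linked_mono: "linked S a b \<Longrightarrow> S \<subseteq> T \<Longrightarrow> linked T a b"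
  by (auto simp: linked_def)

definition link_class :: "nat set \<Rightarrow> nat \<Rightarrow> nat set" where
  "link_class T a = {b. linked T a b}"

lemma link_class_eq_iff: "link_class T a = link_class T b \<longleftrightarrow> linked T a b"
proof
  assume "link_class T a = link_class T b"
  then have "b \<in> link_class T a" by (simp add: link_class_def)
  then show "linked T a b" by (simp add: link_class_def)
next
  assume "linked T a b"
  then show "link_class T a = link_class T b"
    unfolding link_class_def by (intro Collect_cong) (blast intro: linked_trans linked_sym)
qed

text \<open>Fuses the columns \<open>k\<close> and \<open>k + 1\<close> for each
  \<open>k \<in> T\<close>. By \<open>boxed_imp_box\<close> and \<open>box_inj\<close> this encodes
  every boxed partition by its set of fused neighbours.\<close>

definition box :: "nat \<Rightarrow> nat set \<Rightarrow> nat set set" where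
  "box n T = kernel_part n (\<lambda>y. link_class T (pos n y))"

lemma id_part_box: "id_part n = box n {}"
  unfolding id_part_kernel box_def
  by (rule kernel_part_cong) (simp add: link_class_eq_iff linked_empty)

lemma concat_b_part:
  assumes i: "1 \<le> i" "i < n" and T: "T \<subseteq> {1..<n}"
  shows "concat n (b_part n i) (box n T) = box n (insert i T)"
proof -
  let ?T = "insert i T" and ?G = "glue n (b_part n i) (box n T)"
  \<comment> \<open>Column of any of the \<open>3n\<close> stacked points. Every connection stays
    within linked columns, so the class of the column can serve as the label.\<close>
  let ?p = "\<lambda>z. if z \<le> n then z else if z \<le> 2 * n then z - n else z - 2 * n"
  let ?l = "\<lambda>z. link_class ?T (?p z)"
  have lift: "?p (lift n y) = pos n y" for y by (simp add: lift_def pos_def)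
  have mem: "B \<in> b_part n i \<longleftrightarrow> B = {i, Suc i, n + i, n + Suc i} \<or>
      (\<exists>j. B = {j, n + j} \<and> 1 \<le> j \<and> j \<le> n \<and> j \<noteq> i \<and> j \<noteq> Suc i)" for B
    by (auto simp: b_part_def)
  have right: "(n + x, n + y) \<in> ?G"
    if xy: "x \<in> {1..2*n}" "y \<in> {1..2*n}" "linked T (pos n x) (pos n y)" for x y
  proof -
    obtain B where "B \<in> box n T" "x \<in> B" "y \<in> B"
      using kernel_part_blockI[OF xy(1,2), of "\<lambda>y. link_class T (pos n y)"] xy(3)
      unfolding box_def link_class_eq_iff by blast
    then show ?thesis by (rule glue_right)
  qed
  have big: "(x, y) \<in> ?G" if "x \<in> {i, Suc i, n + i, n + Suc i}" "y \<in> {i, Suc i, n + i, n + Suc i}" for x y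
    by (rule glue_left[OF _ that]) (simp add: mem)
  have top: "(y, n + y) \<in> ?G" if "1 \<le> y" "y \<le> n" for y
  proof (cases "y = i \<or> y = Suc i")
    case True
    then show ?thesis by (intro big) auto
  next
    case False
    then have "{y, n + y} \<in> b_part n i" using that by (auto simp: mem)
    then show ?thesis by (rule glue_left) auto
  qed
  have mid: "(lift n y, n + pos n y) \<in> ?G" if y: "y \<in> {1..2*n}" for y
  proof (cases "y \<le> n")
    case True
    then show ?thesis using top y by (simp add: lift_def pos_def)
  next
    case False
    have "(n + y, n + pos n y) \<in> ?G"
      by (rule right) (use y False in \<open>auto simp: pos_def\<close>)
    then show ?thesis using False by (simp add: lift_def)
  qed
  \<comment> \<open>Along the middle row, the step at \<open>i\<close> comes from the large block of
    \<open>b_part\<close> and every other step from the second factor.\<close>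
  have row: "(n + a, n + b) \<in> ?G" if "linked ?T a b" for a b
    using that
  proof (rule linked_chain)
    fix k assume k: "k \<in> ?T"
    show "(n + k, n + Suc k) \<in> ?G"
    proof (cases "k = i")
      case True
      then show ?thesis by (intro big) auto
    next
      case False
      then have "k \<in> T" using k by simp
      then show ?thesis
        using T linked_Suc[of k T] by (intro right) (auto simp: pos_def)
    qed
  qed (blast intro: glue_refl glue_sym glue_trans)+
  have "concat n (b_part n i) (box n T) = kernel_part n (\<lambda>y. ?l (lift n y))"
  proof (rule concat_kernel_part)
    show "?l x = ?l y" if B: "B \<in> b_part n i" "x \<in> B" "y \<in> B" for B x y
      unfolding link_class_eq_iff
    proof (cases "B = {i, Suc i, n + i, n + Suc i}")
      case True
      then have "?p x = i \<or> ?p x = Suc i" "?p y = i \<or> ?p y = Suc i" using B(2,3) i by auto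
      moreover have "linked ?T i (Suc i)" "linked ?T (Suc i) i" using linked_Suc linked_sym by blast+
      ultimately show "linked ?T (?p x) (?p y)" by (elim disjE) (simp_all only: linked_refl)
    next
      case False
      then obtain j where j: "B = {j, n + j}" "1 \<le> j" "j \<le> n" using B(1) mem by blast
      then have "?p x = j" "?p y = j" using B(2,3) by auto
      then show "linked ?T (?p x) (?p y)" by (simp only: linked_refl)
    qed
    show "?l (n + x) = ?l (n + y)" if B: "B \<in> box n T" "x \<in> B" "y \<in> B" for B x y
    proof -
      have "linked T (pos n x) (pos n y)"
        using kernel_part_block[OF B[unfolded box_def]] by (simp only: link_class_eq_iff)
      then have "linked ?T (pos n x) (pos n y)" by (rule linked_mono) blast
      moreover have "x \<in> {1..2*n}" "y \<in> {1..2*n}" using B by (auto simp: box_def kernel_part_def)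
      then have "?p (n + x) = pos n x" "?p (n + y) = pos n y" by (auto simp: pos_def)
      ultimately show ?thesis by (simp only: link_class_eq_iff)
    qed
    show "(lift n x, lift n y) \<in> ?G"
      if xy: "x \<in> {1..2*n}" "y \<in> {1..2*n}" and e: "?l (lift n x) = ?l (lift n y)" for x y
    proof -
      have "linked ?T (pos n x) (pos n y)" using e unfolding lift link_class_eq_iff .
      then have "(n + pos n x, n + pos n y) \<in> ?G" by (rule row)
      then show ?thesis using mid[OF xy(1)] glue_sym[OF mid[OF xy(2)]] glue_trans by blast
    qed
  qed
  then show ?thesis unfolding lift box_def .
qed

lemma box_inj:
  assumes T: "T \<subseteq> {1..<n}" and T': "T' \<subseteq> {1..<n}" and eq: "box n T = box n T'"
  shows "T = T'"
proof -
  have "k \<in> T \<longleftrightarrow> k \<in> T'" if k: "1 \<le> k" "k < n" for k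
  proof -
    have "pos n k = k" "pos n (Suc k) = Suc k" using k by (auto simp: pos_def)
    then show ?thesis
      using kernel_part_eqD[OF eq[unfolded box_def], of k "Suc k"] k
      by (simp add: link_class_eq_iff linked_Suc_iff)
  qed
  then show ?thesis using T T' by auto
qed

lemma boxed_box:
  assumes "T \<subseteq> {1..<n}" shows "boxed n (box n T)"
  unfolding boxed_def
proof (intro conjI ballI)
  show "is_setpart n (box n T)" unfolding is_setpart_def box_def by (rule partition_on_kernel_part)
  show "refines (id_part n) (box n T)" unfolding id_part_kernel box_def refines_kernel_part by simp
  fix A assume "A \<in> restrict_top n (box n T)"
  then obtain x where A: "A = {y \<in> {1..2*n}. link_class T (pos n y) = link_class T x} \<inter> {1..n}"
    unfolding restrict_top_def box_def kernel_part_def by blast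
  have A: "y \<in> A \<longleftrightarrow> 1 \<le> y \<and> y \<le> n \<and> linked T x y" for y
    unfolding A using linked_sym by (auto simp: link_class_eq_iff pos_def)
  show "interval_set A"
    unfolding interval_set_def
  proof (intro allI impI, elim conjE)
    fix a b c assume a: "a \<in> A" and c: "c \<in> A" and le: "a \<le> b" "b \<le> c"
    have "linked T a c" using a c A linked_sym linked_trans by blast
    then have "linked T a b" using linked_between le by blast
    then have "linked T x b" using a A linked_trans by blast
    then show "b \<in> A" using a c le A by simp
  qed
qed

text \<open>Blocks are unions of columns, so the top row determines the partition; interval blocks
  in turn are determined by which neighbours \<open>k\<close> and \<open>k + 1\<close> share a
  block. Those \<open>k\<close> form \<open>T\<close>.\<close>

lemma boxed_imp_box:
  assumes J: "boxed n J"
  obtains T where "T \<subseteq> {1..<n}" "J = box n T"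
proof -
  have part: "partition_on {1..2*n} J" using J by (simp add: boxed_def is_setpart_def)
  define R where "R x y \<longleftrightarrow> (\<exists>B\<in>J. x \<in> B \<and> y \<in> B)" for x y
  have Rrefl: "R x x" if "x \<in> {1..2*n}" for x
    unfolding R_def using partition_onD1[OF part] that by blast
  have Rsym: "R x y \<Longrightarrow> R y x" for x y unfolding R_def by blast
  have Rtrans: "R x z" if xy: "R x y" and yz: "R y z" for x y z
  proof -
    obtain B where B: "B \<in> J" "x \<in> B" "y \<in> B" using xy R_def by blast
    obtain C where C: "C \<in> J" "y \<in> C" "z \<in> C" using yz R_def by blast
    have "B = C" using partition_onD2[OF part] B C unfolding disjoint_def by blast
    then show ?thesis unfolding R_def using B C by blast
  qed
  have Rpos: "R x (pos n x)" if x: "x \<in> {1..2*n}" for x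
  proof -
    obtain B where B: "B \<in> J" "x \<in> B" using Rrefl[OF x] R_def by blast
    obtain C where C: "C \<subseteq> id_part n" "B = \<Union>C"
      using J B(1) unfolding boxed_def refines_def by blast
    then obtain A where A: "A \<in> C" "x \<in> A" using B(2) by blast
    then have "A \<in> id_part n" using C(1) by blast
    then obtain i where "A = {i, n + i} \<and> i \<in> {1..n}" unfolding id_part_def by blast
    then have i: "A = {i, n + i}" "1 \<le> i" "i \<le> n" by simp_all
    then have "pos n x = i" using A(2) by (auto simp: pos_def)
    then have "pos n x \<in> A" using i(1) by simp
    then have "pos n x \<in> B" using A(1) C(2) by blast
    then show ?thesis unfolding R_def using B by blast
  qed
  define T where "T = {k \<in> {1..<n}. R k (Suc k)}"
  have T: "T \<subseteq> {1..<n}" by (auto simp: T_def)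
  have lR: "R a b" if l: "linked T a b" and a: "1 \<le> a" "a \<le> n" for a b
  proof -
    have "R a b \<or> a = b"
      using l
    proof (rule linked_chain[where P = "\<lambda>a b. R a b \<or> a = b"])
      show "R k (Suc k) \<or> k = Suc k" if "k \<in> T" for k using that by (simp add: T_def)
    qed (blast intro: Rsym Rtrans)+
    then show ?thesis using Rrefl[of a] a by auto
  qed
  have Rl_le: "linked T a b" if R: "R a b" and ab: "1 \<le> a" "a \<le> b" "b \<le> n" for a b
  proof -
    obtain B where B: "B \<in> J" "a \<in> B" "b \<in> B" using R R_def by blast
    then have "B \<inter> {1..n} \<in> restrict_top n J" using ab unfolding restrict_top_def by auto
    then have int: "interval_set (B \<inter> {1..n})" using J unfolding boxed_def by blast
    have "a \<in> B \<inter> {1..n}" "b \<in> B \<inter> {1..n}" using B ab by simp_all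
    then have inB: "k \<in> B" if "a \<le> k" "k \<le> b" for k
      using int[unfolded interval_set_def, rule_format, of a b k] that by blast
    have "R k (Suc k)" if "a \<le> k" "k < b" for k
      unfolding R_def using B(1) inB[of k] inB[of "Suc k"] that by (intro bexI[of _ B]) simp_all
    then have "{a..<b} \<subseteq> T" using ab unfolding T_def by (auto simp del: One_nat_def)
    then show ?thesis using ab by (simp add: linked_def)
  qed
  have Rl: "linked T a b" if R: "R a b" and ab: "1 \<le> a" "a \<le> n" "1 \<le> b" "b \<le> n" for a b
    using Rl_le[OF R] Rl_le[OF Rsym[OF R]] ab linked_sym[of T b a] by (cases "a \<le> b") simp_all
  have "J = kernel_part n (\<lambda>y. link_class T (pos n y))"
  proof (rule eq_kernel_partI[OF part])
    fix x y assume x: "x \<in> {1..2*n}" and y: "y \<in> {1..2*n}"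
    have "R x y \<longleftrightarrow> R (pos n x) (pos n y)"
      using Rpos[OF x] Rpos[OF y] Rsym Rtrans by blast
    also have "\<dots> \<longleftrightarrow> linked T (pos n x) (pos n y)"
      using Rl lR pos_bounds[OF x] pos_bounds[OF y] by blast
    finally show "(\<exists>B\<in>J. x \<in> B \<and> y \<in> B) \<longleftrightarrow> link_class T (pos n x) = link_class T (pos n y)"
      unfolding R_def link_class_eq_iff .
  qed
  then show ?thesis using that T unfolding box_def by blast
qed

section \<open>Brauer partitions and the refinement condition\<close>

lemma blocks_block:
  assumes m: "matching n m" and x: "x \<in> {1..2*n}"
  shows "{y \<in> {1..2*n}. {y, m y} = {x, m x}} = {x, m x}"
proof (intro equalityI subsetI)
  fix y assume "y \<in> {x, m x}"
  then have "y = x \<or> y = m x" by blast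
  then show "y \<in> {y \<in> {1..2*n}. {y, m y} = {x, m x}}"
    using x matchingD(1,2)[OF m] by (elim disjE) (simp_all add: insert_commute)
qed blast

lemma brauer_blocks:
  assumes m: "matching n m" shows "brauer n (blocks n m)"
  unfolding brauer_def
proof (intro conjI ballI)
  show "is_setpart n (blocks n m)" unfolding is_setpart_def blocks_def by (rule partition_on_kernel_part)
  fix B assume "B \<in> blocks n m"
  then obtain x where x: "x \<in> {1..2*n}" "B = {y \<in> {1..2*n}. {y, m y} = {x, m x}}"
    unfolding blocks_def kernel_part_def by (rule imageE)
  have "x \<noteq> m x" using matchingD(3)[OF m x(1)] by simp
  then show "card B = 2" unfolding x(2) blocks_block[OF m x(1)] by (rule card_2_iff[THEN iffD2, OF exI, OF exI, OF conjI, OF HOL.refl])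
qed

lemma brauer_imp_blocks:
  assumes I: "brauer n I"
  obtains m where "matching n m" "I = blocks n m"
proof -
  have part: "partition_on {1..2*n} I" and card: "\<And>B. B \<in> I \<Longrightarrow> card B = 2"
    using I by (auto simp: brauer_def is_setpart_def)
  have "\<exists>y. y \<noteq> x \<and> {x, y} \<in> I" if x: "x \<in> {1..2*n}" for x
  proof -
    obtain B where B: "B \<in> I" "x \<in> B" using partition_onD1[OF part] x by blast
    obtain a b where "B = {a, b}" "a \<noteq> b" using card[OF B(1)] by (meson card_2_iff)
    then show ?thesis using B by (metis insertE insert_commute singletonD)
  qed
  then obtain h where h: "\<And>x. x \<in> {1..2*n} \<Longrightarrow> h x \<noteq> x \<and> {x, h x} \<in> I" by metis
  define m where "m x = (if x \<in> {1..2*n} then h x else x)" for x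
  have mI: "m x \<noteq> x" "{x, m x} \<in> I" if "x \<in> {1..2*n}" for x
    using h[OF that] that by (simp_all add: m_def)
  have mr: "m x \<in> {1..2*n}" if "x \<in> {1..2*n}" for x
    using partition_onD1[OF part] mI(2)[OF that] by blast
  have uniq: "B = C" if "B \<in> I" "C \<in> I" "x \<in> B" "x \<in> C" for B C x
    using partition_onD2[OF part] that unfolding disjoint_def by blast
  have mm: "m (m x) = x" if x: "x \<in> {1..2*n}" for x
  proof -
    have "{m x, m (m x)} = {x, m x}"
      by (rule uniq[OF mI(2)[OF mr[OF x]] mI(2)[OF x], of "m x"]) simp_all
    then show ?thesis using mI(1)[OF x] by (metis doubleton_eq_iff)
  qed
  have m: "matching n m"
    unfolding matching_def
  proof (intro conjI allI ballI impI)
    have out: "m x = x" if "x \<notin> {1..2*n}" for x unfolding m_def using that by (rule if_not_P)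
    show "m (m x) = x" for x using mm[of x] out[of x] by (cases "x \<in> {1..2*n}") simp_all
    show "m x \<in> {1..2*n}" "m x \<noteq> x" if "x \<in> {1..2*n}" for x by (rule mr[OF that], rule mI(1)[OF that])
    show "m x = x" if "x \<notin> {1..2*n}" for x by (rule out[OF that])
  qed
  have "I = blocks n m"
    unfolding blocks_def
  proof (rule eq_kernel_partI[OF part])
    fix x y assume x: "x \<in> {1..2*n}" and y: "y \<in> {1..2*n}"
    show "(\<exists>B\<in>I. x \<in> B \<and> y \<in> B) \<longleftrightarrow> {x, m x} = {y, m y}"
    proof
      assume "\<exists>B\<in>I. x \<in> B \<and> y \<in> B"
      then obtain B where B: "B \<in> I" "x \<in> B" "y \<in> B" by blast
      have "B = {x, m x}" by (rule uniq[OF B(1) mI(2)[OF x] B(2)]) simp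
      moreover have "B = {y, m y}" by (rule uniq[OF B(1) mI(2)[OF y] B(3)]) simp
      ultimately show "{x, m x} = {y, m y}" by simp
    next
      assume "{x, m x} = {y, m y}"
      then have "y \<in> {x, m x}" by simp
      then show "\<exists>B\<in>I. x \<in> B \<and> y \<in> B" using mI(2)[OF x] by blast
    qed
  qed
  then show ?thesis using that m by blast
qed

text \<open>The blocks of the first partition are single arcs, so refinement only asks that both
  ends of each arc lie in linked columns.\<close>

lemma refines_blocks_box:
  assumes m: "matching n m"
  shows "refines (blocks n m) (box n T) \<longleftrightarrow> (\<forall>x\<in>{1..2*n}. linked T (pos n x) (pos n (m x)))"
  unfolding blocks_def box_def refines_kernel_part link_class_eq_iff
proof
  assume r: "\<forall>x\<in>{1..2*n}. \<forall>y\<in>{1..2*n}. {x, m x} = {y, m y} \<longrightarrow> linked T (pos n x) (pos n y)"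
  show "\<forall>x\<in>{1..2*n}. linked T (pos n x) (pos n (m x))"
  proof
    fix x assume x: "x \<in> {1..2*n}"
    have "{x, m x} = {m x, m (m x)}" unfolding matchingD(1)[OF m] by (rule insert_commute)
    then show "linked T (pos n x) (pos n (m x))" using r x matchingD(2)[OF m x] by blast
  qed
next
  assume r: "\<forall>x\<in>{1..2*n}. linked T (pos n x) (pos n (m x))"
  show "\<forall>x\<in>{1..2*n}. \<forall>y\<in>{1..2*n}. {x, m x} = {y, m y} \<longrightarrow> linked T (pos n x) (pos n y)"
  proof (intro ballI impI)
    fix x y assume x: "x \<in> {1..2*n}" and e: "{x, m x} = {y, m y}"
    have "y = x \<or> y = m x" using e by (metis doubleton_eq_iff)
    then show "linked T (pos n x) (pos n y)"
      using bspec[OF r x] linked_refl[of T "pos n x"] by (elim disjE) (simp_all only:)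
  qed
qed

subsection \<open>Soundness of the relations\<close>

lemma matching_relabel:
  assumes m: "matching n m" and ab: "a \<in> {1..2*n}" "b \<in> {1..2*n}"
  shows "matching n (relabel (transpose a b) m)"
proof -
  let ?t = "transpose a b"
  have t: "?t x \<in> {1..2*n} \<longleftrightarrow> x \<in> {1..2*n}" for x using ab by (simp only: transpose_def) metis
  have out: "?t x = x" if "x \<notin> {1..2*n}" for x
    using ab that by (simp only: transpose_def) metis
  show ?thesis
    unfolding matching_def relabel_transpose
  proof (intro conjI ballI allI impI)
    show "?t (m (?t (?t (m (?t x))))) = x" for x by (simp add: matchingD(1)[OF m])
    show "?t (m (?t x)) \<in> {1..2*n}" if "x \<in> {1..2*n}" for x
      using that unfolding t by (intro matchingD(2)[OF m]) (simp only: t)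
    show "?t (m (?t x)) \<noteq> x" if "x \<in> {1..2*n}" for x
      using that matchingD(3)[OF m, of "?t x"] t[of x] by (metis transpose_involutory)
    show "?t (m (?t x)) = x" if "x \<notin> {1..2*n}" for x
      using that matchingD(4)[OF m that] out by simp
  qed
qed

lemma matching_cap:
  assumes m: "matching n m" and ab: "a \<in> {1..2*n}" "b \<in> {1..2*n}" "a \<noteq> b"
  shows "matching n (cap a b m)"
  unfolding matching_def
proof (intro conjI ballI allI impI)
  note fpf = matchingD(3)[OF m]
  have in_m: "m x \<in> {1..2*n} \<longleftrightarrow> x \<in> {1..2*n}" for x
    using matchingD(2,4)[OF m, of x] by (cases "x \<in> {1..2*n}") simp_all
  show "cap a b m (cap a b m x) = x" for x
    by (rule cap_involution[OF matchingD(1)[OF m] ab(3) fpf[OF ab(1)] fpf[OF ab(2)]])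
  show "cap a b m x \<in> {1..2*n}" if "x \<in> {1..2*n}" for x
    unfolding cap_def using ab that in_m by presburger
  show "cap a b m x \<noteq> x" if x: "x \<in> {1..2*n}" for x
  proof -
    have "m x \<noteq> x" using fpf[OF x] .
    moreover have "m b \<noteq> x" if "m x = a" using that matchingD(1)[OF m] ab(3) by metis
    moreover have "m a \<noteq> x" if "m x = b" using that matchingD(1)[OF m] ab(3) by metis
    ultimately show ?thesis unfolding cap_def using ab(3) by presburger
  qed
  show "cap a b m x = x" if x: "x \<notin> {1..2*n}" for x
  proof -
    have "m x = x" "x \<noteq> a" "x \<noteq> b" using matchingD(4)[OF m x] x ab by metis+
    then show ?thesis by (simp add: cap_def)
  qed
qed

lemma cap_left [simp]: "cap a b m a = b"
  by (simp add: cap_def)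

lemma relabel_transpose_fix:
  assumes m: "matching n m" and c: "m a = b"
  shows "relabel (transpose a b) m = m"
proof
  fix x
  have b: "m b = a" using matchingD(1)[OF m] c by metis
  consider "x = a" | "x = b" | "x \<noteq> a" "x \<noteq> b" by blast
  then show "relabel (transpose a b) m x = m x"
  proof cases
    case 3
    then have "m x \<noteq> a" "m x \<noteq> b" using b c matchingD(1)[OF m] by metis+
    then show ?thesis using 3 by (simp add: relabel_transpose)
  qed (simp_all add: relabel_transpose b c)
qed

lemma relabel_transpose_twice: "relabel (transpose a b) (relabel (transpose a b) m) = m"
  by (simp add: relabel_transpose fun_eq_iff)

lemma relabel_transpose_commute:
  assumes "a \<noteq> c" "a \<noteq> d" "b \<noteq> c" "b \<noteq> d"
  shows "relabel (transpose a b) (relabel (transpose c d) m) = relabel (transpose c d) (relabel (transpose a b) m)"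
proof -
  have "transpose a b (transpose c d x) = transpose c d (transpose a b x)" for x
    using assms by (simp add: transpose_def)
  then show ?thesis by (intro ext) (simp only: relabel_transpose)
qed

lemma relabel_transpose_conj:
  assumes "a \<noteq> c" "b \<noteq> c"
  shows "relabel (transpose a b) (relabel (transpose b c) m)
    = relabel (transpose a c) (relabel (transpose a b) m)"
proof -
  have 1: "transpose a b (transpose b c x) = transpose a c (transpose a b x)" for x
    using assms by (simp add: transpose_def)
  have 2: "transpose b c (transpose a b x) = transpose a b (transpose a c x)" for x
    using assms by (simp add: transpose_def)
  show ?thesis by (intro ext) (simp only: relabel_transpose 1 2)
qed

lemma cap_relabel_transpose:
  "cap a b (relabel (transpose c d) m)
    = relabel (transpose c d) (cap (transpose c d a) (transpose c d b) m)"
  using cap_relabel[OF bij_transpose, of c d "transpose c d a" "transpose c d b" m] by simp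

lemma cap_adjacent_matching:
  assumes m: "matching n m" and b: "b \<in> {1..2*n}" and c: "m a = c" "a \<noteq> b" "b \<noteq> c" "a \<noteq> c"
  shows "cap a b m = relabel (transpose b c) m"
  by (rule cap_adjacent[OF matchingD(1)[OF m]]) (use c matchingD(3)[OF m b] in auto)

text \<open>Adjacent edges share a point \<open>b\<close>. The identities are proved for arbitrary
  distinct points, so that \<open>adj_cases\<close> yields both orders of the indices.\<close>

context
  fixes n :: nat and m :: "nat \<Rightarrow> nat" and a b c :: nat
  assumes m: "matching n m" and abc: "a \<in> {1..2*n}" "b \<in> {1..2*n}" "c \<in> {1..2*n}"
    and ne: "a \<noteq> b" "a \<noteq> c" "b \<noteq> c"
begin

lemma cap_cap_adjacent: "cap b c (cap a b m) = relabel (transpose a c) (cap a b m)"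
proof -
  have "matching n (cap a b m)" by (rule matching_cap[OF m abc(1,2) ne(1)])
  moreover have "cap a b m b = a" using ne by (simp add: cap_def)
  ultimately have "cap b c (cap a b m) = relabel (transpose c a) (cap a b m)"
    by (rule cap_adjacent_matching[OF _ abc(3)]) (use ne in auto)
  then show ?thesis by (simp only: transpose_commute)
qed

text \<open>After \<open>cap a b\<close> the point \<open>b\<close> is joined to \<open>a\<close>,
  so each further cap only exchanges \<open>a\<close> and \<open>c\<close>, and the two exchanges
  cancel.\<close>

lemma cap_cap_cap: "cap a b (cap b c (cap a b m)) = cap a b m"
proof -
  have mat: "matching n (cap a b m)" by (rule matching_cap[OF m abc(1,2) ne(1)])
  have "cap a b (cap b c (cap a b m)) = relabel (transpose a c) (cap c b (cap a b m))"
    unfolding cap_cap_adjacent cap_relabel_transpose using ne by simp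
  also have "cap c b (cap a b m) = relabel (transpose a c) (cap a b m)"
    using cap_cap_adjacent cap_commute[of c b] ne by simp
  finally show ?thesis by (simp only: relabel_transpose_twice)
qed

lemma relabel_cap_cap:
  "relabel (transpose a b) (cap b c (cap a b m)) = relabel (transpose b c) (cap a b m)"
proof -
  have mat: "matching n (cap a b m)" by (rule matching_cap[OF m abc(1,2) ne(1)])
  have "relabel (transpose b a) (relabel (transpose a c) (cap a b m))
      = relabel (transpose b c) (relabel (transpose b a) (cap a b m))"
    by (rule relabel_transpose_conj) (use ne in auto)
  moreover have "relabel (transpose b a) (cap a b m) = cap a b m"
    unfolding transpose_commute[of b a] by (rule relabel_transpose_fix[OF mat]) simp
  ultimately show ?thesis unfolding cap_cap_adjacent by (simp only: transpose_commute)
qed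

text \<open>Both sides are \<open>cap a c m\<close> with \<open>b\<close> and \<open>c\<close>
  exchanged: on the right by conjugating the cap, on the left by moving the inner permutation out,
  after which the two caps meet at \<open>a\<close>.\<close>

lemma cap_cap_relabel:
  "cap a b (cap b c (relabel (transpose a b) m)) = cap a b (relabel (transpose b c) m)"
proof -
  have mat: "matching n (cap a c m)" by (rule matching_cap[OF m abc(1,3) ne(2)])
  have l: "cap a b (cap b c (relabel (transpose a b) m))
     = relabel (transpose a b) (cap b a (cap a c m))"
    unfolding cap_relabel_transpose using ne by simp
  have "cap a b (cap a c m) = relabel (transpose b c) (cap a c m)"
    by (rule cap_adjacent_matching[OF mat abc(2)]) (use ne in auto)
  then have "cap b a (cap a c m) = relabel (transpose b c) (cap a c m)"
    using cap_commute[of b a] ne by simp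
  then have "cap a b (cap b c (relabel (transpose a b) m))
     = relabel (transpose a b) (relabel (transpose b c) (cap a c m))" using l by simp
  also have "\<dots> = relabel (transpose b c) (relabel (transpose a c) (cap a c m))"
  proof -
    have "relabel (transpose b c) (relabel (transpose c a) (cap a c m))
        = relabel (transpose b a) (relabel (transpose b c) (cap a c m))"
      by (rule relabel_transpose_conj) (use ne in auto)
    then show ?thesis by (simp only: transpose_commute)
  qed
  also have "relabel (transpose a c) (cap a c m) = cap a c m"
    by (rule relabel_transpose_fix[OF mat]) simp
  also have "relabel (transpose b c) (cap a c m) = cap a b (relabel (transpose b c) m)"
    unfolding cap_relabel_transpose using ne by simp
  finally show ?thesis .
qed

end

lemma cap_cap_same:
  assumes "matching n m" "a \<in> {1..2*n}" "b \<in> {1..2*n}" "a \<noteq> b"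
  shows "cap a b (cap a b m) = cap a b m"
  by (rule cap_absorb[OF matchingD(1)[OF matching_cap[OF assms]]]) simp

text \<open>By \<open>cap_adjacent_matching\<close> either order is an exchange applied to
  \<open>cap b d m\<close>, which has the arcs \<open>a c\<close> and \<open>b d\<close>; exchanging
  \<open>a\<close> with \<open>d\<close>, or \<open>b\<close> with \<open>c\<close>, yields the arcs
  \<open>a b\<close> and \<open>c d\<close>.\<close>

lemma cap_cap_commute_linked:
  assumes m: "matching n m" and abcd: "b \<in> {1..2*n}" "d \<in> {1..2*n}"
    and ne: "a \<noteq> b" "a \<noteq> c" "a \<noteq> d" "b \<noteq> c" "b \<noteq> d" "c \<noteq> d" and ac: "m a = c"
  shows "cap a b (cap c d m) = cap c d (cap a b m)"
proof -
  have ca: "m c = a" using matchingD(1)[OF m] ac by metis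
  let ?M = "cap b d m"
  have M: "matching n ?M" by (rule matching_cap[OF m abcd ne(5)])
  have Ma: "?M a = c" using ne ac by (simp add: cap_def)
  have Mb: "?M b = d" by simp
  have "cap c d m = relabel (transpose d a) m"
    by (rule cap_adjacent_matching[OF m abcd(2)]) (use ne ca in auto)
  then have 1: "cap a b (cap c d m) = relabel (transpose d a) (cap d b m)"
    using ne by (simp add: cap_relabel_transpose)
  have "cap a b m = relabel (transpose b c) m"
    by (rule cap_adjacent_matching[OF m abcd(1)]) (use ne ac in auto)
  then have 2: "cap c d (cap a b m) = relabel (transpose b c) ?M"
    using ne by (simp add: cap_relabel_transpose)
  have "relabel (transpose d a) ?M = relabel (transpose b c) ?M"
  proof
    fix x
    have inv: "?M (?M z) = z" for z by (rule matchingD(1)[OF M])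
    have Mc: "?M c = a" "?M d = b" using inv Ma Mb by metis+
    consider "x = a" | "x = b" | "x = c" | "x = d" | "x \<notin> {a,b,c,d}" by blast
    then show "relabel (transpose d a) ?M x = relabel (transpose b c) ?M x"
    proof cases
      case 5
      then have "?M x \<notin> {a,b,c,d}" using inv Ma Mb Mc by (metis insert_iff singletonD)
      then show ?thesis using 5 by (simp add: relabel_transpose transpose_def)
    qed (use ne in \<open>simp_all add: relabel_transpose transpose_def Ma Mb Mc del: cap_left\<close>)
  qed
  then show ?thesis using 1 2 cap_commute[of d b] ne by simp
qed

lemma cap_cap_commute:
  assumes m: "matching n m"
    and abcd: "a \<in> {1..2*n}" "b \<in> {1..2*n}" "c \<in> {1..2*n}" "d \<in> {1..2*n}"
    and ne: "a \<noteq> b" "a \<noteq> c" "a \<noteq> d" "b \<noteq> c" "b \<noteq> d" "c \<noteq> d"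
  shows "cap a b (cap c d m) = cap c d (cap a b m)"
proof -
  note swap = cap_commute[OF ne(1)] cap_commute[OF ne(6)]
  \<comment> \<open>Does \<open>m\<close> join one pair to the other? Up to renaming, the first four
    cases are one; in the last case the two caps change disjoint sets of points.\<close>
  consider "m a = c" | "m a = d" | "m b = c" | "m b = d"
    | "m a \<noteq> c" "m a \<noteq> d" "m b \<noteq> c" "m b \<noteq> d" by blast
  then show ?thesis
  proof cases
    case 1
    show ?thesis by (rule cap_cap_commute_linked[OF m abcd(2,4) ne 1])
  next
    case 2
    show ?thesis unfolding swap(2)
      by (rule cap_cap_commute_linked[OF m abcd(2,3) _ _ _ _ _ _ 2]) (use ne in auto)
  next
    case 3
    show ?thesis unfolding swap(1)
      by (rule cap_cap_commute_linked[OF m abcd(1,4) _ _ _ _ _ _ 3]) (use ne in auto)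
  next
    case 4
    show ?thesis unfolding swap
      by (rule cap_cap_commute_linked[OF m abcd(1,3) _ _ _ _ _ _ 4]) (use ne in auto)
  next
    case 5
    have mm: "m (m x) = x" for x by (rule matchingD(1)[OF m])
    then have 6: "m c \<noteq> a" "m d \<noteq> a" "m c \<noteq> b" "m d \<noteq> b" using 5 by metis+
    show ?thesis
    proof
      fix x
      consider "x \<in> {a,b,c,d}" | "x \<notin> {a,b,c,d}" "m x = a" | "x \<notin> {a,b,c,d}" "m x = b"
        | "x \<notin> {a,b,c,d}" "m x = c" | "x \<notin> {a,b,c,d}" "m x = d" | "x \<notin> {a,b,c,d}" "m x \<notin> {a,b,c,d}"
        by blast
      then show "cap a b (cap c d m) x = cap c d (cap a b m) x"
      proof cases
        case 1
        then show ?thesis using ne 5 6 by (elim insertE) (simp_all add: cap_def)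
      qed (use ne 5 6 in \<open>simp_all add: cap_def\<close>)
    qed
  qed
qed

lemma matching_gen_op:
  assumes m: "matching n m" and i: "1 \<le> gidx g" "gidx g < n"
  shows "matching n (gen_op g m)"
proof (cases g)
  case (E i)
  then show ?thesis using m by simp
next
  case (Z i)
  then show ?thesis using matching_relabel[OF m, of i "Suc i"] assms(2,3) by simp
next
  case (D i)
  then show ?thesis using matching_cap[OF m, of i "Suc i"] assms(2,3) by simp
qed

text \<open>\<open>diag\<close> from an arbitrary starting diagram, because a relation applied
  inside a word meets the diagram of whatever stands to its right.\<close>

definition ops :: "gen list \<Rightarrow> (nat \<Rightarrow> nat) \<Rightarrow> nat \<Rightarrow> nat" where
  "ops w = foldr gen_op w"

lemma ops_simps [simp]:
  "ops [] m = m" "ops (g # w) m = gen_op g (ops w m)" "ops (u @ v) m = ops u (ops v m)"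
  by (simp_all add: ops_def)

lemma diag_ops: "diag n w = ops w (pair_diag n [])"
  by (induction w) simp_all

lemma words_Cons [simp]: "g # w \<in> words n \<longleftrightarrow> 1 \<le> gidx g \<and> gidx g < n \<and> w \<in> words n"
  by (auto simp: words_def)

lemma words_Nil [simp]: "[] \<in> words n"
  by (simp add: words_def)

lemma words_append [simp]: "u @ v \<in> words n \<longleftrightarrow> u \<in> words n \<and> v \<in> words n"
  by (auto simp: words_def)

lemma words_iff: "w \<in> words n \<longleftrightarrow> gidx ` set w \<subseteq> {1..<n}"
  by (auto simp: words_def)

lemma matching_ops: "matching n m \<Longrightarrow> w \<in> words n \<Longrightarrow> matching n (ops w m)"
  by (induction w) (simp_all add: matching_gen_op)

lemma adj_cases:
  assumes "adj i j"
  obtains a b c where "a \<noteq> b" "a \<noteq> c" "b \<noteq> c"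
    "a \<in> {i, Suc i}" "b \<in> {i, Suc i}" "c \<in> {j, Suc j}"
    "cap i (Suc i) = cap a b" "cap j (Suc j) = cap b c"
    "transpose i (Suc i) = transpose a b" "transpose j (Suc j) = transpose b c"
proof -
  consider "i = Suc j" | "j = Suc i" using assms unfolding adj_def by fastforce
  then show ?thesis
  proof cases
    case i: 1
    show ?thesis
    proof (rule that[of "Suc i" i j])
      show "cap i (Suc i) = cap (Suc i) i" "cap j (Suc j) = cap i j"
        unfolding i by (rule ext, rule cap_commute, simp)+
      show "transpose i (Suc i) = transpose (Suc i) i" "transpose j (Suc j) = transpose i j"
        unfolding i by (rule transpose_commute)+
    qed (simp_all add: i)
  next
    case 2
    show ?thesis by (rule that[of i "Suc i" "Suc j"]) (simp_all add: 2)
  qed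
qed

text \<open>The letters \<open>E i\<close> act trivially here, so the relations among them alone
  hold at once; their content lies in the second component, which \<open>rels_gidx\<close>
  covers.\<close>

lemma rels_ops:
  assumes "(u, v) \<in> rels n" "matching n m" shows "ops u m = ops v m"
  using assms(1)
proof cases
  case (ee i)
  then show ?thesis by simp
next
  case (ecomm i j)
  then show ?thesis by simp
next
  case (zbraid i j)
  from zbraid(7) obtain a b c where abc: "a \<noteq> b" "a \<noteq> c" "b \<noteq> c"
    and mem: "a \<in> {i, Suc i}" "b \<in> {i, Suc i}" "c \<in> {j, Suc j}"
    and cap: "cap i (Suc i) = cap a b" "cap j (Suc j) = cap b c"
    and t: "transpose i (Suc i) = transpose a b" "transpose j (Suc j) = transpose b c"
    by (rule adj_cases) blast
  \<comment> \<open>Both sides of the braid relation are the transposition of \<open>a\<close> and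
    \<open>c\<close>.\<close>
  have "relabel (transpose a b) (relabel (transpose b c) (relabel (transpose a b) m))
      = relabel (transpose a c) m"
    using relabel_transpose_conj[OF abc(2,3)] by (simp add: relabel_transpose_twice)
  moreover have "relabel (transpose b c) (relabel (transpose a b) (relabel (transpose b c) m))
      = relabel (transpose a c) m"
    using relabel_transpose_conj[of c a b] abc by (simp add: relabel_transpose_twice transpose_commute)
  ultimately show ?thesis using zbraid(1,2) t by simp
next
  case (zcomm i j)
  then show ?thesis by (auto simp: far_def intro!: relabel_transpose_commute)
next
  case (ez i j)
  then show ?thesis by simp
next
  case (zz i)
  then show ?thesis by (simp add: relabel_transpose_twice)
next
  case (ezi i)
  then show ?thesis by simp
next
  case (dd i)
  then show ?thesis using cap_cap_same[OF assms(2), of i "Suc i"] by simp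
next
  case (dcomm i j)
  then show ?thesis using cap_cap_commute[OF assms(2), of i "Suc i" j "Suc j"] by (auto simp: far_def)
next
  case (de i j)
  then show ?thesis by simp
next
  case (dei i)
  then show ?thesis by simp
next
  case (ddd i j)
  from ddd(7) obtain a b c where abc: "a \<noteq> b" "a \<noteq> c" "b \<noteq> c"
    and mem: "a \<in> {i, Suc i}" "b \<in> {i, Suc i}" "c \<in> {j, Suc j}"
    and t: "cap i (Suc i) = cap a b" "cap j (Suc j) = cap b c"
      "transpose i (Suc i) = transpose a b" "transpose j (Suc j) = transpose b c"
    by (rule adj_cases) blast
  have "a \<in> {1..2*n}" "b \<in> {1..2*n}" "c \<in> {1..2*n}" using mem ddd(3-6) by auto
  from cap_cap_cap[OF assms(2) this abc] show ?thesis using ddd(1,2) t by simp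
next
  case (zdd i j)
  from zdd(7) obtain a b c where abc: "a \<noteq> b" "a \<noteq> c" "b \<noteq> c"
    and mem: "a \<in> {i, Suc i}" "b \<in> {i, Suc i}" "c \<in> {j, Suc j}"
    and t: "cap i (Suc i) = cap a b" "cap j (Suc j) = cap b c"
      "transpose i (Suc i) = transpose a b" "transpose j (Suc j) = transpose b c"
    by (rule adj_cases) blast
  have "a \<in> {1..2*n}" "b \<in> {1..2*n}" "c \<in> {1..2*n}" using mem zdd(3-6) by auto
  from relabel_cap_cap[OF assms(2) this abc] show ?thesis using zdd(1,2) t by simp
next
  case (ddz i j)
  from ddz(7) obtain a b c where abc: "a \<noteq> b" "a \<noteq> c" "b \<noteq> c"
    and mem: "a \<in> {i, Suc i}" "b \<in> {i, Suc i}" "c \<in> {j, Suc j}"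
    and t: "cap i (Suc i) = cap a b" "cap j (Suc j) = cap b c"
      "transpose i (Suc i) = transpose a b" "transpose j (Suc j) = transpose b c"
    by (rule adj_cases) blast
  have "a \<in> {1..2*n}" "b \<in> {1..2*n}" "c \<in> {1..2*n}" using mem ddz(3-6) by auto
  from cap_cap_relabel[OF assms(2) this abc] show ?thesis using ddz(1,2) t by simp
next
  case (zd i)
  then show ?thesis
    using relabel_transpose_fix[OF matching_cap[OF assms(2), of i "Suc i"], of i "Suc i"] by simp
next
  case (dz i)
  then show ?thesis
    using relabel_transpose_fix[OF matching_cap[OF assms(2), of i "Suc i"], of i "Suc i"]
      cap_commute[of "Suc i" i] by (simp add: cap_relabel_transpose)
next
  case (zdfar i j)
  then show ?thesis by (auto simp: cap_relabel_transpose transpose_def far_def)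
qed

text \<open>Soundness for the second component, which depends on the index set only. The
  \<open>E\<close> letters on the right of \<open>zz\<close> and \<open>ddd\<close> keep this set
  intact.\<close>

lemma rels_gidx: "(u, v) \<in> rels n \<Longrightarrow> gidx ` set u = gidx ` set v"
  by (cases rule: rels.cases) auto

text \<open>\<open>congr\<close> lives on all lists, but by this invariant a derivation that starts
  in \<open>words n\<close> never leaves it.\<close>

lemma congr_gidx: "(u, v) \<in> congr n \<Longrightarrow> gidx ` set u = gidx ` set v"
  by (induction rule: congr.induct) (auto simp: rels_gidx image_Un)

lemma congr_ops:
  "(u, v) \<in> congr n \<Longrightarrow> u \<in> words n \<Longrightarrow> matching n m \<Longrightarrow> ops u m = ops v m"
proof (induction arbitrary: m rule: congr.induct)
  case (base u v)
  then show ?case by (simp only: rels_ops)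
next
  case (sym u v)
  then have "u \<in> words n" using congr_gidx words_iff by metis
  then show ?case using sym by simp
next
  case (trans u v w)
  then have "v \<in> words n" using congr_gidx words_iff by metis
  then show ?case using trans by simp
next
  case (ctx u v a b)
  then show ?case using matching_ops by simp
qed simp

subsection \<open>Generation\<close>

text \<open>The refinement condition on a pair, in the form of
  \<open>refines_blocks_box\<close>.\<close>

definition links_respect :: "nat \<Rightarrow> nat set \<Rightarrow> (nat \<Rightarrow> nat) \<Rightarrow> bool" where
  "links_respect n T m \<longleftrightarrow> (\<forall>x\<in>{1..2*n}. linked T (pos n x) (pos n (m x)))"

lemma links_respectD: "links_respect n T m \<Longrightarrow> x \<in> {1..2*n} \<Longrightarrow> linked T (pos n x) (pos n (m x))"
  by (simp only: links_respect_def)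

lemma links_respect_mono: "links_respect n S m \<Longrightarrow> S \<subseteq> T \<Longrightarrow> links_respect n T m"
  unfolding links_respect_def using linked_mono by blast

lemma links_respect_relabel:
  assumes r: "links_respect n T m" and m: "matching n m"
    and ab: "a \<in> {1..2*n}" "b \<in> {1..2*n}" "linked T (pos n a) (pos n b)"
  shows "links_respect n T (relabel (transpose a b) m)"
  unfolding links_respect_def relabel_transpose
proof
  fix x assume x: "x \<in> {1..2*n}"
  let ?t = "transpose a b"
  have t: "linked T (pos n z) (pos n (?t z))" for z
    using ab(3) linked_sym[OF ab(3)] by (simp add: transpose_def)
  have "?t x \<in> {1..2*n}" using x ab(1,2) by (simp only: transpose_def) metis
  then have "linked T (pos n (?t x)) (pos n (m (?t x)))" by (rule links_respectD[OF r])
  then show "linked T (pos n x) (pos n (?t (m (?t x))))"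
    using t[of x] t[of "m (?t x)"] linked_trans by meson
qed

lemma links_respect_cap:
  assumes r: "links_respect n T m" and m: "matching n m"
    and ab: "a \<in> {1..2*n}" "b \<in> {1..2*n}" "linked T (pos n a) (pos n b)"
  shows "links_respect n T (cap a b m)"
  unfolding links_respect_def
proof
  fix x assume x: "x \<in> {1..2*n}"
  note ba = linked_sym[OF ab(3)]
  have mx: "linked T (pos n x) (pos n (m x))" by (rule links_respectD[OF r x])
  consider "x = a" | "x = b" | "x \<noteq> a" "x \<noteq> b" "m x = a" | "x \<noteq> a" "x \<noteq> b" "m x = b" "m x \<noteq> a"
    | "x \<noteq> a" "x \<noteq> b" "m x \<noteq> a" "m x \<noteq> b" by blast
  then show "linked T (pos n x) (pos n (cap a b m x))"
  proof cases
    case 1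
    then show ?thesis using ab(3) by (simp add: cap_def)
  next
    case 2
    then show ?thesis using ba by (cases "a = b") (simp_all add: cap_def)
  next
    case 3
    have "linked T (pos n x) (pos n a)" using mx 3(3) by simp
    then have "linked T (pos n x) (pos n (m b))"
      using ab(3) links_respectD[OF r ab(2)] linked_trans by meson
    then show ?thesis using 3 by (simp add: cap_def)
  next
    case 4
    have "linked T (pos n x) (pos n b)" using mx 4(3) by simp
    then have "linked T (pos n x) (pos n (m a))"
      using ba links_respectD[OF r ab(1)] linked_trans by meson
    then show ?thesis using 4 by (simp add: cap_def)
  next
    case 5
    then show ?thesis using mx by (simp add: cap_def)
  qed
qed

lemma matching_diag: "w \<in> words n \<Longrightarrow> matching n (diag n w)"
  unfolding diag_ops by (rule matching_ops[OF matching_vertical])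

lemma links_respect_diag: "w \<in> words n \<Longrightarrow> links_respect n (gidx ` set w) (diag n w)"
proof (induction w)
  case Nil
  show ?case by (auto simp: links_respect_def pos_def pair_diag_def)
next
  case (Cons g w)
  let ?T = "gidx ` set (g # w)" and ?i = "gidx g"
  have w: "w \<in> words n" and i: "1 \<le> ?i" "?i < n" using Cons.prems by simp_all
  have m: "matching n (diag n w)" by (rule matching_diag[OF w])
  have r: "links_respect n ?T (diag n w)"
    by (rule links_respect_mono[OF Cons.IH[OF w]]) auto
  have l: "?i \<in> {1..2*n}" "Suc ?i \<in> {1..2*n}" "linked ?T (pos n ?i) (pos n (Suc ?i))"
    using i linked_Suc[of ?i ?T] by (simp_all add: pos_def)
  have "links_respect n ?T (relabel (transpose ?i (Suc ?i)) (diag n w))"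
    "links_respect n ?T (cap ?i (Suc ?i) (diag n w))"
    by (rule links_respect_relabel[OF r m l] links_respect_cap[OF r m l])+
  then show ?case using r by (cases g) simp_all
qed

text \<open>From here on an involution and a set of indices replace the two partitions.\<close>

lemma eval_word:
  "w \<in> words n \<Longrightarrow> eval n w = (blocks n (diag n w), box n (gidx ` set w))"
proof (induction w)
  case Nil
  show ?case by (simp add: brone_def id_part_blocks[symmetric] id_part_box[symmetric])
next
  case (Cons g w)
  have w: "w \<in> words n" and i: "1 \<le> gidx g" "gidx g < n" using Cons.prems by simp_all
  have m: "matching n (diag n w)" by (rule matching_diag[OF w])
  have T: "gidx ` set w \<subseteq> {1..<n}" using w by (simp only: words_iff)
  show ?case
    using Cons.IH[OF w] i concat_b_part[OF i T] concat_id_part[OF m]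
      concat_s_part[OF m i] concat_t_part[OF m i]
    by (cases g) (simp_all add: brmult_def)
qed

lemma eval_in_BR: "w \<in> words n \<Longrightarrow> eval n w \<in> BR n"
  unfolding BR_def
  using brauer_blocks[OF matching_diag] boxed_box[of "gidx ` set w" n]
    refines_blocks_box[OF matching_diag] links_respect_diag[of w n]
  by (auto simp: eval_word words_iff links_respect_def)

section \<open>Diagrams reached with given indices\<close>

definition reachable :: "nat \<Rightarrow> nat set \<Rightarrow> (nat \<Rightarrow> nat) set" where
  "reachable n T = {diag n w | w. gidx ` set w \<subseteq> T}"

lemma reachable_vertical: "pair_diag n [] \<in> reachable n T"
  unfolding reachable_def by (rule CollectI, rule exI[of _ "[]"]) simp

lemma reachable_gen_op:
  assumes "m \<in> reachable n T" "gidx g \<in> T" shows "gen_op g m \<in> reachable n T"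
proof -
  obtain w where w: "m = diag n w" "gidx ` set w \<subseteq> T" using assms(1) unfolding reachable_def by blast
  then have "gen_op g m = diag n (g # w)" "gidx ` set (g # w) \<subseteq> T" using assms(2) by simp_all
  then show ?thesis unfolding reachable_def by blast
qed

text \<open>Phrased as a closure property of the swap so that \<open>linked_chain\<close> applies;
  transitivity is \<open>(x z) = (x y)(y z)(x y)\<close>.\<close>

lemma reachable_relabel:
  assumes "linked T a b"
  shows "\<forall>m\<in>reachable n T. relabel (transpose a b) m \<in> reachable n T"
  using assms
proof (rule linked_chain)
  fix k assume "k \<in> T"
  then show "\<forall>m\<in>reachable n T. relabel (transpose k (Suc k)) m \<in> reachable n T"
    using reachable_gen_op[of _ n T "Z k"] by simp
next
  fix x show "\<forall>m\<in>reachable n T. relabel (transpose x x) m \<in> reachable n T"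
    by simp
next
  fix x y assume "\<forall>m\<in>reachable n T. relabel (transpose x y) m \<in> reachable n T"
  then show "\<forall>m\<in>reachable n T. relabel (transpose y x) m \<in> reachable n T"
    by (simp only: transpose_commute[of y x])
next
  fix x y z
  assume xy: "\<forall>m\<in>reachable n T. relabel (transpose x y) m \<in> reachable n T"
    and yz: "\<forall>m\<in>reachable n T. relabel (transpose y z) m \<in> reachable n T"
  show "\<forall>m\<in>reachable n T. relabel (transpose x z) m \<in> reachable n T"
  proof (cases "y = z \<or> x = z")
    case True
    then show ?thesis
    proof
      assume "y = z"
      then show ?thesis using xy by simp
    next
      assume "x = z"
      then show ?thesis by simp
    qed
  next
    case False
    have "relabel (transpose x z) m
        = relabel (transpose x y) (relabel (transpose y z) (relabel (transpose x y) m))" for m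
      using relabel_transpose_conj[of x z y "relabel (transpose x y) m"] False
      by (simp add: relabel_transpose_twice)
    then show ?thesis using xy yz by simp
  qed
qed

lemma reachable_cap:
  assumes "linked T a b" "a \<noteq> b" "m \<in> reachable n T" shows "cap a b m \<in> reachable n T"
proof -
  have *: "cap a b m \<in> reachable n T" if ab: "linked T a b" "a < b" for a b
  proof -
    let ?t = "transpose (Suc a) b"
    have a: "a \<in> T" using ab by (auto simp: linked_def)
    have l: "linked T (Suc a) b" using ab by (auto simp: linked_def min_def max_def)
    have "relabel ?t m \<in> reachable n T" using reachable_relabel[OF l] assms(3) by blast
    then have "cap a (Suc a) (relabel ?t m) \<in> reachable n T"
      using reachable_gen_op[of _ n T "D a"] a by simp
    then have "relabel ?t (cap a b m) \<in> reachable n T"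
      using ab(2) by (simp add: cap_relabel_transpose)
    then have "relabel ?t (relabel ?t (cap a b m)) \<in> reachable n T"
      using reachable_relabel[OF l] by blast
    then show ?thesis by (simp only: relabel_transpose_twice)
  qed
  show ?thesis
  proof (cases "a < b")
    case False
    then have "cap b a m \<in> reachable n T" using * linked_sym[OF assms(1)] assms(2) by simp
    then show ?thesis using cap_commute[OF assms(2)] by simp
  qed (use * assms(1) in blast)
qed

text \<open>By counting: otherwise the bottom row of the class of \<open>a\<close> is matched into, hence onto, its top row.\<close>

lemma ex_bottom_arc:
  assumes m: "matching n m" and r: "links_respect n T m"
    and a: "1 \<le> a" "a \<le> n" "m a \<le> n"
  shows "\<exists>c. 1 \<le> c \<and> c \<le> n \<and> linked T a c \<and> n < m (n + c)"
proof (rule ccontr)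
  assume no: "\<not> ?thesis"
  let ?C = "{c \<in> {1..n}. linked T a c}" and ?g = "\<lambda>c. m (n + c)"
  have top: "m (n + c) \<le> n" if "c \<in> ?C" for c
  proof (rule ccontr)
    assume "\<not> m (n + c) \<le> n"
    then show False using that no by auto
  qed
  have "?g ` ?C \<subseteq> ?C"
  proof
    fix y assume "y \<in> ?g ` ?C"
    then obtain c where c: "c \<in> ?C" "y = m (n + c)" by blast
    have nc: "n + c \<in> {1..2*n}" using c(1) by simp
    have "y \<le> n" using top[OF c(1)] c(2) by simp
    moreover have "1 \<le> y" using matchingD(2)[OF m nc] c(2) by simp
    moreover have "linked T c y"
      using links_respectD[OF r nc] c \<open>y \<le> n\<close> by (simp add: pos_def)
    ultimately show "y \<in> ?C" using c(1) linked_trans by auto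
  qed
  moreover have "inj_on ?g ?C" by (rule inj_onI) (simp add: matching_eq_iff[OF m])
  ultimately have "?g ` ?C = ?C" by (intro endo_inj_surj) simp_all
  moreover have "a \<in> ?C" using a by simp
  ultimately obtain c where "c \<in> ?C" "a = m (n + c)" by (metis (no_types, lifting) imageE)
  then have "m a = n + c" "1 \<le> c" using matchingD(1)[OF m] by simp_all
  then show False using a(3) by simp
qed

text \<open>A top arc and a bottom arc in one class are opened into two through lines, which a
  single cap would close again; without top arcs the diagram is a permutation, and linked swaps
  straighten it. The measure adds the number of top points not joined to the point below them and
  the number of top points on top arcs.\<close>

lemma reachable_if_links_respect:
  assumes T: "T \<subseteq> {1..<n}"
  shows "matching n m \<Longrightarrow> links_respect n T m \<Longrightarrow> m \<in> reachable n T"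
proof (induction "card {x \<in> {1..n}. m x \<noteq> n + x} + card {x \<in> {1..n}. m x \<le> n}" arbitrary: m
    rule: less_induct)
  case less
  note m = less.prems(1) and r = less.prems(2)
  note mm = matchingD(1)[OF m]
  let ?U = "\<lambda>m. {x \<in> {1..n}. m x \<noteq> n + x}" and ?A = "\<lambda>m. {x \<in> {1..n}. m x \<le> n}"
  show ?case
  proof (cases "?A m = {}")
    case False
    then obtain a where a: "1 \<le> a" "a \<le> n" "m a \<le> n" by auto
    obtain c where c: "1 \<le> c" "c \<le> n" "linked T a c" "n < m (n + c)"
      using ex_bottom_arc[OF m r a] by blast
    \<comment> \<open>Exchanging \<open>?b\<close> with \<open>n + c\<close> opens the top arc at
      \<open>a\<close> and the bottom arc at \<open>n + c\<close>. As \<open>?m\<close> joins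
      \<open>a\<close> to \<open>n + c\<close>, capping \<open>a\<close> with \<open>?b\<close>
      undoes exactly this exchange.\<close>
    let ?b = "m a" and ?m = "relabel (transpose (m a) (n + c)) m"
    have a2: "a \<in> {1..2*n}" and c2: "n + c \<in> {1..2*n}" using a c by simp_all
    have b2: "?b \<in> {1..2*n}" and ab: "?b \<noteq> a" using matchingD(2,3)[OF m a2] by simp_all
    have lab: "linked T a ?b" using links_respectD[OF r a2] a by (simp add: pos_def)
    then have lbc: "linked T (pos n ?b) (pos n (n + c))"
      using c a linked_trans[OF linked_sym[OF lab] c(3)] by (simp add: pos_def)
    have m': "matching n ?m" by (rule matching_relabel[OF m b2 c2])
    have r': "links_respect n T ?m" by (rule links_respect_relabel[OF r m b2 c2 lbc])
    have ne: "?b \<noteq> n + c" "a \<noteq> n + c" using a c by simp_all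
    have ma: "?m a = n + c" using ab ne by (simp add: relabel_transpose)
    have mc: "m (n + c) \<noteq> ?b" using ne matching_eq_iff[OF m] by metis
    have mb: "?m ?b = m (n + c)"
      using mc matchingD(3)[OF m c2] by (simp add: relabel_transpose)
    have other: "?m x = m x" if "x \<le> n" "x \<noteq> a" "x \<noteq> ?b" for x
    proof -
      have "m x \<noteq> ?b" using that matching_eq_iff[OF m] by metis
      moreover have "m x \<noteq> n + c"
      proof
        assume "m x = n + c"
        then have "m (n + c) = x" using mm by metis
        then show False using c(4) that by simp
      qed
      ultimately show ?thesis using that c by (simp add: relabel_transpose)
    qed
    have "?U ?m \<subseteq> ?U m"
    proof
      fix x assume x: "x \<in> ?U ?m"
      then show "x \<in> ?U m"
      proof (cases "x = a \<or> x = ?b")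
        case True
        \<comment> \<open>In \<open>m\<close> both \<open>a\<close> and \<open>?b\<close> lie on a
          top arc, so they were counted before.\<close>
        then have "m x \<le> n" using a mm by auto
        then show ?thesis using x by auto
      qed (use x other in auto)
    qed
    then have "card (?U ?m) \<le> card (?U m)" by (intro card_mono) simp_all
    moreover have "?A ?m \<subset> ?A m"
    proof
      show "?A ?m \<subseteq> ?A m"
      proof
        fix x assume x: "x \<in> ?A ?m"
        have "x \<noteq> a" "x \<noteq> ?b" using x ma mb c by auto
        then show "x \<in> ?A m" using x other by auto
      qed
      have "a \<in> ?A m" "a \<notin> ?A ?m" using a ma c by simp_all
      then show "?A ?m \<noteq> ?A m" by blast
    qed
    then have "card (?A ?m) < card (?A m)" by (intro psubset_card_mono) simp_all
    ultimately have "?m \<in> reachable n T" using m' r' by (intro less.hyps) simp_all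
    then have "cap a ?b ?m \<in> reachable n T" using lab ab by (intro reachable_cap) auto
    moreover have "cap a ?b ?m = relabel (transpose ?b (n + c)) ?m"
      by (rule cap_adjacent_matching[OF m' b2 ma]) (use ab ne in auto)
    ultimately show ?thesis by (simp only: relabel_transpose_twice)
  next
    case True
    have down: "n < m x" if "1 \<le> x" "x \<le> n" for x
    proof (rule ccontr)
      assume "\<not> n < m x"
      then have "x \<in> ?A m" using that by simp
      then show False using True by blast
    qed
    show ?thesis
    proof (cases "?U m = {}")
      case True
      have "m = pair_diag n []"
      proof
        fix x
        have top: "m y = n + y" if "1 \<le> y" "y \<le> n" for y using True that by auto
        consider "1 \<le> x" "x \<le> n" | y where "1 \<le> y" "y \<le> n" "x = n + y" | "x \<notin> {1..2*n}"
        proof (cases "n < x \<and> x \<le> 2 * n")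
          case True
          then have "x = n + (x - n)" "1 \<le> x - n" "x - n \<le> n" by auto
          then show ?thesis using that by blast
        qed (use that in auto, linarith)
        then show "m x = pair_diag n [] x"
        proof cases
          case 1
          then show ?thesis using top by (simp add: pair_diag_def)
        next
          case 2
          then have "m x = y" using top mm by metis
          then show ?thesis using 2 by (simp add: pair_diag_def)
        next
          case 3
          then show ?thesis using matchingD(4)[OF m] by (auto simp: pair_diag_def)
        qed
      qed
      then show ?thesis using reachable_vertical by simp
    next
      case False
      then obtain x where x: "1 \<le> x" "x \<le> n" "m x \<noteq> n + x" by auto
      define y where "y = m x - n"
      have x2: "x \<in> {1..2*n}" using x by simp
      have y: "m x = n + y" "1 \<le> y" "y \<le> n" "y \<noteq> x"
        using down[OF x(1,2)] matchingD(2)[OF m x2] x(3) unfolding y_def by auto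
      have y2: "y \<in> {1..2*n}" using y by simp
      \<comment> \<open>The line from \<open>x\<close> ends in column \<open>y\<close>; exchanging
        the tops \<open>x\<close> and \<open>y\<close> makes the line at \<open>y\<close> vertical
        and disturbs no vertical line.\<close>
      let ?m = "relabel (transpose x y) m"
      have l: "linked T x y" using links_respectD[OF r x2] x y by (simp add: pos_def)
      then have l': "linked T (pos n x) (pos n y)" using x y by (simp add: pos_def)
      have m': "matching n ?m" by (rule matching_relabel[OF m x2 y2])
      have r': "links_respect n T ?m" by (rule links_respect_relabel[OF r m x2 y2 l'])
      have mz: "?m z = m (transpose x y z)" if z: "1 \<le> z" "z \<le> n" for z
      proof -
        have "1 \<le> transpose x y z" "transpose x y z \<le> n" using z x y by (simp_all add: transpose_def)
        then have "n < m (transpose x y z)" by (rule down)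
        then show ?thesis using x y by (simp add: relabel_transpose)
      qed
      have my: "?m y = n + y" using mz[OF y(2,3)] y(1) by simp
      have "?A ?m = {}"
      proof -
        have lt: "n < ?m z" if z: "1 \<le> z" "z \<le> n" for z
          unfolding mz[OF z] by (rule down) (use z x y in \<open>simp_all add: transpose_def\<close>)
        have "z \<notin> ?A ?m" for z
        proof
          assume "z \<in> ?A ?m"
          then have z: "1 \<le> z" "z \<le> n" "?m z \<le> n" by simp_all
          then show False using lt[OF z(1,2)] by simp
        qed
        then show ?thesis by blast
      qed
      then have "card (?A ?m) = card (?A m)" using \<open>?A m = {}\<close> by (simp only:)
      moreover have "?U ?m \<subset> ?U m"
      proof
        show "?U ?m \<subseteq> ?U m"
        proof
          fix z assume z: "z \<in> ?U ?m"
          have "z \<noteq> y" using z my by auto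
          then show "z \<in> ?U m" using z mz[of z] x by (cases "z = x") auto
        qed
        have "m y \<noteq> n + y" using y matching_eq_iff[OF m] by metis
        then have "y \<in> ?U m" "y \<notin> ?U ?m" using y my by simp_all
        then show "?U ?m \<noteq> ?U m" by blast
      qed
      then have "card (?U ?m) < card (?U m)" by (intro psubset_card_mono) simp_all
      ultimately have "?m \<in> reachable n T" using m' r' by (intro less.hyps) simp_all
      then have "relabel (transpose x y) ?m \<in> reachable n T" using reachable_relabel[OF l] by blast
      then show ?thesis by (simp only: relabel_transpose_twice)
    qed
  qed
qed

subsection \<open>Completeness of the relations\<close>

lemma congr_rel: "(u, v) \<in> rels n \<Longrightarrow> (u @ x, v @ x) \<in> congr n"
  using congr.ctx[OF congr.base, of u v n "[]" x] by simp

lemma congr_Cons: "(u, v) \<in> congr n \<Longrightarrow> (g # u, g # v) \<in> congr n"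
  using congr.ctx[of u v n "[g]" "[]"] by simp

lemma congr_append_left: "(u, v) \<in> congr n \<Longrightarrow> (x @ u, x @ v) \<in> congr n"
  using congr.ctx[of u v n x "[]"] by simp

lemma congr_append_right: "(u, v) \<in> congr n \<Longrightarrow> (u @ x, v @ x) \<in> congr n"
  using congr.ctx[of u v n "[]" x] by simp

lemma E_central:
  assumes "1 \<le> i" "i < n" "1 \<le> gidx g" "gidx g < n"
  shows "(E i # g # x, g # E i # x) \<in> congr n"
proof -
  have "([E i, g], [g, E i]) \<in> congr n"
  proof (cases g)
    case (E j)
    then show ?thesis using assms by (auto intro!: congr.base rels.ecomm)
  next
    case (Z j)
    then show ?thesis using assms by (auto intro!: congr.base rels.ez)
  next
    case (D j)
    then show ?thesis using assms by (auto intro!: congr.sym[OF congr.base] rels.de)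
  qed
  from congr_append_right[OF this, of x] show ?thesis by simp
qed

lemma E_central_word:
  assumes "1 \<le> i" "i < n" "w \<in> words n"
  shows "(E i # w @ x, w @ E i # x) \<in> congr n"
  using assms(3)
proof (induction w)
  case (Cons g w)
  have "(E i # g # w @ x, g # E i # w @ x) \<in> congr n"
    by (rule E_central) (use assms Cons.prems in auto)
  moreover have "(g # E i # w @ x, g # w @ E i # x) \<in> congr n"
    by (rule congr_Cons) (use Cons in auto)
  ultimately show ?case using congr.trans by simp
qed (simp add: congr.refl)

lemma E_absorb_letter:
  assumes "1 \<le> gidx g" "gidx g < n" shows "(E (gidx g) # g # x, g # x) \<in> congr n"
proof -
  have "([E (gidx g), g], [g]) \<in> congr n"
  proof (cases g)
    case (E j)
    then show ?thesis using assms by (auto intro!: congr.base rels.ee)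
  next
    case (Z j)
    then show ?thesis using assms by (auto intro!: congr.base rels.ezi)
  next
    case (D j)
    then have j: "1 \<le> j" "j < n" using assms by simp_all
    have "([E j, D j], [D j, E j]) \<in> congr n" "([D j, E j], [D j]) \<in> congr n"
      by (rule congr.sym[OF congr.base[OF rels.de[OF j j]]] congr.base[OF rels.dei[OF j]])+
    then show ?thesis using D congr.trans by simp
  qed
  from congr_append_right[OF this, of x] show ?thesis by simp
qed

lemma E_absorb_word:
  assumes "i \<in> gidx ` set w" "w \<in> words n" shows "(E i # w @ x, w @ x) \<in> congr n"
  using assms
proof (induction w)
  case (Cons g w)
  have g: "1 \<le> gidx g" "gidx g < n" and w: "w \<in> words n" using Cons.prems(2) by simp_all
  show ?case
  proof (cases "i = gidx g")
    case True
    then show ?thesis using E_absorb_letter[OF g] by simp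
  next
    case False
    then have iw: "i \<in> gidx ` set w" using Cons.prems(1) by simp
    then have "1 \<le> i" "i < n" using w unfolding words_iff by auto
    then have "(E i # g # w @ x, g # E i # w @ x) \<in> congr n" using E_central g by blast
    moreover have "(g # E i # w @ x, g # w @ x) \<in> congr n"
      by (rule congr_Cons[OF Cons.IH[OF iw w]])
    ultimately show ?thesis using congr.trans by simp
  qed
qed simp

section \<open>The corner cut out by a central idempotent\<close>

definition e_word :: "nat set \<Rightarrow> gen list" where
  "e_word T = map E (sorted_list_of_set T)"

lemma e_word_words: "T \<subseteq> {1..<n} \<Longrightarrow> e_word T \<in> words n"
  using finite_subset[of T "{1..<n}"] by (auto simp: e_word_def words_def)

lemma gidx_e_word: "finite T \<Longrightarrow> gidx ` set (e_word T) = T"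
  by (simp add: e_word_def image_image)

lemma e_word_central:
  assumes T: "T \<subseteq> {1..<n}" and g: "1 \<le> gidx g" "gidx g < n"
  shows "(e_word T @ g # x, g # e_word T @ x) \<in> congr n"
proof -
  have "(map E is @ g # x, g # map E is @ x) \<in> congr n" if "set is \<subseteq> {1..<n}" for "is"
    using that
  proof (induction "is")
    case (Cons i "is")
    have "(E i # map E is @ g # x, E i # g # map E is @ x) \<in> congr n"
      by (rule congr_Cons) (use Cons in auto)
    moreover have "(E i # g # map E is @ x, g # E i # map E is @ x) \<in> congr n"
      by (rule E_central) (use Cons.prems g in auto)
    ultimately show ?case using congr.trans by simp
  qed (simp add: congr.refl)
  then show ?thesis using finite_subset[OF T] T by (simp add: e_word_def)
qed

text \<open>Each \<open>E i\<close> moves to a letter of \<open>w\<close> with index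
  \<open>i\<close> and is absorbed there, so \<open>w\<close> already lies in the corner of its own
  index set.\<close>

lemma e_word_absorb:
  assumes w: "w \<in> words n" and T: "T = gidx ` set w"
  shows "(e_word T @ w, w) \<in> congr n"
proof -
  have "(map E is @ w, w) \<in> congr n" if "set is \<subseteq> T" for "is"
    using that
  proof (induction "is")
    case (Cons i "is")
    then have "(E i # map E is @ w, E i # w) \<in> congr n" by (intro congr_Cons) simp
    moreover have "(E i # w, w) \<in> congr n"
      using E_absorb_word[of i w n "[]"] Cons.prems w T by simp
    ultimately show ?case using congr.trans by simp
  qed (simp add: congr.refl)
  then show ?thesis using T by (simp add: e_word_def)
qed

lemma diag_e_word: "diag n (e_word T @ w) = diag n w"
proof -
  have "ops (map E is) m = m" for "is" m by (induction "is") simp_all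
  then show ?thesis unfolding e_word_def diag_ops ops_simps .
qed

text \<open>Congruence in the corner monoid cut out by the central idempotent \<open>e_word T\<close>: there the
  letters \<open>E i\<close> with \<open>i \<in> T\<close> become trivial and the letters \<open>Z i\<close> become involutions.\<close>

definition corner_eq :: "nat \<Rightarrow> nat set \<Rightarrow> gen list \<Rightarrow> gen list \<Rightarrow> bool" where
  "corner_eq n T u v \<longleftrightarrow> (e_word T @ u, e_word T @ v) \<in> congr n"

lemma corner_eq_refl: "corner_eq n T u u"
  by (simp add: corner_eq_def congr.refl)

lemma corner_eq_sym: "corner_eq n T u v \<Longrightarrow> corner_eq n T v u"
  unfolding corner_eq_def by (rule congr.sym)

lemma corner_eq_trans: "corner_eq n T u v \<Longrightarrow> corner_eq n T v w \<Longrightarrow> corner_eq n T u w"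
  unfolding corner_eq_def by (rule congr.trans)

lemma corner_eq_congr: "(u, v) \<in> congr n \<Longrightarrow> corner_eq n T u v"
  unfolding corner_eq_def by (rule congr_append_left)

lemma corner_eq_rel: "(u, v) \<in> rels n \<Longrightarrow> corner_eq n T (u @ x) (v @ x)"
  by (rule corner_eq_congr[OF congr_rel])

lemma corner_eq_Cons:
  assumes T: "T \<subseteq> {1..<n}" and g: "1 \<le> gidx g" "gidx g < n" and uv: "corner_eq n T u v"
  shows "corner_eq n T (g # u) (g # v)"
proof -
  have "(g # e_word T @ u, g # e_word T @ v) \<in> congr n"
    using uv unfolding corner_eq_def by (rule congr_Cons)
  then show ?thesis
    unfolding corner_eq_def
    using e_word_central[OF T g, of u] congr.sym[OF e_word_central[OF T g, of v]] congr.trans by blast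
qed

lemma corner_eq_append:
  assumes "T \<subseteq> {1..<n}" "w \<in> words n" "corner_eq n T u v"
  shows "corner_eq n T (w @ u) (w @ v)"
  using assms(2)
proof (induction w)
  case (Cons g w)
  then have "corner_eq n T (g # w @ u) (g # w @ v)" by (intro corner_eq_Cons[OF assms(1)]) simp_all
  then show ?case by simp
qed (simp add: assms(3))

lemma corner_eq_E:
  assumes T: "T \<subseteq> {1..<n}" and i: "i \<in> T" shows "corner_eq n T (E i # x) x"
proof -
  have in1: "1 \<le> i" "i < n" using T i by auto
  have "(E i # e_word T @ x, e_word T @ E i # x) \<in> congr n"
    by (rule E_central_word[OF in1 e_word_words[OF T]])
  moreover have "(E i # e_word T @ x, e_word T @ x) \<in> congr n"
    by (rule E_absorb_word[OF _ e_word_words[OF T]])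
      (use i T in \<open>simp add: gidx_e_word finite_subset[of T "{1..<n}"]\<close>)
  ultimately show ?thesis unfolding corner_eq_def using congr.sym congr.trans by blast
qed

text \<open>The quotient depends on \<open>n\<close> and \<open>T\<close>, so it is encoded by
  chosen representatives inside the fixed type of words. Equivalent words have the same candidates
  and hence the same choice.\<close>

definition corner_rep :: "nat \<Rightarrow> nat set \<Rightarrow> gen list \<Rightarrow> gen list" where
  "corner_rep n T u = (SOME v. corner_eq n T u v)"

lemma corner_eq_rep: "corner_eq n T u (corner_rep n T u)"
  unfolding corner_rep_def by (rule someI, rule corner_eq_refl)

lemma corner_rep_eq:
  assumes "corner_eq n T u v" shows "corner_rep n T u = corner_rep n T v"
proof -
  have "corner_eq n T u w \<longleftrightarrow> corner_eq n T v w" for w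
    using assms corner_eq_sym corner_eq_trans by blast
  then have "corner_eq n T u = corner_eq n T v" by (rule ext)
  then show ?thesis unfolding corner_rep_def by (simp only:)
qed

lemma corner_rep_rep: "corner_rep n T (corner_rep n T u) = corner_rep n T u"
  by (rule corner_rep_eq[OF corner_eq_sym[OF corner_eq_rep]])

text \<open>Left multiplication on class representatives, extended by the identity to all words, so that
  the relations of the corner monoid hold unconditionally.\<close>

definition corner_op :: "nat \<Rightarrow> nat set \<Rightarrow> gen \<Rightarrow> gen list \<Rightarrow> gen list" where
  "corner_op n T g u = (if corner_rep n T u = u then corner_rep n T (g # u) else u)"

text \<open>On representatives this is the left regular representation, so acting on the class of
  the empty word recovers a word up to \<open>corner_eq\<close>.\<close>

lemma corner_ops_rep:
  assumes T: "T \<subseteq> {1..<n}" and x: "corner_rep n T x = x"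
  shows "w \<in> words n \<Longrightarrow> foldr (corner_op n T) w x = corner_rep n T (w @ x)"
proof (induction w)
  case (Cons g w)
  then have g: "1 \<le> gidx g" "gidx g < n" by simp_all
  have "corner_eq n T (g # w @ x) (g # corner_rep n T (w @ x))"
    by (rule corner_eq_Cons[OF T g corner_eq_rep])
  then have "corner_rep n T (g # w @ x) = corner_rep n T (g # corner_rep n T (w @ x))"
    by (rule corner_rep_eq)
  then show ?case using Cons by (simp add: corner_op_def corner_rep_rep)
qed (simp add: x)

lemma corner_ops_not_rep:
  "corner_rep n T x \<noteq> x \<Longrightarrow> foldr (corner_op n T) w x = x"
  by (induction w) (simp_all add: corner_op_def)

lemma corner_ops_eq:
  assumes T: "T \<subseteq> {1..<n}" and uv: "u \<in> words n" "v \<in> words n"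
    and eq: "\<And>x. corner_eq n T (u @ x) (v @ x)"
  shows "foldr (corner_op n T) u x = foldr (corner_op n T) v x"
proof (cases "corner_rep n T x = x")
  case True
  show ?thesis
    unfolding corner_ops_rep[OF T True uv(1)] corner_ops_rep[OF T True uv(2)]
    by (rule corner_rep_eq[OF eq])
qed (simp add: corner_ops_not_rep)

lemma corner_ops_rel:
  assumes T: "T \<subseteq> {1..<n}" and uv: "(u, v) \<in> rels n" "u \<in> words n"
  shows "foldr (corner_op n T) u x = foldr (corner_op n T) v x"
proof (rule corner_ops_eq[OF T uv(2)])
  show "v \<in> words n" using rels_gidx[OF uv(1)] uv(2) by (simp only: words_iff)
  show "corner_eq n T (u @ x) (v @ x)" for x by (rule corner_eq_rel[OF uv(1)])
qed

lemma brauer_action_corner: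
  assumes T: "T \<subseteq> {1..<n}"
  shows "brauer_action T (\<lambda>i. corner_op n T (Z i)) (\<lambda>i. corner_op n T (D i))"
proof
  show "finite T" using T finite_subset by blast
  have in1: "1 \<le> i" "i < n" if "i \<in> T" for i using T that by auto
  note rel = corner_ops_rel[OF T]
  fix i x assume i: "i \<in> T"
  note ii = in1[OF i]
  \<comment> \<open>The one law on the generators that is no relation verbatim: \<open>Z i\<close>
    twice is \<open>E i\<close>, which is trivial in the corner.\<close>
  have "foldr (corner_op n T) [Z i, Z i] x = foldr (corner_op n T) [] x"
  proof (rule corner_ops_eq[OF T])
    show "corner_eq n T ([Z i, Z i] @ y) ([] @ y)" for y
      using corner_eq_trans[OF corner_eq_rel[OF rels.zz[OF ii]] , of T y y] corner_eq_E[OF T i, of y] by simp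
  qed (use ii in simp_all)
  then show "corner_op n T (Z i) (corner_op n T (Z i) x) = x" by simp
  show "corner_op n T (D i) (corner_op n T (D i) x) = corner_op n T (D i) x"
    using rel[OF rels.dd[OF ii], of x] ii by simp
  show "corner_op n T (Z i) (corner_op n T (D i) x) = corner_op n T (D i) x"
    using rel[OF rels.zd[OF ii], of x] ii by simp
  show "corner_op n T (D i) (corner_op n T (Z i) x) = corner_op n T (D i) x"
    using rel[OF rels.dz[OF ii], of x] ii by simp
  fix j assume j: "j \<in> T"
  note ij = ii in1[OF j]
  show "corner_op n T (Z i) (corner_op n T (Z j) x) = corner_op n T (Z j) (corner_op n T (Z i) x)"
    if "far i j" using rel[OF rels.zcomm[OF ij that], of x] ij by simp
  show "corner_op n T (D i) (corner_op n T (D j) x) = corner_op n T (D j) (corner_op n T (D i) x)"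
    if "far i j" using rel[OF rels.dcomm[OF ij that], of x] ij by simp
  show "corner_op n T (Z i) (corner_op n T (D j) x) = corner_op n T (D j) (corner_op n T (Z i) x)"
    if "far i j" using rel[OF rels.zdfar[OF ij that], of x] ij by simp
  show "corner_op n T (Z i) (corner_op n T (Z j) (corner_op n T (Z i) x))
      = corner_op n T (Z j) (corner_op n T (Z i) (corner_op n T (Z j) x))"
    if "adj i j" using rel[OF rels.zbraid[OF ij that], of x] ij by simp
  show "corner_op n T (Z i) (corner_op n T (D j) (corner_op n T (D i) x))
      = corner_op n T (Z j) (corner_op n T (D i) x)"
    if "adj i j" using rel[OF rels.zdd[OF ij that], of x] ij by simp
  show "corner_op n T (D i) (corner_op n T (D j) (corner_op n T (Z i) x))
      = corner_op n T (D i) (corner_op n T (Z j) x)"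
    if "adj i j" using rel[OF rels.ddz[OF ij that], of x] ij by simp
qed

lemma corner_eq_if_diag_eq:
  assumes T: "T \<subseteq> {1..<n}" and uv: "gidx ` set u \<subseteq> T" "gidx ` set v \<subseteq> T"
    and eq: "diag n u = diag n v"
  shows "corner_eq n T u v"
proof -
  interpret brauer_action T "\<lambda>i. corner_op n T (Z i)" "\<lambda>i. corner_op n T (D i)"
    by (rule brauer_action_corner[OF T])
  have E: "corner_op n T (E i) x = x" if "i \<in> T" for i x
  proof -
    have "foldr (corner_op n T) [E i] x = foldr (corner_op n T) [] x"
    proof (rule corner_ops_eq[OF T])
      show "corner_eq n T ([E i] @ y) ([] @ y)" for y using corner_eq_E[OF T that] by simp
    qed (use T that in auto)
    then show ?thesis by simp
  qed
  have act: "act w x = foldr (corner_op n T) w x" if "gidx ` set w \<subseteq> T" for w x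
    using that
  proof (induction w)
    case (Cons g w)
    then show ?case using E by (cases g) simp_all
  qed simp
  \<comment> \<open>The unit of the corner: words whose operators agree here are equal in the
    corner.\<close>
  let ?r = "corner_rep n T []"
  have words: "u \<in> words n" "v \<in> words n" using uv T by (auto simp: words_iff)
  have "foldr (corner_op n T) u ?r = foldr (corner_op n T) v ?r"
    using act_eq_if_diag_eq[OF T uv eq, of ?r] act uv by simp
  then have "corner_rep n T (u @ ?r) = corner_rep n T (v @ ?r)"
    using corner_ops_rep[OF T corner_rep_rep] words by simp
  then have "corner_eq n T (u @ ?r) (v @ ?r)"
    using corner_eq_rep corner_eq_sym corner_eq_trans by metis
  moreover have "corner_eq n T (w @ []) (w @ ?r)" if "w \<in> words n" for w
    by (rule corner_eq_append[OF T that corner_eq_rep])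
  ultimately show ?thesis
    using words corner_eq_sym corner_eq_trans by (metis append_Nil2)
qed

theorem theorem6p12:
  fixes n :: nat
  shows "(\<forall>w\<in>words n. eval n w \<in> BR n)
       \<and> (\<forall>x\<in>BR n. \<exists>w\<in>words n. eval n w = x)
       \<and> (\<forall>u\<in>words n. \<forall>v\<in>words n. eval n u = eval n v \<longleftrightarrow> (u, v) \<in> congr n)"
proof (intro conjI ballI)
  show "eval n w \<in> BR n" if "w \<in> words n" for w by (rule eval_in_BR[OF that])
next
  fix x assume "x \<in> BR n"
  then obtain I J where x: "x = (I, J)" "brauer n I" "boxed n J" "refines I J" by (auto simp: BR_def)
  obtain m where m: "matching n m" "I = blocks n m" using brauer_imp_blocks[OF x(2)] .
  obtain T where T: "T \<subseteq> {1..<n}" "J = box n T" using boxed_imp_box[OF x(3)] .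
  have "links_respect n T m"
    using x(4) unfolding m(2) T(2) refines_blocks_box[OF m(1)] links_respect_def .
  then have "m \<in> reachable n T" by (rule reachable_if_links_respect[OF T(1) m(1)])
  then obtain w where w: "m = diag n w" "gidx ` set w \<subseteq> T" unfolding reachable_def by blast
  \<comment> \<open>\<open>w\<close> may miss indices of \<open>T\<close>; the prefix adds them
    without changing the diagram.\<close>
  let ?w = "e_word T @ w"
  have fin: "finite T" using T(1) finite_subset by blast
  have "w \<in> words n" using w(2) T(1) by (auto simp: words_iff)
  then have "?w \<in> words n" using e_word_words[OF T(1)] by simp
  moreover have "gidx ` set ?w = T" using gidx_e_word[OF fin] w(2) by (simp add: image_Un) blast
  ultimately have "eval n ?w = x"
    using eval_word[of ?w n] diag_e_word[of n T w] w(1) m(2) T(2) x(1) by simp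
  then show "\<exists>w\<in>words n. eval n w = x" using \<open>?w \<in> words n\<close> by blast
next
  fix u v assume u: "u \<in> words n" and v: "v \<in> words n"
  show "eval n u = eval n v \<longleftrightarrow> (u, v) \<in> congr n"
  proof
    assume "eval n u = eval n v"
    then have eq: "blocks n (diag n u) = blocks n (diag n v)"
      "box n (gidx ` set u) = box n (gidx ` set v)"
      unfolding eval_word[OF u] eval_word[OF v] by simp_all
    have dia: "diag n u = diag n v" by (rule blocks_inj[OF matching_diag[OF u] matching_diag[OF v] eq(1)])
    define T where "T = gidx ` set u"
    have T: "T \<subseteq> {1..<n}" using u unfolding T_def words_iff .
    have Tv: "T = gidx ` set v" unfolding T_def by (rule box_inj[OF _ _ eq(2)]) (use u v words_iff in blast)+
    have "corner_eq n T u v" by (rule corner_eq_if_diag_eq[OF T _ _ dia]) (use T_def Tv in blast)+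
    \<comment> \<open>Both words use exactly the indices in \<open>T\<close>, so the prefix
      \<open>e_word T\<close> can be removed from either one.\<close>
    then show "(u, v) \<in> congr n"
      unfolding corner_eq_def
      using e_word_absorb[OF u T_def] e_word_absorb[OF v Tv] congr.sym congr.trans by meson
  next
    assume c: "(u, v) \<in> congr n"
    have "diag n u = diag n v" unfolding diag_ops by (rule congr_ops[OF c u matching_vertical])
    then show "eval n u = eval n v"
      unfolding eval_word[OF u] eval_word[OF v] by (simp only: congr_gidx[OF c])
  qed
qed

end
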